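(* For every integer $k\ge 2$, the Dehn function of the group $$\Gamma_k := \langle\, a_1,\ldots,a_k,t,p \mid t^{-1}a_1t=a_1,\ t^{-1}a_it=a_ia_{i-1}\ (1<i\le k),\ [p,a_it]=1\ (1\le i\le k)\,\rangle$$ is $\simeq$-equivalent to the $k$-th Ackermann function $A_k$.
   Context: $\mathbb{N}=\{0,1,2,\ldots\}$. $[a,b]=a^{-1}b^{-1}ab$. Ackermann's functions $A_k:\mathbb{N}\to\mathbb{N}$ are defined for integers $k,n\ge 0$ by: $A_0(n)=n+2$; $A_1(0)=0$; $A_k(0)=1$ for $k\ge 2$; and $A_{k+1}(n+1)=A_k(A_{k+1}(n))$ for $k,n\ge 0$. For $f,g:\mathbb{N}\to\mathbb{N}$, write $f\preceq g$ when there exists $C>0$ such that $f(n)\le Cg(Cn+C)+Cn+C$ for all $n$; write $f\simeq g$ when $f\preceq g$ and $g\preceq f$. The Dehn function $\mathrm{Area}:\mathbb{N}\to\mathbb{N}$ of a finite presentation $\langle A\mid R\rangle$ is: $\mathrm{Area}(n)$ is the minimal $N$ such that every word $w$ on $A^{\pm1}$ of length at most $n$ representing the identity is freely equal to a product $\prod_{i=1}^{N'}u_i^{-1}r_iu_i$ with $N'\le N$, the $u_i$ words on $A^{\pm 1}$ and $r_i\in R^{\pm1}$. Up to $\simeq$ it depends only on the group. *)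

theory Defs
  imports "HOL-Algebra.Group"
begin

text \<open>Words on \<open>A\<^sup>\<plusminus>\<^sup>1\<close>: the letter \<open>(x, True)\<close> stands for \<open>x\<close>, and \<open>(x, False)\<close> for its inverse.\<close>

type_synonym 'a word = "('a \<times> bool) list"

definition words :: "'a set \<Rightarrow> 'a word set" where
  "words A = lists (A \<times> UNIV)"

definition inv_word :: "'a word \<Rightarrow> 'a word" where
  "inv_word w = rev (map (\<lambda>(x, b). (x, \<not> b)) w)"

definition comm_word :: "'a word \<Rightarrow> 'a word \<Rightarrow> 'a word" where
  "comm_word u v = inv_word u @ inv_word v @ u @ v"

text \<open>Equality in \<open>\<langle>A | R\<rangle>\<close>: the congruence on words generated by free cancellation and the relators.\<close>

inductive word_eq :: "'a set \<Rightarrow> 'a word set \<Rightarrow> 'a word \<Rightarrow> 'a word \<Rightarrow> bool"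
  for A :: "'a set" and R :: "'a word set" where
  cancel: "x \<in> A \<Longrightarrow> word_eq A R [(x, b), (x, \<not> b)] []"
| relator: "r \<in> R \<Longrightarrow> word_eq A R r []"
| refl: "w \<in> words A \<Longrightarrow> word_eq A R w w"
| sym: "word_eq A R u v \<Longrightarrow> word_eq A R v u"
| trans: "word_eq A R u v \<Longrightarrow> word_eq A R v w \<Longrightarrow> word_eq A R u w"
| append: "word_eq A R u u' \<Longrightarrow> word_eq A R v v' \<Longrightarrow> word_eq A R (u @ v) (u' @ v')"

abbreviation freely_equal :: "'a set \<Rightarrow> 'a word \<Rightarrow> 'a word \<Rightarrow> bool" where
  "freely_equal A \<equiv> word_eq A {}"

definition word_class :: "'a set \<Rightarrow> 'a word set \<Rightarrow> 'a word \<Rightarrow> 'a word set" where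
  "word_class A R w = {v. word_eq A R w v}"

definition presented_group :: "'a set \<Rightarrow> 'a word set \<Rightarrow> 'a word set monoid" where
  "presented_group A R =
    \<lparr>carrier = word_class A R ` words A,
     mult = (\<lambda>U V. {w. \<exists>u\<in>U. \<exists>v\<in>V. word_eq A R (u @ v) w}),
     one = word_class A R []\<rparr>"

text \<open>A list of pairs \<open>(u, r)\<close> encodes the product of the conjugates \<open>u\<inverse> r u\<close>.\<close>

definition conj_product :: "('a word \<times> 'a word) list \<Rightarrow> 'a word" where
  "conj_product cs = concat (map (\<lambda>(u, r). inv_word u @ r @ u) cs)"

definition fills :: "'a set \<Rightarrow> 'a word set \<Rightarrow> nat \<Rightarrow> 'a word \<Rightarrow> bool" where
  "fills A R N w \<longleftrightarrow> (\<exists>cs. length cs \<le> N \<and>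
     set cs \<subseteq> words A \<times> (R \<union> inv_word ` R) \<and> freely_equal A w (conj_product cs))"

definition dehn_function :: "'a set \<Rightarrow> 'a word set \<Rightarrow> nat \<Rightarrow> nat" where
  "dehn_function A R n = (LEAST N. \<forall>w\<in>words A.
     length w \<le> n \<and> word_class A R w = \<one>\<^bsub>presented_group A R\<^esub> \<longrightarrow> fills A R N w)"

fun ackermann :: "nat \<Rightarrow> nat \<Rightarrow> nat" where
  "ackermann 0 n = n + 2"
| "ackermann (Suc 0) 0 = 0"
| "ackermann (Suc (Suc k)) 0 = 1"
| "ackermann (Suc k) (Suc n) = ackermann k (ackermann (Suc k) n)"

definition growth_le :: "(nat \<Rightarrow> nat) \<Rightarrow> (nat \<Rightarrow> nat) \<Rightarrow> bool" (infix "\<preceq>" 50) where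
  "f \<preceq> g \<longleftrightarrow> (\<exists>C>0. \<forall>n. f n \<le> C * g (C * n + C) + C * n + C)"

definition growth_equiv :: "(nat \<Rightarrow> nat) \<Rightarrow> (nat \<Rightarrow> nat) \<Rightarrow> bool" (infix "\<simeq>" 50) where
  "f \<simeq> g \<longleftrightarrow> f \<preceq> g \<and> g \<preceq> f"

datatype hydra_gen = Gen_a nat | Gen_t | Gen_p

abbreviation a_word :: "nat \<Rightarrow> hydra_gen word" where "a_word i \<equiv> [(Gen_a i, True)]"
abbreviation t_word :: "hydra_gen word" where "t_word \<equiv> [(Gen_t, True)]"
abbreviation p_word :: "hydra_gen word" where "p_word \<equiv> [(Gen_p, True)]"

definition hydra_gens :: "nat \<Rightarrow> hydra_gen set" where
  "hydra_gens k = Gen_a ` {1..k} \<union> {Gen_t, Gen_p}"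

text \<open>A relation \<open>u = v\<close> is turned into the relator \<open>u v\<inverse>\<close>.\<close>

definition hydra_relators :: "nat \<Rightarrow> hydra_gen word set" where
  "hydra_relators k =
     {inv_word t_word @ a_word 1 @ t_word @ inv_word (a_word 1)}
   \<union> {inv_word t_word @ a_word i @ t_word @ inv_word (a_word i @ a_word (i - 1)) | i. 1 < i \<and> i \<le> k}
   \<union> {comm_word p_word (a_word i @ t_word) | i. 1 \<le> i \<and> i \<le> k}"

subsection \<open>Well-definedness\<close>

lemma words_simps [simp]:
  "[] \<in> words A" "u @ v \<in> words A \<longleftrightarrow> u \<in> words A \<and> v \<in> words A"
  "l # w \<in> words A \<longleftrightarrow> fst l \<in> A \<and> w \<in> words A"
  by (auto simp: words_def mem_Times_iff)

lemma inv_word_simps [simp]: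
  "inv_word [] = []" "inv_word (u @ v) = inv_word v @ inv_word u"
  "inv_word ((x, b) # w) = inv_word w @ [(x, \<not> b)]" "inv_word (inv_word u) = u"
  by (auto simp: inv_word_def rev_map comp_def case_prod_unfold)

lemma inv_word_in_words [simp]: "inv_word w \<in> words A \<longleftrightarrow> w \<in> words A"
  by (induction w) auto

lemma finite_hydra_gens: "finite (hydra_gens k)"
  by (simp add: hydra_gens_def)

lemma finite_hydra_relators: "finite (hydra_relators k)"
proof -
  have "{i. 1 < i \<and> i \<le> k} \<subseteq> {..k}" "{i. 1 \<le> i \<and> i \<le> k} \<subseteq> {..k}" by auto
  then have "finite {i. 1 < i \<and> i \<le> k}" "finite {i. 1 \<le> i \<and> i \<le> k}"
    by (auto intro: finite_subset)
  then show ?thesis by (simp add: hydra_relators_def)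
qed

lemma hydra_relators_words: "k \<ge> 1 \<Longrightarrow> hydra_relators k \<subseteq> words (hydra_gens k)"
  by (auto simp: hydra_relators_def hydra_gens_def comm_word_def image_iff)

lemma word_eq_trans_eq:
  "word_eq A R u' v \<Longrightarrow> word_eq A R v' w' \<Longrightarrow> u = u' \<Longrightarrow> v = v' \<Longrightarrow> w = w' \<Longrightarrow> word_eq A R u w"
  by (auto intro: word_eq.trans)

context
  fixes A :: "'a set" and R :: "'a word set"
  assumes R: "R \<subseteq> words A"
begin

lemma word_eq_words: "word_eq A R u v \<Longrightarrow> u \<in> words A \<and> v \<in> words A"
  by (induction rule: word_eq.induct) (use R in auto)

lemma word_class_eq_iff:
  assumes "u \<in> words A" shows "word_class A R u = word_class A R v \<longleftrightarrow> word_eq A R u v"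
  unfolding word_class_def set_eq_iff mem_Collect_eq
  by (meson assms word_eq.refl word_eq.sym word_eq.trans)

lemma word_class_eq_one_iff:
  assumes "w \<in> words A"
  shows "word_class A R w = \<one>\<^bsub>presented_group A R\<^esub> \<longleftrightarrow> word_eq A R w []"
  using word_class_eq_iff[OF assms] by (simp add: presented_group_def)

lemma word_eq_inv_left: "w \<in> words A \<Longrightarrow> word_eq A R (inv_word w @ w) []"
proof (induction w)
  case Nil then show ?case by (simp add: word_eq.refl)
next
  case (Cons l w)
  obtain x b where l: "l = (x, b)" by force
  have x: "x \<in> A" and w: "w \<in> words A" using Cons.prems l by auto
  have c: "word_eq A R [(x, \<not> b), (x, b)] []"
    using word_eq.cancel[OF x, of R "\<not> b"] by simp
  have "word_eq A R ([(x, \<not> b), (x, b)] @ w) ([] @ w)"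
    by (rule word_eq.append[OF c word_eq.refl[OF w]])
  then have "word_eq A R (inv_word w @ ([(x, \<not> b), (x, b)] @ w)) (inv_word w @ ([] @ w))"
    by (intro word_eq.append[OF word_eq.refl]) (use w in simp_all)
  from this Cons.IH[OF w] show ?case by (rule word_eq_trans_eq) (simp_all add: l)
qed

lemma mult_word_class:
  assumes "u \<in> words A" "v \<in> words A"
  shows "word_class A R u \<otimes>\<^bsub>presented_group A R\<^esub> word_class A R v = word_class A R (u @ v)"
proof -
  have "(\<exists>x y. word_eq A R u x \<and> word_eq A R v y \<and> word_eq A R (x @ y) w) \<longleftrightarrow> word_eq A R (u @ v) w" for w
  proof
    assume "\<exists>x y. word_eq A R u x \<and> word_eq A R v y \<and> word_eq A R (x @ y) w"
    then obtain x y where "word_eq A R u x" "word_eq A R v y" and w: "word_eq A R (x @ y) w" by blast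
    then have "word_eq A R (u @ v) (x @ y)" by (intro word_eq.append)
    then show "word_eq A R (u @ v) w" using w by (rule word_eq.trans)
  next
    assume "word_eq A R (u @ v) w"
    with word_eq.refl[OF assms(1)] word_eq.refl[OF assms(2)]
    show "\<exists>x y. word_eq A R u x \<and> word_eq A R v y \<and> word_eq A R (x @ y) w" by blast
  qed
  then show ?thesis by (auto simp: presented_group_def word_class_def)
qed

lemma group_presented_group: "group (presented_group A R)"
proof (rule groupI)
  let ?G = "presented_group A R"
  have car: "carrier ?G = word_class A R ` words A"
    and one: "\<one>\<^bsub>?G\<^esub> = word_class A R []" by (simp_all add: presented_group_def)
  show "\<one>\<^bsub>?G\<^esub> \<in> carrier ?G" by (auto simp: car one)
  fix x assume "x \<in> carrier ?G"
  then obtain u where u: "u \<in> words A" "x = word_class A R u" by (auto simp: car)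
  show "\<one>\<^bsub>?G\<^esub> \<otimes>\<^bsub>?G\<^esub> x = x" using u by (simp add: one mult_word_class)
  show "\<exists>y\<in>carrier ?G. y \<otimes>\<^bsub>?G\<^esub> x = \<one>\<^bsub>?G\<^esub>"
  proof
    show "word_class A R (inv_word u) \<in> carrier ?G" using u by (simp add: car)
    show "word_class A R (inv_word u) \<otimes>\<^bsub>?G\<^esub> x = \<one>\<^bsub>?G\<^esub>"
      using u word_eq_inv_left[of u] by (simp add: one mult_word_class word_class_eq_iff)
  qed
  fix y assume "y \<in> carrier ?G"
  then obtain v where v: "v \<in> words A" "y = word_class A R v" by (auto simp: car)
  show "x \<otimes>\<^bsub>?G\<^esub> y \<in> carrier ?G" using u v by (simp add: car mult_word_class)
  fix z assume "z \<in> carrier ?G"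
  then obtain w where "w \<in> words A" "z = word_class A R w" by (auto simp: car)
  then show "x \<otimes>\<^bsub>?G\<^esub> y \<otimes>\<^bsub>?G\<^esub> z = x \<otimes>\<^bsub>?G\<^esub> (y \<otimes>\<^bsub>?G\<^esub> z)"
    using u v by (simp add: mult_word_class)
qed

end

lemmas free_word_eq_words = word_eq_words[where R = "{}", OF empty_subsetI]
lemmas free_inv_left = word_eq_inv_left[where R = "{}", OF empty_subsetI]

context
  fixes A :: "'a set" and R :: "'a word set"
  assumes R: "R \<subseteq> words A"
begin

lemma word_eq_conj_product:
  assumes "word_eq A R u v"
  shows "\<exists>cs. set cs \<subseteq> words A \<times> (R \<union> inv_word ` R) \<and> freely_equal A u (conj_product cs @ v)"
  using assms
proof (induction rule: word_eq.induct)
  case (cancel x b)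
  show ?case by (rule exI[of _ "[]"]) (simp add: conj_product_def word_eq.cancel cancel)
next
  case (relator r)
  then show ?case using R
    by (intro exI[of _ "[([], r)]"]) (auto simp: conj_product_def word_eq.refl)
next
  case (refl w)
  then show ?case by (intro exI[of _ "[]"]) (simp add: conj_product_def word_eq.refl)
next
  case (sym u v)
  then obtain cs where cs: "set cs \<subseteq> words A \<times> (R \<union> inv_word ` R)"
    and eq: "freely_equal A u (conj_product cs @ v)" by blast
  define ds where "ds = rev (map (\<lambda>(u, r). (u, inv_word r)) cs)"
  have ds: "conj_product ds = inv_word (conj_product cs)"
    unfolding ds_def by (induction cs) (auto simp: conj_product_def)
  have sub: "set ds \<subseteq> words A \<times> (R \<union> inv_word ` R)"
    using cs by (force simp: ds_def)
  have v: "v \<in> words A" and P: "conj_product cs \<in> words A"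
    using free_word_eq_words[OF eq] by auto
  have "freely_equal A (conj_product ds @ u) (conj_product ds @ (conj_product cs @ v))"
    using eq P by (intro word_eq.append word_eq.refl) (simp_all add: ds)
  moreover have "freely_equal A ((conj_product ds @ conj_product cs) @ v) ([] @ v)"
    unfolding ds by (intro word_eq.append word_eq.refl free_inv_left v P)
  ultimately have "freely_equal A (conj_product ds @ u) v"
    by (rule word_eq_trans_eq) simp_all
  then have "freely_equal A v (conj_product ds @ u)" by (rule word_eq.sym)
  with sub show ?case by blast
next
  case (trans u v w)
  then obtain cs ds where cs: "set cs \<subseteq> words A \<times> (R \<union> inv_word ` R)"
      "freely_equal A u (conj_product cs @ v)"
    and ds: "set ds \<subseteq> words A \<times> (R \<union> inv_word ` R)"
      "freely_equal A v (conj_product ds @ w)" by blast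
  have "freely_equal A (conj_product cs @ v) (conj_product cs @ (conj_product ds @ w))"
    using ds(2) free_word_eq_words[OF cs(2)] by (intro word_eq.append word_eq.refl) simp_all
  from cs(2) this have "freely_equal A u (conj_product (cs @ ds) @ w)"
    by (rule word_eq_trans_eq) (simp_all add: conj_product_def)
  with cs(1) ds(1) show ?case by (intro exI[of _ "cs @ ds"]) simp
next
  case (append u u' v v')
  then obtain cs ds where cs: "set cs \<subseteq> words A \<times> (R \<union> inv_word ` R)"
      "freely_equal A u (conj_product cs @ u')"
    and ds: "set ds \<subseteq> words A \<times> (R \<union> inv_word ` R)"
      "freely_equal A v (conj_product ds @ v')" by blast
  have u': "u' \<in> words A" and P: "conj_product cs \<in> words A"
    using free_word_eq_words[OF cs(2)] by auto
  have v': "v' \<in> words A" and Q: "conj_product ds \<in> words A"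
    using free_word_eq_words[OF ds(2)] by auto
  define es where "es = map (\<lambda>(x, r). (x @ inv_word u', r)) ds"
  have sub: "set es \<subseteq> words A \<times> (R \<union> inv_word ` R)"
    using ds(1) u' by (auto simp: es_def)
  have es: "freely_equal A (conj_product es @ u') (u' @ conj_product ds)"
    using ds(1) Q unfolding es_def
  proof (induction ds)
    case Nil then show ?case using u' by (simp add: conj_product_def word_eq.refl)
  next
    case (Cons d ds)
    obtain x r where d: "d = (x, r)" by force
    define c where "c = inv_word x @ r @ x"
    define E where "E = conj_product (map (\<lambda>(x, r). (x @ inv_word u', r)) ds)"
    have D: "conj_product ds \<in> words A" and c: "c \<in> words A"
      using Cons.prems(2) by (auto simp: d c_def conj_product_def)
    have IH: "freely_equal A (E @ u') (u' @ conj_product ds)"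
      unfolding E_def using Cons.IH Cons.prems(1) D by simp
    have "freely_equal A ((u' @ c @ inv_word u') @ (E @ u')) ((u' @ c @ inv_word u') @ (u' @ conj_product ds))"
      by (intro word_eq.append word_eq.refl IH) (use u' c in auto)
    moreover have "freely_equal A ((u' @ c) @ ((inv_word u' @ u') @ conj_product ds)) ((u' @ c) @ ([] @ conj_product ds))"
      by (intro word_eq.append word_eq.refl free_inv_left) (use u' c D in auto)
    ultimately have "freely_equal A (u' @ c @ inv_word u' @ E @ u') (u' @ c @ conj_product ds)"
      by (rule word_eq_trans_eq) simp_all
    then show ?case by (simp add: conj_product_def d c_def E_def)
  qed
  have "freely_equal A (u @ v) ((conj_product cs @ u') @ (conj_product ds @ v'))"
    by (intro word_eq.append cs ds)
  moreover have "freely_equal A (conj_product cs @ (u' @ conj_product ds) @ v')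
      (conj_product cs @ (conj_product es @ u') @ v')"
    by (intro word_eq.append word_eq.refl word_eq.sym[OF es] P v')
  ultimately have "freely_equal A (u @ v) (conj_product cs @ (conj_product es @ u') @ v')"
    by (rule word_eq_trans_eq) simp_all
  then have "freely_equal A (u @ v) (conj_product (cs @ es) @ u' @ v')"
    by (simp add: conj_product_def)
  with cs(1) sub show ?case by (intro exI[of _ "cs @ es"]) simp
qed

lemma dehn_function_fills:
  assumes "finite A" "w \<in> words A" "length w \<le> n" "word_class A R w = \<one>\<^bsub>presented_group A R\<^esub>"
  shows "fills A R (dehn_function A R n) w"
proof -
  define W where "W = {w \<in> words A. length w \<le> n \<and> word_class A R w = \<one>\<^bsub>presented_group A R\<^esub>}"
  have "finite {w. set w \<subseteq> A \<times> (UNIV :: bool set) \<and> length w \<le> n}"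
    by (rule finite_lists_length_le) (simp add: assms(1))
  then have fin: "finite W"
    by (rule rev_finite_subset) (auto simp: W_def words_def lists_eq_set)
  have "\<exists>N. fills A R N w" if "w \<in> W" for w
    using that word_eq_conj_product[of w "[]"] word_class_eq_one_iff[OF R, of w]
    by (auto simp: W_def fills_def)
  then obtain N where N: "\<And>w. w \<in> W \<Longrightarrow> fills A R (N w) w" by metis
  have "fills A R (\<Sum>w\<in>W. N w) w" if "w \<in> W" for w
    using N[OF that] member_le_sum[OF that _ fin, of N] unfolding fills_def
    by (meson order_trans zero_le)
  then have "\<exists>M. \<forall>w\<in>words A. length w \<le> n \<and>
      word_class A R w = \<one>\<^bsub>presented_group A R\<^esub> \<longrightarrow> fills A R M w"
    unfolding W_def by blast
  from LeastI_ex[OF this] show ?thesis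
    using assms unfolding dehn_function_def by blast
qed

end

end

theory Submission imports Defs begin

text \<open>Put \<open>x\<^sub>i = a\<^sub>i t\<close>, \<open>x\<^sub>0 = t\<close>, \<open>H\<^sub>k = \<langle>x\<^sub>1, \<dots>, x\<^sub>k\<rangle>\<close>. The group \<open>G\<^sub>k = \<langle>a\<^sub>1, \<dots>, a\<^sub>k, t\<rangle>\<close> is an HNN
  extension of \<open>G\<^sub>k\<^sub>-\<^sub>1\<close> with stable letter \<open>x\<^sub>k\<close>, which conjugates \<open>t\<close> to \<open>b\<^sub>k\<^sub>-\<^sub>1 = a\<^sub>k\<^sub>-\<^sub>1\<inverse> t\<close>, and \<open>H\<^sub>k\<close> is
  the free product of \<open>H\<^sub>k\<^sub>-\<^sub>1\<close> and \<open>\<langle>x\<^sub>k\<rangle>\<close>.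

  Distortion: comparing the normal form of an element of \<open>H\<^sub>k\<close> given by a word of length \<open>n\<close> in \<open>G\<^sub>k\<close> with
  the one given by a word in the \<open>x\<^sub>i\<close>, one passes a power of \<open>t\<close> or \<open>b\<^sub>k\<^sub>-\<^sub>1\<close> through at most \<open>n\<close> syllables.
  Each passage enlarges the exponent at most by the corresponding function for \<open>k - 1\<close>, so an \<open>n\<close>-fold
  iteration, that is, the step from \<open>A\<^sub>k\<^sub>-\<^sub>1\<close> to \<open>A\<^sub>k\<close>, bounds the length in \<open>H\<^sub>k\<close>.

  Upper bound: by Britton's lemma a trivial word of \<open>\<Gamma>\<^sub>k\<close> that involves \<open>p\<close> contains a subword \<open>p u p\<inverse>\<close> or
  \<open>p\<inverse> u p\<close> with \<open>u\<close> free of \<open>p\<close> and in \<open>H\<^sub>k\<close>. Rewriting \<open>u\<close> in the \<open>x\<^sub>i\<close>, removing the two letters \<open>p\<close> and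
  rewriting back costs a polynomial in the distortion and does not lengthen the word.

  Lower bound: \<open>(t\<inverse> a\<^sub>k)\<^sup>n = h t\<^sup>-\<^sup>y\<close> with \<open>h\<close> a positive word in the \<open>x\<^sub>i\<close> of length about \<open>A\<^sub>k(n)\<close>, and
  \<open>q = x\<^sub>2 x\<^sub>1 x\<^sub>2\<inverse>\<close> commutes with \<open>t\<close>. Hence conjugating \<open>q\<close> by \<open>(t\<inverse> a\<^sub>k)\<^sup>n\<close> gives a word of length \<open>O(n)\<close>
  equal to the reduced word \<open>h q h\<inverse>\<close>, and its commutator with \<open>p\<close> needs at least \<open>|h|\<close> relators.\<close>

section \<open>Free groups\<close>

fun push :: "'a \<times> bool \<Rightarrow> 'a word \<Rightarrow> 'a word" where
  "push l [] = [l]"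
| "push l (m # w) = (if m = (fst l, \<not> snd l) then w else l # m # w)"

definition reduce :: "'a word \<Rightarrow> 'a word" where
  "reduce w = foldr push w []"

fun reduced :: "'a word \<Rightarrow> bool" where
  "reduced (l # m # w) \<longleftrightarrow> m \<noteq> (fst l, \<not> snd l) \<and> reduced (m # w)"
| "reduced w \<longleftrightarrow> True"

lemma reduced_tl: "reduced (l # w) \<Longrightarrow> reduced w"
  by (cases w) auto

lemma reduced_push: "reduced w \<Longrightarrow> reduced (push l w)"
  by (cases w) (auto dest: reduced_tl)

lemma reduced_foldr_push: "reduced w \<Longrightarrow> reduced (foldr push u w)"
  by (induction u) (auto intro: reduced_push)

lemma reduced_reduce [simp]: "reduced (reduce w)"
  by (simp add: reduce_def reduced_foldr_push)

lemma push_reduced_Cons: "reduced (l # w) \<Longrightarrow> push l w = l # w"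
  by (cases w) auto

lemma push_push_inverse: "reduced w \<Longrightarrow> push (x, b) (push (x, \<not> b) w) = w"
  by (cases w) (auto dest: push_reduced_Cons)

text \<open>Van der Waerden's argument: prepending letters with cancellation is an action of the
  free group on reduced words, so freely equal words act alike and reduced forms are unique without
  a confluence proof.\<close>

lemma foldr_push_freely_equal:
  "freely_equal A u v \<Longrightarrow> reduced w \<Longrightarrow> foldr push u w = foldr push v w"
proof (induction arbitrary: w rule: word_eq.induct)
  case (cancel x b)
  then show ?case by (simp add: push_push_inverse)
qed (auto simp: reduced_foldr_push)

lemma reduce_freely_equal: "freely_equal A u v \<Longrightarrow> reduce u = reduce v"
  by (simp add: reduce_def foldr_push_freely_equal)

lemma reduce_Cons: "reduce (l # w) = push l (reduce w)"
  by (simp add: reduce_def)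

lemma reduce_Nil [simp]: "reduce [] = []"
  by (simp add: reduce_def)

lemma reduce_reduced: "reduced w \<Longrightarrow> reduce w = w"
proof (induction w)
  case (Cons l w)
  then show ?case using reduced_tl[OF Cons.prems] by (simp add: reduce_Cons push_reduced_Cons)
qed simp

lemma length_push: "length (push l w) \<le> Suc (length w)"
  by (cases w) auto

lemma length_reduce: "length (reduce w) \<le> length w"
  by (induction w) (auto simp: reduce_Cons intro: order_trans[OF length_push])

lemma freely_equal_push: "l # w \<in> words A \<Longrightarrow> freely_equal A (l # w) (push l w)"
proof (cases w)
  case (Cons m v)
  assume A: "l # w \<in> words A"
  show ?thesis
  proof (cases "m = (fst l, \<not> snd l)")
    case True
    have "freely_equal A ([(fst l, snd l), (fst l, \<not> snd l)] @ v) ([] @ v)"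
      by (intro word_eq.append word_eq.cancel word_eq.refl) (use A Cons in auto)
    then show ?thesis using True Cons by simp
  qed (use A Cons in \<open>auto intro: word_eq.refl\<close>)
qed (auto intro: word_eq.refl)

lemma freely_equal_reduce: "w \<in> words A \<Longrightarrow> freely_equal A w (reduce w)"
proof (induction w)
  case (Cons l w)
  then have IH: "freely_equal A w (reduce w)" by simp
  have "freely_equal A ([l] @ w) ([l] @ reduce w)"
    by (intro word_eq.append word_eq.refl IH) (use Cons.prems in auto)
  moreover have "freely_equal A (l # reduce w) (push l (reduce w))"
    using Cons.prems free_word_eq_words[OF IH] by (intro freely_equal_push) auto
  ultimately show ?case by (auto simp: reduce_Cons intro: word_eq.trans)
qed (auto intro: word_eq.refl)

lemma freely_equal_iff_reduce:
  assumes "u \<in> words A" "v \<in> words A"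
  shows "freely_equal A u v \<longleftrightarrow> reduce u = reduce v"
proof
  assume "reduce u = reduce v"
  with freely_equal_reduce[OF assms(1)] freely_equal_reduce[OF assms(2)]
  show "freely_equal A u v" by (metis word_eq.sym word_eq.trans)
qed (rule reduce_freely_equal)

lemma words_UNIV [simp]: "w \<in> words UNIV"
  by (simp add: words_def)

lemma in_words_iff: "w \<in> words A \<longleftrightarrow> fst ` set w \<subseteq> A"
  by (induction w) auto

section \<open>Evaluation of words in a group\<close>

definition eval :: "('a \<Rightarrow> 'g) \<Rightarrow> 'a word \<Rightarrow> 'g::group_add" where
  "eval f w = sum_list (map (\<lambda>(x, b). if b then f x else - f x) w)"

lemma eval_simps [simp]:
  "eval f [] = 0" "eval f ((x, b) # w) = (if b then f x else - f x) + eval f w"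
  "eval f (u @ v) = eval f u + eval f v"
  by (simp_all add: eval_def)

lemma eval_inv_word [simp]: "eval f (inv_word w) = - eval f w"
  by (induction w) (auto simp: minus_add)

lemma eval_word_eq:
  "word_eq A R u v \<Longrightarrow> (\<And>r. r \<in> R \<Longrightarrow> eval f r = 0) \<Longrightarrow> eval f u = eval f v"
  by (induction rule: word_eq.induct) auto

lemma eval_freely_equal: "freely_equal A u v \<Longrightarrow> eval f u = eval f v"
  by (rule eval_word_eq) auto

lemma eval_reduce [simp]: "eval f (reduce w) = eval f w"
  by (rule eval_freely_equal[OF word_eq.sym[OF freely_equal_reduce[OF words_UNIV]]])

text \<open>An entry is the sign of a stable letter together with the syllable after it. A pinch is
  a syllable satisfying \<open>P\<close> between opposite signs; keeping \<open>P\<close> abstract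
  serves HNN extensions and free products alike.\<close>

fun no_pinch :: "(bool \<Rightarrow> 'v \<Rightarrow> bool) \<Rightarrow> (bool \<times> 'v) list \<Rightarrow> bool" where
  "no_pinch P ((b, v) # (b', v') # l) \<longleftrightarrow> \<not> (b' = (\<not> b) \<and> P b v) \<and> no_pinch P ((b', v') # l)"
| "no_pinch P l \<longleftrightarrow> True"

lemma no_pinch_tl: "no_pinch P (s # l) \<Longrightarrow> no_pinch P l"
  by (cases s; cases l) auto

fun join :: "'a \<Rightarrow> 'a word \<Rightarrow> (bool \<times> 'a word) list \<Rightarrow> 'a word" where
  "join k v [] = v"
| "join k v ((b, u) # l) = v @ (k, b) # join k u l"

lemma foldr_push_fresh:
  "k \<notin> fst ` set v \<Longrightarrow> foldr push v ((k, b) # r) = reduce v @ (k, b) # r"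
proof (induction v)
  case (Cons l v)
  then have "foldr push (l # v) ((k, b) # r) = push l (reduce v @ (k, b) # r)" "k \<noteq> fst l"
    by auto
  then show ?case by (cases "reduce v") (auto simp: reduce_Cons)
qed simp

lemma set_push: "set (push l w) \<subseteq> insert l (set w)"
  by (cases w) auto

lemma set_reduce: "set (reduce w) \<subseteq> set w"
  by (induction w) (use set_push in \<open>force simp: reduce_Cons\<close>)+

lemma fst_set_reduce: "k \<notin> fst ` set v \<Longrightarrow> k \<notin> fst ` set (reduce v)"
  using set_reduce by fastforce

text \<open>Opposite letters \<open>k\<close> can only meet across a syllable that reduces to the
  empty word. Without one, free reduction works inside the syllables, as in the normal form of a
  free product with the cyclic group of \<open>k\<close>.\<close>

lemma reduce_join:
  assumes "k \<notin> fst ` set v" "\<And>b u. (b, u) \<in> set l \<Longrightarrow> k \<notin> fst ` set u"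
    and "no_pinch (\<lambda>_ u. reduce u = []) l"
  shows "reduce (join k v l) = join k (reduce v) (map (apsnd reduce) l)"
  using assms
proof (induction l arbitrary: v)
  case (Cons s l)
  obtain b u where s: "s = (b, u)" by force
  have u: "k \<notin> fst ` set u" using Cons.prems(2) s by auto
  have IH: "reduce (join k u l) = join k (reduce u) (map (apsnd reduce) l)"
    using Cons.prems s by (intro Cons.IH) (auto dest: no_pinch_tl)
  have "push (k, b) (reduce (join k u l)) = (k, b) # reduce (join k u l)"
  proof (cases "reduce u")
    case Nil
    show ?thesis
    proof (cases l)
      case (Cons s' l')
      then obtain b' u' where "s' = (b', u')" by force
      then have "b' = b" using Cons Nil s Cons.prems(3) by auto
      then show ?thesis using IH Cons Nil \<open>s' = _\<close> by simp
    qed (use IH Nil in simp)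
  next
    case (Cons m u')
    then have "fst m \<noteq> k" using fst_set_reduce[OF u] by auto
    then show ?thesis using IH Cons by (cases l) auto
  qed
  then have "reduce (join k v (s # l)) = foldr push v ((k, b) # reduce (join k u l))"
    by (simp add: s reduce_def)
  then show ?case
    using Cons.prems(1) s IH by (simp add: foldr_push_fresh)
qed simp

lemma append_fresh_eq:
  assumes "u @ (k, b) # r = u' @ (k, b') # r'" "k \<notin> fst ` set u" "k \<notin> fst ` set u'"
  shows "u = u' \<and> b = b' \<and> r = r'"
  using assms
proof (induction u arbitrary: u')
  case Nil then show ?case by (cases u') auto
next
  case (Cons l u) then show ?case by (cases u') auto
qed

section \<open>The group \<open>G\<close> as a semidirect product\<close>

declare One_nat_def [simp del]

text \<open>In the generators \<open>x\<^sub>0 = t\<close> and \<open>x\<^sub>i = a\<^sub>i t\<close> (so that \<open>a\<^sub>0 = 1\<close>) the relations of all the groups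
  \<open>G\<^sub>k = \<langle>a\<^sub>1, \<dots>, a\<^sub>k, t\<rangle>\<close> take the uniform shape \<open>x\<^sub>i\<inverse> x\<^sub>0 x\<^sub>i = x\<^sub>0 x\<^sub>i\<^sub>-\<^sub>1\<inverse> x\<^sub>0\<close>. The type \<open>hyd\<close> is their union;
  it is written additively because \<open>group_add\<close> is the type class of non-commutative groups.\<close>

definition hyd_rel :: "nat word set" where
  "hyd_rel = {[(i, False), (0, True), (i, True), (0, False), (i - 1, True), (0, False)] | i. 1 \<le> i}"

lemma hyd_rel_words: "hyd_rel \<subseteq> words UNIV"
  by (auto simp: hyd_rel_def)

quotient_type hyd = "nat word" / "word_eq UNIV hyd_rel"
proof (rule equivpI)
  show "reflp (word_eq UNIV hyd_rel)" by (rule reflpI) (simp add: word_eq.refl)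
  show "symp (word_eq UNIV hyd_rel)" by (rule sympI) (rule word_eq.sym)
  show "transp (word_eq UNIV hyd_rel)" by (rule transpI) (rule word_eq.trans)
qed

instantiation hyd :: group_add
begin

lift_definition zero_hyd :: hyd is "[]" .

lift_definition plus_hyd :: "hyd \<Rightarrow> hyd \<Rightarrow> hyd" is "(@)"
  by (rule word_eq.append)

lift_definition uminus_hyd :: "hyd \<Rightarrow> hyd" is inv_word
proof -
  fix u v :: "nat word" assume uv: "word_eq UNIV hyd_rel u v"
  have left: "word_eq UNIV hyd_rel (inv_word w @ w) []" for w
    by (rule word_eq_inv_left[OF hyd_rel_words]) simp
  have "word_eq UNIV hyd_rel (inv_word u @ v @ inv_word v) (inv_word u @ [])"
    using left[of "inv_word v"] by (intro word_eq.append word_eq.refl) simp_all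
  moreover have "word_eq UNIV hyd_rel (inv_word u @ v) (inv_word u @ u)"
    by (intro word_eq.append word_eq.refl word_eq.sym[OF uv]) simp
  then have "word_eq UNIV hyd_rel (inv_word u @ v) []"
    using left word_eq.trans by blast
  then have "word_eq UNIV hyd_rel ((inv_word u @ v) @ inv_word v) ([] @ inv_word v)"
    by (intro word_eq.append word_eq.refl) simp_all
  ultimately show "word_eq UNIV hyd_rel (inv_word u) (inv_word v)"
    by simp (metis word_eq.sym word_eq.trans)
qed

definition minus_hyd :: "hyd \<Rightarrow> hyd \<Rightarrow> hyd" where
  "minus_hyd g h = g + - h"

instance
proof
  fix a b c :: hyd
  show "a + b + c = a + (b + c)" by transfer (simp add: word_eq.refl)
  show "0 + a = a" by transfer (simp add: word_eq.refl)
  show "a + 0 = a" by transfer (simp add: word_eq.refl)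
  show "- a + a = 0" by transfer (rule word_eq_inv_left[OF hyd_rel_words], simp)
  show "a + - b = a - b" by (simp add: minus_hyd_def)
qed

end

lift_definition gx :: "nat \<Rightarrow> hyd" is "\<lambda>i. [(i, True)]" .

lemma abs_hyd_eq_eval: "abs_hyd w = eval gx w"
proof (induction w)
  case Nil then show ?case by (simp add: zero_hyd.abs_eq)
next
  case (Cons l w)
  obtain i b where l: "l = (i, b)" by force
  have "abs_hyd [(i, b)] = (if b then gx i else - gx i)"
    by (simp add: gx.abs_eq uminus_hyd.abs_eq)
  moreover have "abs_hyd (l # w) = abs_hyd [l] + abs_hyd w"
    by (simp add: plus_hyd.abs_eq)
  ultimately show ?case using Cons l by simp
qed

lemma eval_x_eq_iff: "eval gx u = eval gx v \<longleftrightarrow> word_eq UNIV hyd_rel u v"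
  by (simp add: abs_hyd_eq_eval[symmetric] hyd.abs_eq_iff)

lemma x_conj: "- gx (Suc i) + gx 0 + gx (Suc i) = gx 0 - gx i + gx 0"
proof -
  have "[(Suc i, False), (0, True), (Suc i, True), (0, False), (i, True), (0, False)] \<in> hyd_rel"
    by (force simp: hyd_rel_def)
  then have "eval gx [(Suc i, False), (0, True), (Suc i, True), (0, False), (i, True), (0, False)] = eval gx []"
    unfolding eval_x_eq_iff by (rule word_eq.relator)
  then have "(- gx (Suc i) + gx 0 + gx (Suc i)) + - (gx 0 - gx i + gx 0) = 0"
    by (simp add: minus_add add.assoc)
  then show ?thesis by (simp add: eq_neg_iff_add_eq_0 minus_equation_iff)
qed

section \<open>Integer powers, written as multiples\<close>

definition zm :: "int \<Rightarrow> 'g::group_add \<Rightarrow> 'g" where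
  "zm j g = (if 0 \<le> j then ((+) g ^^ nat j) 0 else ((+) (- g) ^^ nat (- j)) 0)"

lemma zm_0 [simp]: "zm 0 g = 0" and zm_1 [simp]: "zm 1 g = g"
  by (simp_all add: zm_def)

text \<open>With \<open>simp only\<close> these rules decide identities in free groups; the default simpset would fold
  \<open>u + - v\<close> back into differences.\<close>

lemmas group_norm = add.assoc minus_add diff_conv_add_uminus minus_minus minus_zero
  add_minus_cancel minus_add_cancel right_minus left_minus add_0_left add_0_right

lemma zm_Suc: "zm (j + 1) g = g + zm j g"
proof (cases "0 \<le> j")
  case True then show ?thesis by (simp add: zm_def nat_add_distrib)
next
  case False
  then obtain n where j: "j = - int n - 1" by (intro that[of "nat (- j - 1)"]) simp
  show ?thesis by (cases "n = 0") (auto simp: zm_def j nat_add_distrib)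
qed

lemma zm_diff1: "zm (j - 1) g = - g + zm j g"
  using zm_Suc[of "j - 1" g] by (simp add: add.assoc[symmetric])

lemma zm_add: "zm (i + j) g = zm i g + zm j g"
proof (induction i rule: int_induct[where k = 0])
  case (step1 i)
  have "zm (i + 1 + j) g = g + zm (i + j) g" using zm_Suc[of "i + j" g] by (simp add: add_ac)
  then show ?case using step1 by (simp add: zm_Suc add.assoc)
next
  case (step2 i)
  have "zm (i - 1 + j) g = - g + zm (i + j) g" using zm_diff1[of "i + j" g] by (simp add: algebra_simps)
  then show ?case unfolding step2 zm_diff1 by (simp only: add.assoc)
qed simp

lemma zm_minus [simp]: "zm (- j) g = - zm j g"
  using zm_add[of "- j" j g] by (simp add: eq_neg_iff_add_eq_0)

lemma zm_diff: "zm (i - j) g = zm i g - zm j g"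
  using zm_add[of i "- j" g] by simp

lemma zm_conj: "zm j (- c + g + c) = - c + zm j g + c"
proof (induction j rule: int_induct[where k = 0])
  case (step1 i) then show ?case by (simp add: zm_Suc add.assoc)
next
  case (step2 i) then show ?case unfolding zm_diff1 by (simp only: group_norm)
qed simp

lemma zm_commute:
  assumes "g + h = h + (g :: 'g::group_add)"
  shows "g + zm j h = zm j h + g"
proof -
  have "- g + h + g = - g + (g + h)" unfolding assms by (simp only: group_norm)
  then have "- g + h + g = h" by (simp only: group_norm)
  then have "zm j h = - g + zm j h + g" using zm_conj[of j g h] by (simp only:)
  then have "g + zm j h = g + (- g + zm j h + g)" by (rule arg_cong)
  then show ?thesis by (simp only: group_norm)
qed

lemma uminus_commute:
  assumes "g + h = h + (g :: 'g::group_add)"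
  shows "- g + h = h + - g"
proof -
  have "- g + (h + g) + - g = - g + (g + h) + - g" by (simp only: assms)
  then show ?thesis by (simp only: group_norm)
qed

lemma zm_uminus: "zm j (- g) = - zm j g"
proof (induction j rule: int_induct[where k = 0])
  case (step1 i)
  have "zm (i + 1) (- g) = - (zm i g + g)" unfolding zm_Suc step1 by (simp only: group_norm)
  also have "zm i g + g = zm (i + 1) g" by (simp add: zm_add)
  finally show ?case .
next
  case (step2 i)
  have "zm (i - 1) (- g) = - (zm i g - g)" unfolding zm_diff1 step2 by (simp only: group_norm)
  also have "zm i g - g = zm (i - 1) g" using zm_add[of i "- 1" g] by simp
  finally show ?case .
qed simp

lemma zm_zm: "zm i (zm j g) = zm (i * j) g"
proof (induction i rule: int_induct[where k = 0])
  case (step1 i)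
  have "(i + 1) * j = j + i * j" by (simp add: algebra_simps)
  then show ?case using step1 by (simp only: zm_Suc zm_add[of j])
next
  case (step2 i)
  have "(i - 1) * j = - j + i * j" by (simp add: algebra_simps)
  then show ?case using step2 by (simp only: zm_diff1 zm_add[of "- j"] zm_minus)
qed simp

lemma zm_add_commute:
  assumes "g + h = h + (g :: 'g::group_add)"
  shows "zm j (g + h) = zm j g + zm j h"
proof (induction j rule: int_induct[where k = 0])
  case (step1 i)
  have "zm (i + 1) (g + h) = g + (h + zm i g) + zm i h" unfolding zm_Suc step1 by (simp only: group_norm)
  also have "\<dots> = g + (zm i g + h) + zm i h" by (simp only: zm_commute[OF assms[symmetric]])
  also have "\<dots> = zm (i + 1) g + zm (i + 1) h" by (simp only: zm_Suc group_norm)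
  finally show ?case .
next
  case (step2 i)
  have "zm (i - 1) (g + h) = (- h + zm (i - 1) g) + zm i h" unfolding zm_diff1 step2 by (simp only: group_norm)
  also have "\<dots> = zm (i - 1) g + - h + zm i h"
    by (simp only: uminus_commute[OF zm_commute[OF assms[symmetric]]])
  also have "\<dots> = zm (i - 1) g + zm (i - 1) h" unfolding zm_diff1 by (simp only: group_norm)
  finally show ?case .
qed simp

text \<open>Words for \<open>\<theta>\<^sup>m(a\<^sub>i)\<close> and \<open>\<theta>\<^sup>-\<^sup>m(a\<^sub>i)\<close>, where \<open>\<theta>\<close> is conjugation \<open>g \<mapsto> t\<inverse> g t\<close>.
  \<open>Th e i\<close> stands for \<open>t\<^sup>e a\<^sub>i t\<^sup>-\<^sup>e\<close>, and \<open>phi e w\<close> is the free part of \<open>t\<^sup>e w\<close> once all powers of \<open>t\<close> are moved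
  to the right.\<close>

fun theta_pos :: "nat \<Rightarrow> nat \<Rightarrow> nat word" where
  "theta_pos m 0 = []"
| "theta_pos 0 (Suc i) = [(Suc i, True)]"
| "theta_pos (Suc m) (Suc i) = theta_pos m (Suc i) @ theta_pos m i"

fun theta_neg :: "nat \<Rightarrow> nat \<Rightarrow> nat word" where
  "theta_neg m 0 = []"
| "theta_neg 0 (Suc i) = [(Suc i, True)]"
| "theta_neg (Suc m) (Suc i) = theta_neg m (Suc i) @ inv_word (theta_neg (Suc m) i)"

definition Th :: "int \<Rightarrow> nat \<Rightarrow> nat word" where
  "Th e i = (if e \<le> 0 then theta_pos (nat (- e)) i else theta_neg (nat e) i)"

fun phi :: "int \<Rightarrow> nat word \<Rightarrow> nat word" where
  "phi e [] = []"
| "phi e ((i, True) # w) = Th e i @ phi (e + 1) w"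
| "phi e ((i, False) # w) = inv_word (Th (e - 1) i) @ phi (e - 1) w"

lemma Th_0 [simp]: "Th e 0 = []"
  by (simp add: Th_def)

lemma freely_equal_inv_right: "freely_equal UNIV (w @ inv_word w) []"
  using free_inv_left[of "inv_word w" UNIV] by simp

lemma theta_0 [simp]: "theta_pos 0 i = theta_neg 0 i"
  by (cases i) auto

text \<open>This is t^-1 a_i t = a_i a_(i-1) conjugated by t^e. For \<open>e\<close> at most 0 it is
  the recursion of \<open>theta_pos\<close>; for positive \<open>e\<close> the second factor cancels
  the tail that \<open>theta_neg\<close> puts into the first.\<close>

lemma Th_rec: "1 \<le> i \<Longrightarrow> freely_equal UNIV (Th (e - 1) i) (Th e i @ Th e (i - 1))"
proof (cases "e \<le> 0")
  case True
  assume "1 \<le> i"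
  then obtain j where i: "i = Suc j" by (cases i) auto
  have "nat (- (e - 1)) = Suc (nat (- e))" using True by simp
  then show ?thesis using True by (simp add: Th_def i word_eq.refl)
next
  case False
  assume "1 \<le> i"
  then obtain j where i: "i = Suc j" by (cases i) auto
  define m where "m = nat (e - 1)"
  have e: "e = int (Suc m)" using False by (simp add: m_def)
  \<comment> \<open>For \<open>m = 0\<close> the left side falls under the other branch of
    \<open>Th\<close>; the two branches agree there by \<open>theta_0\<close>.\<close>
  have "Th (e - 1) i = theta_neg m i" by (cases "m = 0") (auto simp: Th_def e)
  moreover have "nat e = Suc m" using False by (simp add: m_def)
  then have "Th e i @ Th e (i - 1) = theta_neg m i @ inv_word (theta_neg (Suc m) j) @ theta_neg (Suc m) j"
    using False by (simp add: Th_def i)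
  moreover have "freely_equal UNIV (theta_neg m i @ (inv_word (theta_neg (Suc m) j) @ theta_neg (Suc m) j)) (theta_neg m i @ [])"
    by (intro word_eq.append word_eq.refl free_inv_left) simp_all
  ultimately show ?thesis by (simp add: word_eq.sym)
qed

definition expo :: "'a word \<Rightarrow> int" where
  "expo w = eval (\<lambda>_. 1) w"

lemma expo_simps [simp]:
  "expo [] = 0" "expo ((i, b) # w) = (if b then 1 else - 1) + expo w"
  "expo (u @ v) = expo u + expo v" "expo (inv_word u) = - expo u"
  by (simp_all add: expo_def)

lemma phi_append: "phi e (u @ v) = phi e u @ phi (e + expo u) v"
  by (induction e u rule: phi.induct) (simp_all add: algebra_simps)

lemma expo_word_eq: "word_eq UNIV hyd_rel u v \<Longrightarrow> expo u = expo v"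
  unfolding expo_def by (rule eval_word_eq) (auto simp: hyd_rel_def)

text \<open>With \<open>expo\<close> this gives well-defined coordinates on \<open>hyd\<close>, a
  free part and an exponent. On a relator the letters of index 0 only shift the exponent, and what
  remains is \<open>Th_rec\<close>.\<close>

lemma phi_word_eq: "word_eq UNIV hyd_rel u v \<Longrightarrow> freely_equal UNIV (phi e u) (phi e v)"
proof (induction arbitrary: e rule: word_eq.induct)
  case (cancel i b)
  show ?case
    by (cases b) (simp_all add: freely_equal_inv_right free_inv_left)
next
  case (relator r)
  then obtain i where i: "1 \<le> i"
    and r: "r = [(i, False), (0, True), (i, True), (0, False), (i - 1, True), (0, False)]"
    by (auto simp: hyd_rel_def)
  have "freely_equal UNIV (inv_word (Th (e - 1) i) @ (Th e i @ Th e (i - 1))) (inv_word (Th (e - 1) i) @ Th (e - 1) i)"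
    by (intro word_eq.append word_eq.refl word_eq.sym[OF Th_rec] i) simp
  then have "freely_equal UNIV (inv_word (Th (e - 1) i) @ (Th e i @ Th e (i - 1))) []"
    using free_inv_left[OF words_UNIV] by (blast intro: word_eq.trans)
  then show ?case by (simp add: r)
next
  case (append u u' v v')
  then show ?case
    using expo_word_eq[OF append.hyps(1)] by (auto simp: phi_append intro: word_eq.append)
qed (auto intro: word_eq.refl word_eq.sym word_eq.trans)

lift_definition ex :: "hyd \<Rightarrow> int" is expo
  by (rule expo_word_eq)

lemma ex_simps [simp]: "ex 0 = 0" "ex (g + h) = ex g + ex h" "ex (- g) = - ex g" "ex (gx i) = 1"
  by (transfer, simp)+

lemma ex_diff [simp]: "ex (g - h) = ex g - ex h"
  by (metis diff_conv_add_uminus ex_simps(2,3))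

lemma ex_zm [simp]: "ex (zm j g) = j * ex g"
  by (induction j rule: int_induct[where k = 0]) (auto simp: zm_Suc zm_diff1 algebra_simps)

lemma ex_eval: "ex (eval gx w) = expo w"
  by (induction w) auto

section \<open>Recovering a group element from its free part\<close>

abbreviation T :: "int \<Rightarrow> hyd" where "T j \<equiv> zm j (gx 0)"

abbreviation ga :: "nat \<Rightarrow> hyd" where "ga i \<equiv> gx i - gx 0"

text \<open>The relation \<open>x_conj\<close> in the original generators; since
  \<open>ga 0 = 0\<close>, it includes the one saying that t and a_1 commute.\<close>

lemma a_conj: "- gx 0 + ga (Suc i) + gx 0 = ga (Suc i) + ga i"
proof -
  have "gx 0 + gx (Suc i) = gx (Suc i) + (gx 0 - gx i + gx 0)"
    using x_conj[of i] by (metis add.assoc add_minus_cancel)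
  then have "- gx 0 + gx (Suc i) - gx 0 + gx 0 - (gx i - gx 0) = gx (Suc i) - gx 0"
    by (metis (no_types) add.assoc add_diff_cancel diff_add_cancel minus_add_cancel add_diff_eq diff_diff_eq2)
  then show ?thesis by (metis add.assoc add_diff_eq diff_add_cancel diff_conv_add_uminus)
qed

lemma eval_theta_pos: "eval ga (theta_pos m i) = - T (int m) + ga i + T (int m)"
proof (induction m i rule: theta_pos.induct)
  case (3 m i)
  have "- T (int (Suc m)) + ga (Suc i) + T (int (Suc m)) = - T (int m) + (- gx 0 + ga (Suc i) + gx 0) + T (int m)"
    by (simp only: of_nat_Suc zm_Suc add.commute[of "1::int"] group_norm)
  also have "\<dots> = - T (int m) + (ga (Suc i) + ga i) + T (int m)" by (simp only: a_conj)
  finally show ?case using 3 by (simp only: theta_pos.simps eval_simps group_norm)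
qed simp_all

lemma eval_theta_neg: "eval ga (theta_neg m i) = T (int m) + ga i - T (int m)"
proof (induction m i rule: theta_neg.induct)
  case (3 m i)
  have "ga (Suc i) = gx 0 + (ga (Suc i) + ga i) - gx 0"
    unfolding a_conj[symmetric] by (simp only: group_norm)
  then have "T (int m) + ga (Suc i) - T (int m) = T (int m) + (gx 0 + (ga (Suc i) + ga i) - gx 0) - T (int m)"
    by (rule arg_cong)
  also have "\<dots> = T (int (Suc m)) + (ga (Suc i) + ga i) - T (int (Suc m))"
    using zm_add[of "int m" 1 "gx 0"] by (simp only: of_nat_Suc zm_1 add.commute[of "1::int"] group_norm)
  finally show ?case using 3 by (simp only: theta_neg.simps eval_simps eval_inv_word group_norm)
qed simp_all

lemma eval_Th: "eval ga (Th e i) = T e + ga i - T e"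
proof (cases "e \<le> 0")
  case True then show ?thesis using zm_minus[of e "gx 0"] by (simp add: Th_def eval_theta_pos)
qed (simp add: Th_def eval_theta_neg)

text \<open>Moving the powers of t to the right is a telescoping product of conjugates. Hence free
  part and exponent together determine the element.\<close>

lemma eval_phi: "eval ga (phi e w) = T e + eval gx w - T (e + expo w)"
proof (induction e w rule: phi.induct)
  case (2 e i w)
  have "eval ga (phi e ((i, True) # w)) = (T e + ga i - T e) + (T (e + 1) + eval gx w - T (e + 1 + expo w))"
    using 2 by (simp add: eval_Th)
  also have "\<dots> = T e + (gx i + eval gx w) - T (e + 1 + expo w)"
    unfolding zm_add[of e 1] zm_1 by (simp only: group_norm)
  also have "e + 1 + expo w = e + expo ((i, True) # w)" by simp
  finally show ?case by (simp only: eval_simps if_True)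
next
  case (3 e i w)
  have e: "T e = T (e - 1) + gx 0" using zm_add[of "e - 1" 1 "gx 0"] by simp
  have "eval ga (phi e ((i, False) # w)) = - (T (e - 1) + ga i - T (e - 1)) + (T (e - 1) + eval gx w - T (e - 1 + expo w))"
    using 3 by (simp add: eval_Th)
  also have "\<dots> = T (e - 1) + gx 0 + (- gx i + eval gx w) - T (e - 1 + expo w)"
    by (simp only: group_norm)
  also have "e - 1 + expo w = e + expo ((i, False) # w)" by simp
  finally show ?case by (simp only: e eval_simps if_False)
qed simp

lemma words_mono: "w \<in> words A \<Longrightarrow> A \<subseteq> B \<Longrightarrow> w \<in> words B"
  by (auto simp: in_words_iff)

lemma theta_pos_words: "theta_pos m k \<in> words {1..k}"
  by (induction m k rule: theta_pos.induct) (auto intro: words_mono)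

lemma theta_neg_words: "theta_neg m k \<in> words {1..k}"
  by (induction m k rule: theta_neg.induct) (auto intro: words_mono)

lemma Th_words: "Th e k \<in> words {1..k}"
  using theta_pos_words theta_neg_words by (auto simp: Th_def)

text \<open>Conjugation by t multiplies a_(k+1) only by letters of lower index on the right. The one
  letter a_(k+1) that survives can therefore serve as a marker for the stable letter.\<close>

lemma theta_pos_Suc: "\<exists>v \<in> words {1..k}. theta_pos m (Suc k) = (Suc k, True) # v"
proof (induction m)
  case (Suc m)
  then obtain v where "theta_pos m (Suc k) = (Suc k, True) # v" "v \<in> words {1..k}" by blast
  then show ?case using theta_pos_words[of m k] by simp
qed simp

lemma theta_neg_Suc: "\<exists>v \<in> words {1..k}. theta_neg m (Suc k) = (Suc k, True) # v"
proof (induction m)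
  case (Suc m)
  then obtain v where "theta_neg m (Suc k) = (Suc k, True) # v" "v \<in> words {1..k}" by blast
  then show ?case using theta_neg_words[of "Suc m" k] by simp
qed simp

definition th :: "int \<Rightarrow> nat \<Rightarrow> nat word" where
  "th e k = tl (Th e (Suc k))"

lemma Th_Suc: "Th e (Suc k) = (Suc k, True) # th e k"
  and th_words: "th e k \<in> words {1..k}"
proof -
  obtain u v where "theta_pos (nat (- e)) (Suc k) = (Suc k, True) # u" "u \<in> words {1..k}"
    "theta_neg (nat e) (Suc k) = (Suc k, True) # v" "v \<in> words {1..k}"
    using theta_pos_Suc theta_neg_Suc by blast
  then show "Th e (Suc k) = (Suc k, True) # th e k" "th e k \<in> words {1..k}"
    by (simp_all add: th_def Th_def)
qed

lemma phi_words: "w \<in> words {..k} \<Longrightarrow> phi e w \<in> words {1..k}"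
proof (induction e w rule: phi.induct)
  case (2 e i w)
  then show ?case using words_mono[OF Th_words[of e i], of "{1..k}"] by simp
next
  case (3 e i w)
  then show ?case using words_mono[OF Th_words[of "e - 1" i], of "{1..k}"] by simp
qed simp

lemma eval_th: "eval ga (th e k) = - ga (Suc k) + (T e + ga (Suc k) - T e)"
proof -
  have "ga (Suc k) + eval ga (th e k) = T e + ga (Suc k) - T e"
    using eval_Th[of e "Suc k"] by (simp only: Th_Suc eval_simps if_True)
  then show ?thesis by (metis minus_add_cancel)
qed

section \<open>Normal forms over a stable letter\<close>

text \<open>In the original generators this is a_m^-1 t, the conjugate of t by x_(m+1).\<close>

definition bb :: "nat \<Rightarrow> hyd" where
  "bb m = gx 0 - gx m + gx 0"

lemma bb_conj: "- gx (Suc m) + T j + gx (Suc m) = zm j (bb m)"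
  by (simp add: bb_def x_conj flip: zm_conj)

lemma bb_conj': "gx (Suc m) + zm j (bb m) - gx (Suc m) = T j"
  unfolding bb_conj[symmetric] by (simp only: group_norm)

definition G :: "nat \<Rightarrow> hyd set" where
  "G m = eval gx ` words {..m}"

definition repr_word :: "nat \<Rightarrow> hyd \<Rightarrow> nat word" where
  "repr_word m g = (SOME w. w \<in> words {..m} \<and> eval gx w = g)"

lemma repr_word: "g \<in> G m \<Longrightarrow> repr_word m g \<in> words {..m} \<and> eval gx (repr_word m g) = g"
  unfolding repr_word_def G_def by (rule someI_ex) auto

lemma expo_repr_word: "g \<in> G m \<Longrightarrow> expo (repr_word m g) = ex g"
  using repr_word[of g m] ex_eval[of "repr_word m g"] by simp

fun val :: "nat \<Rightarrow> hyd \<Rightarrow> (bool \<times> hyd) list \<Rightarrow> hyd" where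
  "val m g [] = g"
| "val m g ((b, h) # l) = g + (if b then gx (Suc m) else - gx (Suc m)) + val m h l"

text \<open>\<open>assoc m b g\<close>: conjugating \<open>g\<close> by \<open>x\<^sub>m\<^sub>+\<^sub>1\<close> (if \<open>b\<close>, else by its inverse) stays inside \<open>G m\<close>.\<close>

definition assoc :: "nat \<Rightarrow> bool \<Rightarrow> hyd \<Rightarrow> bool" where
  "assoc m b g \<longleftrightarrow> (if b then \<exists>j. g = zm j (bb m) else \<exists>j. g = T j)"

text \<open>The syllables of \<open>phi e\<close> of a word between its letters \<open>a\<^sub>m\<^sub>+\<^sub>1\<close>: moving \<open>t\<^sup>e\<close> past \<open>x\<^sub>m\<^sub>+\<^sub>1\<close> leaves a single
  such letter, and the rest \<open>th e m\<close> of \<open>Th e (Suc m)\<close> is absorbed into the neighbouring syllable.\<close>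

definition push_head :: "nat \<Rightarrow> int \<Rightarrow> nat word \<Rightarrow> (bool \<times> hyd) list \<Rightarrow> nat word" where
  "push_head m e u l = u @ (case l of (False, _) # _ \<Rightarrow> inv_word (th (e - 1) m) | _ \<Rightarrow> [])"

fun push_syl :: "nat \<Rightarrow> int \<Rightarrow> (bool \<times> hyd) list \<Rightarrow> (bool \<times> nat word) list" where
  "push_syl m e [] = []"
| "push_syl m e ((True, g) # l) =
    (True, push_head m (e + 1 + ex g) (th e m @ phi (e + 1) (repr_word m g)) l) # push_syl m (e + 1 + ex g) l"
| "push_syl m e ((False, g) # l) =
    (False, push_head m (e - 1 + ex g) (phi (e - 1) (repr_word m g)) l) # push_syl m (e - 1 + ex g) l"

fun syl_word :: "nat \<Rightarrow> (bool \<times> hyd) list \<Rightarrow> nat word" where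
  "syl_word m [] = []"
| "syl_word m ((b, g) # l) = (Suc m, b) # repr_word m g @ syl_word m l"

lemma push_head_simps [simp]:
  "push_head m e u [] = u" "push_head m e u ((True, g) # l) = u"
  "push_head m e u ((False, g) # l) = u @ inv_word (th (e - 1) m)"
  by (simp_all add: push_head_def)

text \<open>The prefix \<open>u\<close> is arbitrary because every stable letter leaves a
  \<open>th\<close>, which goes to the following syllable for a positive sign and to the preceding
  one for a negative sign.\<close>

lemma phi_syl_word:
  "snd ` set l \<subseteq> G m \<Longrightarrow> u @ phi e (syl_word m l) = join (Suc m) (push_head m e u l) (push_syl m e l)"
proof (induction m e l arbitrary: u rule: push_syl.induct)
  case (2 m e g l)
  then have "(th e m @ phi (e + 1) (repr_word m g)) @ phi (e + 1 + ex g) (syl_word m l) =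
    join (Suc m) (push_head m (e + 1 + ex g) (th e m @ phi (e + 1) (repr_word m g)) l) (push_syl m (e + 1 + ex g) l)"
    by simp
  then show ?case using 2(2) by (simp add: Th_Suc phi_append expo_repr_word)
next
  case (3 m e g l)
  then have "phi (e - 1) (repr_word m g) @ phi (e - 1 + ex g) (syl_word m l) =
    join (Suc m) (push_head m (e - 1 + ex g) (phi (e - 1) (repr_word m g)) l) (push_syl m (e - 1 + ex g) l)"
    by simp
  then show ?case using 3(2) by (simp add: Th_Suc phi_append expo_repr_word)
qed simp

lemma eval_syl_word: "g \<in> G m \<Longrightarrow> snd ` set l \<subseteq> G m \<Longrightarrow> g + eval gx (syl_word m l) = val m g l"
proof (induction m g l rule: val.induct)
  case (2 m g b h l)
  then show ?case using repr_word[of h m] by (simp add: add.assoc)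
qed simp

lemma push_head_words: "u \<in> words {1..m} \<Longrightarrow> push_head m e u l \<in> words {1..m}"
  unfolding push_head_def using th_words by (auto split: list.splits prod.splits bool.splits)

lemma push_syl_words: "snd ` set l \<subseteq> G m \<Longrightarrow> (b, u) \<in> set (push_syl m e l) \<Longrightarrow> u \<in> words {1..m}"
proof (induction m e l rule: push_syl.induct)
  case (2 m e g l)
  then show ?case using repr_word[of g m] th_words[of e m] by (auto intro!: push_head_words phi_words)
next
  case (3 m e g l)
  then show ?case using repr_word[of g m] by (auto intro!: push_head_words phi_words)
qed simp

lemma x_Suc_eq: "gx (Suc m) = ga (Suc m) + gx 0"
  by simp

lemma T_Suc: "T (e + 1) = T e + gx 0"
  by (simp add: zm_add)

lemma conj_eq_0: "- c + z + c = 0 \<longleftrightarrow> z = (0 :: 'g::group_add)"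
proof
  assume "- c + z + c = 0"
  then have "c + (- c + z + c) - c = c + 0 - c" by (rule arg_cong)
  then show "z = 0" by (simp only: group_norm)
qed simp

lemma conj_solve: "u + y + g - y = v \<Longrightarrow> g = - y + (- u + v) + (y :: 'g::group_add)"
proof -
  assume v: "u + y + g - y = v"
  show ?thesis unfolding v[symmetric] by (simp only: group_norm)
qed

text \<open>Evaluate the vanishing syllable in the group. For a positive sign the two
  \<open>th\<close> at its ends turn the equation into x_(m+1) g x_(m+1)^-1 being a power of t; for
  a negative sign g itself is a power of t.\<close>

lemma pinch_transfer:
  assumes g: "g \<in> G m" and u: "reduce (snd (hd (push_syl m e ((b, g) # (\<not> b, h) # l)))) = []"
  shows "assoc m b g"
proof (cases b)
  case True
  define f where "f = e + ex g"
  have "reduce (th e m @ phi (e + 1) (repr_word m g) @ inv_word (th f m)) = []"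
    using u True by (simp add: f_def)
  from arg_cong[OF this, of "eval ga"]
  have "eval ga (th e m) + eval ga (phi (e + 1) (repr_word m g)) - eval ga (th f m) = 0"
    by (simp only: eval_reduce eval_simps eval_inv_word group_norm)
  moreover have "eval ga (phi (e + 1) (repr_word m g)) = T (e + 1) + g - T (f + 1)"
    using g by (simp add: eval_phi expo_repr_word repr_word f_def add_ac)
  ultimately have "- ga (Suc m) + (T e + (ga (Suc m) + gx 0) + g - (ga (Suc m) + gx 0) - T f) + ga (Suc m) = 0"
    unfolding T_Suc eval_th by (simp only: group_norm)
  then have "- ga (Suc m) + (T e + gx (Suc m) + g - gx (Suc m) - T f) + ga (Suc m) = 0"
    unfolding x_Suc_eq[symmetric] .
  then have "T e + gx (Suc m) + g - gx (Suc m) = T f" by (simp only: conj_eq_0 right_minus_eq)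
  then have "g = - gx (Suc m) + (- T e + T f) + gx (Suc m)" by (rule conj_solve)
  then have "g = zm (f - e) (bb m)" unfolding bb_conj[symmetric]
    by (simp only: diff_conv_add_uminus add.commute[of f] zm_add zm_minus)
  then show ?thesis using True by (auto simp: assoc_def)
next
  case False
  then have "reduce (phi (e - 1) (repr_word m g)) = []" using u by simp
  from arg_cong[OF this, of "eval ga"]
  have "T (e - 1) + g - T (e - 1 + ex g) = 0" using g by (simp add: eval_phi expo_repr_word repr_word)
  then have "g = T (ex g)" by (simp add: zm_add)
  then show ?thesis using False by (auto simp: assoc_def)
qed

lemma no_pinch_push_syl:
  "snd ` set l \<subseteq> G m \<Longrightarrow> no_pinch (assoc m) l \<Longrightarrow> no_pinch (\<lambda>_ u. reduce u = []) (push_syl m e l)"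
proof (induction m e l rule: push_syl.induct)
  case (2 m e g l)
  have IH: "no_pinch (\<lambda>_ u. reduce u = []) (push_syl m (e + 1 + ex g) l)"
    using 2 by (auto dest: no_pinch_tl)
  show ?case
  proof (cases l)
    case (Cons s l')
    obtain b h where s: "s = (b, h)" by force
    show ?thesis
    proof (cases b)
      case True then show ?thesis using IH Cons s by simp
    next
      case False
      then show ?thesis using IH Cons s 2(2,3) pinch_transfer[of g m e True h l'] by auto
    qed
  qed simp
next
  case (3 m e g l)
  have IH: "no_pinch (\<lambda>_ u. reduce u = []) (push_syl m (e - 1 + ex g) l)"
    using 3 by (auto dest: no_pinch_tl)
  show ?case
  proof (cases l)
    case (Cons s l')
    obtain b h where s: "s = (b, h)" by force
    show ?thesis
    proof (cases b)
      case False then show ?thesis using IH Cons s by simp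
    next
      case True
      then show ?thesis using IH Cons s 3(2,3) pinch_transfer[of g m e False h l'] by auto
    qed
  qed simp
qed simp

lemma eval_push_head:
  assumes g: "g \<in> G m"
  shows "eval ga (push_head m (ex g) (phi 0 (repr_word m g)) ((b, h) # l)) =
    (if b then g - T (ex g) else g - gx (Suc m) - T (ex g - 1) + ga (Suc m))"
proof (cases b)
  case False
  define e where "e = ex g - 1"
  have "eval ga (push_head m (ex g) (phi 0 (repr_word m g)) ((b, h) # l)) = (g - T (e + 1)) - (- ga (Suc m) + (T e + ga (Suc m) - T e))"
    using g False by (simp add: eval_phi eval_th repr_word expo_repr_word e_def)
  also have "\<dots> = g - (ga (Suc m) + gx 0) - T e + ga (Suc m)"
    unfolding T_Suc by (simp only: group_norm)
  finally show ?thesis using False unfolding x_Suc_eq[symmetric] by (simp add: e_def)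
qed (use g in \<open>simp add: eval_phi repr_word expo_repr_word\<close>)

text \<open>Britton's lemma for the stable letter \<open>x\<^sub>m\<^sub>+\<^sub>1\<close>, read off from normal forms in the free product
  \<open>F\<^sub>m * \<langle>a\<^sub>m\<^sub>+\<^sub>1\<rangle>\<close> after all powers of \<open>t\<close> are moved to the right.\<close>

theorem hnn_compare:
  assumes g: "g \<in> G m" "snd ` set l \<subseteq> G m" "no_pinch (assoc m) l"
    and h: "h \<in> G m" "snd ` set l' \<subseteq> G m" "no_pinch (assoc m) l'"
    and eq: "val m g l = val m h l'"
  obtains (Nil) "l = []" "l' = []" "g = h"
  | (Cons) b g1 l1 h1 l1' where "l = (b, g1) # l1" "l' = (b, h1) # l1'" "assoc m (\<not> b) (- h + g)"
proof -
  \<comment> \<open>\<open>V\<close> is the reduced leading syllable and \<open>L\<close> the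
    reduced rest; pushing starts there at exponent \<open>ex g\<close>, the power of t that the
    leading \<open>g\<close> leaves behind.\<close>
  define V where "V g l = reduce (push_head m (ex g) (phi 0 (repr_word m g)) l)" for g l
  define L where "L g l = map (apsnd reduce) (push_syl m (ex g) l)" for g l
  have J: "reduce (phi 0 (repr_word m g @ syl_word m l)) = join (Suc m) (V g l) (L g l) \<and> Suc m \<notin> fst ` set (V g l)"
    if gl: "g \<in> G m" "snd ` set l \<subseteq> G m" "no_pinch (assoc m) l" for g l
  proof -
    have c: "push_head m (ex g) (phi 0 (repr_word m g)) l \<in> words {1..m}"
      using repr_word[OF gl(1)] by (intro push_head_words phi_words) (rule conjunct1)
    have fresh: "Suc m \<notin> fst ` set u" if "u \<in> words {1..m}" for u
      using that by (auto simp: in_words_iff)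
    have "phi 0 (repr_word m g @ syl_word m l) = phi 0 (repr_word m g) @ phi (ex g) (syl_word m l)"
      unfolding phi_append expo_repr_word[OF gl(1)] by simp
    also have "\<dots> = join (Suc m) (push_head m (ex g) (phi 0 (repr_word m g)) l) (push_syl m (ex g) l)"
      by (rule phi_syl_word[OF gl(2)])
    also have "reduce \<dots> = join (Suc m) (V g l) (L g l)"
      unfolding V_def L_def
    proof (rule reduce_join[OF fresh[OF c]])
      show "Suc m \<notin> fst ` set u" if "(b, u) \<in> set (push_syl m (ex g) l)" for b u
        using fresh push_syl_words[OF gl(2) that] by blast
      show "no_pinch (\<lambda>_ u. reduce u = []) (push_syl m (ex g) l)"
        by (rule no_pinch_push_syl[OF gl(2,3)])
    qed
    finally show ?thesis
      using fst_set_reduce[OF fresh[OF c]] unfolding V_def by (rule conjI)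
  qed
  have "eval gx (repr_word m g @ syl_word m l) = eval gx (repr_word m h @ syl_word m l')"
    by (simp only: eval_simps repr_word[OF g(1), THEN conjunct2] repr_word[OF h(1), THEN conjunct2]
        eval_syl_word[OF g(1,2)] eval_syl_word[OF h(1,2)] eq)
  then have "reduce (phi 0 (repr_word m g @ syl_word m l)) = reduce (phi 0 (repr_word m h @ syl_word m l'))"
    unfolding eval_x_eq_iff by (rule reduce_freely_equal[OF phi_word_eq])
  then have eq': "join (Suc m) (V g l) (L g l) = join (Suc m) (V h l') (L h l')"
    by (simp only: J[OF g] J[OF h])
  have fresh: "Suc m \<notin> fst ` set (V g l)" "Suc m \<notin> fst ` set (V h l')"
    using J[OF g] J[OF h] by blast+
  have L_Nil: "L g [] = []" for g by (simp add: L_def)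
  have L_Cons: "\<exists>u r. L g ((b, h) # l) = (b, u) # r" for g b h l by (cases b) (auto simp: L_def)
  show thesis
  proof (cases l)
    case l: Nil
    show thesis
    proof (cases l')
      case Nil with l eq that(1) show thesis by simp
    next
      case (Cons s l1')
      obtain b h1 where s: "s = (b, h1)" by force
      obtain u r where "L h l' = (b, u) # r" using L_Cons Cons s by blast
      with eq' l L_Nil have "V g l = V h l' @ (Suc m, b) # join (Suc m) u r" by simp
      with fresh(1) show thesis by simp
    qed
  next
    case l: (Cons s l1)
    obtain b g1 where s: "s = (b, g1)" by force
    obtain u r where Lg: "L g l = (b, u) # r" using L_Cons l s by blast
    show thesis
    proof (cases l')
      case Nil
      with eq' Lg L_Nil have "V h l' = V g l @ (Suc m, b) # join (Suc m) u r" by simp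
      with fresh(2) show thesis by simp
    next
      case l': (Cons s' l1')
      obtain b' h1 where s': "s' = (b', h1)" by force
      obtain u' r' where Lh: "L h l' = (b', u') # r'" using L_Cons l' s' by blast
      have "V g l @ (Suc m, b) # join (Suc m) u r = V h l' @ (Suc m, b') # join (Suc m) u' r'"
        using eq' Lg Lh by simp
      \<comment> \<open>Both normal forms are cut at their first letter \<open>Suc m\<close>, so
        signs and leading syllables agree. Evaluating the latter leaves only powers of t, or their
        conjugates, between \<open>g\<close> and \<open>h\<close>.\<close>
      from append_fresh_eq[OF this fresh] have b: "b' = b" and r: "V g l = V h l'" by auto
      have e: "eval ga (push_head m (ex g) (phi 0 (repr_word m g)) l) = eval ga (push_head m (ex h) (phi 0 (repr_word m h)) l')"
        using arg_cong[OF r, of "eval ga"] unfolding V_def eval_reduce .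
      have "assoc m (\<not> b) (- h + g)"
      proof (cases b)
        case True
        then have "g - T (ex g) = h - T (ex h)"
          using e g(1) h(1) unfolding l l' s s' b by (simp only: eval_push_head if_True)
        then have "g = h - T (ex h) + T (ex g)" by (simp only: diff_eq_eq[of g])
        then have "- h + g = - h + (h - T (ex h) + T (ex g))" by (rule arg_cong)
        then have "- h + g = - T (ex h) + T (ex g)" by (simp only: group_norm)
        then have "- h + g = T (- ex h + ex g)" by (simp only: zm_add zm_minus)
        then show ?thesis using True unfolding assoc_def by (simp only: simp_thms if_False) blast
      next
        case False
        then have "g - gx (Suc m) - T (ex g - 1) + ga (Suc m) = h - gx (Suc m) - T (ex h - 1) + ga (Suc m)"
          using e g(1) h(1) unfolding l l' s s' b by (simp only: eval_push_head if_False)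
        then have "g - gx (Suc m) - T (ex g - 1) = h - gx (Suc m) - T (ex h - 1)" by (simp only: add_right_cancel)
        then have "g = h - gx (Suc m) - T (ex h - 1) + T (ex g - 1) + gx (Suc m)"
          by (simp only: diff_eq_eq[of "g - gx (Suc m)"] diff_eq_eq[of g])
        then have "- h + g = - h + (h - gx (Suc m) - T (ex h - 1) + T (ex g - 1) + gx (Suc m))" by (rule arg_cong)
        then have "- h + g = - gx (Suc m) + (- T (ex h - 1) + T (ex g - 1)) + gx (Suc m)"
          by (simp only: group_norm)
        then have "- h + g = - gx (Suc m) + T (- (ex h - 1) + (ex g - 1)) + gx (Suc m)"
          by (simp only: zm_add zm_minus)
        then show ?thesis using False unfolding bb_conj assoc_def by (simp only: simp_thms if_True) blast
      qed
      with l l' s s' b that(2) show thesis by blast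
    qed
  qed
qed

section \<open>The subgroups \<open>H k\<close>\<close>

definition H :: "nat \<Rightarrow> hyd set" where
  "H k = eval gx ` words {1..k}"

lemma G_zero [simp]: "0 \<in> G m"
  unfolding G_def by (rule image_eqI[of _ _ "[]"]) simp_all

lemma H_zero [simp]: "0 \<in> H m"
  unfolding H_def by (rule image_eqI[of _ _ "[]"]) simp_all

lemma G_add: "g \<in> G m \<Longrightarrow> h \<in> G m \<Longrightarrow> g + h \<in> G m"
proof -
  assume "g \<in> G m" "h \<in> G m"
  then obtain u v where "g = eval gx u" "h = eval gx v" "u @ v \<in> words {..m}"
    unfolding G_def words_simps(2) by blast
  then show ?thesis unfolding G_def by (simp only: image_eqI eval_simps(3)[symmetric])
qed

lemma H_add: "g \<in> H m \<Longrightarrow> h \<in> H m \<Longrightarrow> g + h \<in> H m"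
proof -
  assume "g \<in> H m" "h \<in> H m"
  then obtain u v where "g = eval gx u" "h = eval gx v" "u @ v \<in> words {1..m}"
    unfolding H_def words_simps(2) by blast
  then show ?thesis unfolding H_def by (simp only: image_eqI eval_simps(3)[symmetric])
qed

lemma G_uminus: "g \<in> G m \<Longrightarrow> - g \<in> G m"
proof -
  assume "g \<in> G m"
  then obtain u where "g = eval gx u" "inv_word u \<in> words {..m}"
    unfolding G_def inv_word_in_words by blast
  then show ?thesis unfolding G_def by (simp only: image_eqI eval_inv_word[symmetric])
qed

lemma H_uminus: "g \<in> H m \<Longrightarrow> - g \<in> H m"
proof -
  assume "g \<in> H m"
  then obtain u where "g = eval gx u" "inv_word u \<in> words {1..m}"
    unfolding H_def inv_word_in_words by blast
  then show ?thesis unfolding H_def by (simp only: image_eqI eval_inv_word[symmetric])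
qed

lemma G_diff: "g \<in> G m \<Longrightarrow> h \<in> G m \<Longrightarrow> g - h \<in> G m"
  unfolding diff_conv_add_uminus by (intro G_add G_uminus)

lemma H_diff: "g \<in> H m \<Longrightarrow> h \<in> H m \<Longrightarrow> g - h \<in> H m"
  unfolding diff_conv_add_uminus by (intro H_add H_uminus)

lemma x_G: "i \<le> m \<Longrightarrow> gx i \<in> G m"
  unfolding G_def by (rule image_eqI[of _ _ "[(i, True)]"]) simp_all

lemma x_H: "1 \<le> i \<Longrightarrow> i \<le> m \<Longrightarrow> gx i \<in> H m"
  unfolding H_def by (rule image_eqI[of _ _ "[(i, True)]"]) simp_all

lemma zm_G: "g \<in> G m \<Longrightarrow> zm j g \<in> G m"
  by (induction j rule: int_induct[where k = 0]) (simp_all only: zm_0 zm_Suc zm_diff1 G_zero G_add G_uminus)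

lemma zm_H: "g \<in> H m \<Longrightarrow> zm j g \<in> H m"
  by (induction j rule: int_induct[where k = 0]) (simp_all only: zm_0 zm_Suc zm_diff1 H_zero H_add H_uminus)

lemma T_G: "T j \<in> G m"
  by (intro zm_G x_G) simp

lemma bb_G: "bb m \<in> G m"
  unfolding bb_def by (intro G_add G_diff x_G) simp_all

lemma H_sub_G: "H m \<subseteq> G m"
  unfolding H_def G_def by (rule image_mono) (auto elim!: words_mono)

lemma H_mono: "m \<le> n \<Longrightarrow> H m \<subseteq> H n"
  unfolding H_def by (rule image_mono) (auto elim!: words_mono)

lemma G_mono: "m \<le> n \<Longrightarrow> G m \<subseteq> G n"
  unfolding G_def by (rule image_mono) (auto elim!: words_mono)

lemma H_zero_iff: "h \<in> H 0 \<longleftrightarrow> h = 0"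
proof -
  have "words {1..0::nat} = {[]}" by (auto simp: words_def)
  then show ?thesis by (simp add: H_def)
qed

lemma val_H: "h \<in> H m \<Longrightarrow> snd ` set l \<subseteq> H m \<Longrightarrow> val m h l \<in> H (Suc m)"
proof (induction m h l rule: val.induct)
  case (1 m g)
  then show ?case using H_mono[of m "Suc m"] by auto
next
  case (2 m g b h l)
  have "g \<in> H (Suc m)" using 2(2) H_mono[of m "Suc m"] by auto
  moreover have "(if b then gx (Suc m) else - gx (Suc m)) \<in> H (Suc m)"
    by (simp add: x_H H_uminus)
  moreover have "val m h l \<in> H (Suc m)" using 2 by simp
  ultimately show ?case by (simp only: val.simps H_add)
qed

lemma val_add_left: "val m (u + g) l = u + val m g l"
  by (cases l) (auto simp only: val.simps add.assoc split_paired_all)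

section \<open>Trivial intersection of \<open>H m\<close> with the associated subgroups\<close>

definition trivial_assoc :: "nat \<Rightarrow> bool" where
  "trivial_assoc m \<longleftrightarrow> (\<forall>j. T j \<in> H m \<longrightarrow> j = 0) \<and> (\<forall>j. zm j (bb m) \<in> H m \<longrightarrow> j = 0)"

lemma assoc_H:
  assumes "trivial_assoc m" "h \<in> H m" "assoc m b h"
  shows "h = 0"
proof (cases b)
  case True
  then obtain j where "h = zm j (bb m)" using assms(3) by (auto simp: assoc_def)
  then show ?thesis using assms by (auto simp: trivial_assoc_def)
next
  case False
  then obtain j where "h = T j" using assms(3) by (auto simp: assoc_def)
  then show ?thesis using assms by (auto simp: trivial_assoc_def)
qed

lemma no_pinch_Cons:
  "no_pinch P l \<Longrightarrow> (\<And>v l'. l = (\<not> b, v) # l' \<Longrightarrow> \<not> P b g) \<Longrightarrow> no_pinch P ((b, g) # l)"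
  by (cases "(P, (b, g) # l)" rule: no_pinch.cases) auto

text \<open>The middle of a pinch lies both in \<open>H m\<close> and in an associated subgroup, so
  it is 0 and the two stable letters simply cancel. Removing pinches thus never leaves
  \<open>H m\<close>, which makes \<open>H (Suc m)\<close> a free product.\<close>

lemma H_syllables:
  assumes m: "trivial_assoc m" and h: "h \<in> H (Suc m)"
  obtains h0 l where "h0 \<in> H m" "snd ` set l \<subseteq> H m" "no_pinch (assoc m) l" "val m h0 l = h"
proof -
  have "\<exists>h0 l. h0 \<in> H m \<and> snd ` set l \<subseteq> H m \<and> no_pinch (assoc m) l \<and> val m h0 l = eval gx w"
    if "w \<in> words {1..Suc m}" for w
    using that
  proof (induction w)
    case Nil
    show ?case by (rule exI[of _ 0], rule exI[of _ "[]"]) simp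
  next
    case (Cons s w)
    obtain i b where s: "s = (i, b)" by force
    from Cons obtain h0 l where IH: "h0 \<in> H m" "snd ` set l \<subseteq> H m" "no_pinch (assoc m) l" "val m h0 l = eval gx w"
      by auto
    define y where "y = (if b then gx i else - gx i)"
    have e: "eval gx (s # w) = y + val m h0 l" by (simp add: s IH y_def)
    show ?case
    proof (cases "i \<le> m")
      case True
      then have "y \<in> H m" using Cons.prems s by (auto simp: y_def x_H H_uminus)
      then show ?thesis using IH e by (intro exI[of _ "y + h0"] exI[of _ l]) (simp add: H_add val_add_left)
    next
      case False
      then have i: "i = Suc m" using Cons.prems s by auto
      show ?thesis
      proof (cases "\<exists>h1 l'. l = (\<not> b, h1) # l' \<and> assoc m b h0")
        case True
        then obtain h1 l' where l: "l = (\<not> b, h1) # l'" and a: "assoc m b h0" by blast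
        have h0: "h0 = 0" by (rule assoc_H[OF m IH(1) a])
        have "eval gx (s # w) = val m h1 l'" unfolding e l y_def i h0
          by (cases b) (simp_all only: val.simps if_True if_False not_True_eq_False not_False_eq_True group_norm)
        moreover have "h1 \<in> H m" "snd ` set l' \<subseteq> H m" using IH(2) unfolding l by simp_all
        moreover have "no_pinch (assoc m) l'" using IH(3) unfolding l by (rule no_pinch_tl)
        ultimately show ?thesis by (intro exI[of _ h1] exI[of _ l'] conjI) simp_all
      next
        case False
        then have "no_pinch (assoc m) ((b, h0) # l)" by (intro no_pinch_Cons[OF IH(3)]) blast
        moreover have "val m 0 ((b, h0) # l) = eval gx (s # w)" unfolding e y_def i by simp
        moreover have "snd ` set ((b, h0) # l) \<subseteq> H m" using IH by simp
        ultimately show ?thesis by (intro exI[of _ 0] exI[of _ "(b, h0) # l"] conjI) (simp_all only: H_zero)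
      qed
    qed
  qed
  moreover obtain w where "w \<in> words {1..Suc m}" "h = eval gx w" using h unfolding H_def by blast
  ultimately obtain h0 l where "h0 \<in> H m" "snd ` set l \<subseteq> H m" "no_pinch (assoc m) l" "val m h0 l = h"
    by metis
  then show thesis by (rule that)
qed

lemma H_syllables_G:
  assumes "trivial_assoc m" and "h \<in> H (Suc m)"
  obtains h0 l where "h0 \<in> H m" "snd ` set l \<subseteq> H m" "no_pinch (assoc m) l" "val m h0 l = h"
    "h0 \<in> G m" "snd ` set l \<subseteq> G m"
proof -
  obtain h0 l where "h0 \<in> H m" "snd ` set l \<subseteq> H m" "no_pinch (assoc m) l" "val m h0 l = h"
    by (rule H_syllables[OF assms])
  then show thesis using H_sub_G[of m] by (intro that[of h0 l]) blast+
qed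

lemma ex_bb [simp]: "ex (bb m) = 1"
  by (simp add: bb_def)

text \<open>A power of t has no stable letter, so \<open>hnn_compare\<close> leaves its syllable
  form in \<open>H (Suc m)\<close> with the single syllable \<open>h0\<close>, and
  \<open>T j\<close> already lies in \<open>H m\<close>.\<close>

lemma T_H_Suc:
  assumes m: "trivial_assoc m" and j: "T j \<in> H (Suc m)"
  shows "j = 0"
proof -
  obtain h0 l where h: "h0 \<in> H m" "no_pinch (assoc m) l" "val m h0 l = T j" "h0 \<in> G m" "snd ` set l \<subseteq> G m"
    by (rule H_syllables_G[OF m j])
  have "val m h0 l = val m (T j) []" using h(3) by simp
  from h(4,5,2) T_G _ _ this have "h0 = T j" by (rule hnn_compare) simp_all
  then show ?thesis using m h(1) unfolding trivial_assoc_def by blast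
qed

text \<open>The hydra battle: \<open>(t\<inverse> a\<^sub>k)\<^sup>n\<close> is a positive word in \<open>x\<^sub>1, \<dots>, x\<^sub>k\<close> times \<open>t\<^sup>-\<^sup>y\<close> with
  \<open>y = hydra_steps k n\<close>.\<close>

fun hydra_steps :: "nat \<Rightarrow> nat \<Rightarrow> nat" where
  "hydra_steps 0 n = n"
| "hydra_steps (Suc k) 0 = 0"
| "hydra_steps (Suc k) (Suc n) = Suc (hydra_steps k (Suc (hydra_steps (Suc k) n)))"

definition pos :: "nat list \<Rightarrow> nat word" where
  "pos l = map (\<lambda>i. (i, True)) l"

lemma pos_simps [simp]: "pos [] = []" "pos (i # l) = (i, True) # pos l" "pos (l @ l') = pos l @ pos l'"
  "length (pos l) = length l" "pos l \<in> words A \<longleftrightarrow> set l \<subseteq> A" "expo (pos l) = int (length l)"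
  by (auto simp: pos_def expo_def in_words_iff image_image sum_list_triv eval_def comp_def)

text \<open>Double induction. A new factor t^-1 x_(k+1) t^-1 first enlarges the trailing power of t
  by one; passing x_(k+1), that power becomes one of \<open>bb k\<close>, to which the hypothesis
  for \<open>k\<close> applies; the last t^-1 adds one more.\<close>

lemma bb_neg_power:
  "\<exists>l. set l \<subseteq> {1..k} \<and> zm (- int n) (bb k) = eval gx (pos l) + T (- int (hydra_steps k n))"
proof (induction k arbitrary: n)
  case 0
  then show ?case by (intro exI[of _ "[]"]) (simp add: bb_def)
next
  case (Suc k)
  show ?case
  proof (induction n)
    case 0
    then show ?case by (intro exI[of _ "[]"]) simp
  next
    case IH: (Suc n)
    define r where "r = hydra_steps (Suc k) n"
    obtain l where l: "set l \<subseteq> {1..Suc k}" "zm (- int n) (bb (Suc k)) = eval gx (pos l) + T (- int r)"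
      using IH by (auto simp: r_def)
    obtain l' where l': "set l' \<subseteq> {1..k}"
      "zm (- int (Suc r)) (bb k) = eval gx (pos l') + T (- int (hydra_steps k (Suc r)))"
      using Suc.IH by blast
    have "zm (- int (Suc n)) (bb (Suc k)) = zm (- int n) (bb (Suc k)) + zm (-1) (bb (Suc k))"
      unfolding zm_add[symmetric] by (rule arg_cong2[where f = zm]) simp_all
    also have "\<dots> = eval gx (pos l) + T (- int r) + - (gx 0 - gx (Suc k) + gx 0)"
      unfolding l(2) by (simp add: bb_def)
    also have "\<dots> = eval gx (pos l) + gx (Suc k) + (- gx (Suc k) + (T (- int r) + T (- 1)) + gx (Suc k)) - gx 0"
      by (simp only: zm_minus zm_1 group_norm)
    also have "\<dots> = eval gx (pos l) + gx (Suc k) + zm (- int (Suc r)) (bb k) - gx 0"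
      unfolding zm_add[symmetric] bb_conj by (rule arg_cong[where f = "\<lambda>j. eval gx (pos l) + gx (Suc k) + zm j (bb k) - gx 0"]) simp
    also have "\<dots> = eval gx (pos (l @ [Suc k] @ l')) + (T (- int (hydra_steps k (Suc r))) + T (- 1))"
      unfolding l'(2) by (simp only: pos_simps eval_simps if_True zm_minus zm_1 group_norm)
    also have "T (- int (hydra_steps k (Suc r))) + T (- 1) = T (- int (hydra_steps (Suc k) (Suc n)))"
      unfolding zm_add[symmetric] by (rule arg_cong2[where f = zm]) (simp_all add: r_def)
    finally show ?case using l(1) l'(1) by (intro exI[of _ "l @ [Suc k] @ l'"]) auto
  qed
qed


text \<open>Compare exponent sums.\<close>

lemma bb_neg_power_length:
  assumes "zm (- int n) (bb k) = eval gx (pos l) + T (- int y)"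
  shows "y = length l + n"
  using arg_cong[OF assms, of ex] by (simp add: ex_eval)

text \<open>The positive word in the hydra identity lies in \<open>H k\<close>, so the remaining
  power of t would as well, and its exponent is at least \<open>n\<close> in absolute value.\<close>

lemma bb_neg_power_H:
  assumes T: "\<And>j. T j \<in> H k \<Longrightarrow> j = 0" and n: "zm (- int n) (bb k) \<in> H k"
  shows "n = 0"
proof -
  obtain l where l: "set l \<subseteq> {1..k}" "zm (- int n) (bb k) = eval gx (pos l) + T (- int (hydra_steps k n))"
    using bb_neg_power by blast
  have "eval gx (pos l) \<in> H k" unfolding H_def using l(1) by (intro imageI) simp
  then have "- eval gx (pos l) + zm (- int n) (bb k) \<in> H k" using n by (intro H_add H_uminus)
  then have "T (- int (hydra_steps k n)) \<in> H k" unfolding l(2) minus_add_cancel .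
  from T[OF this] bb_neg_power_length[OF l(2)] show ?thesis by simp
qed

lemma x_0_1_commute: "gx 0 + gx 1 = gx 1 + gx 0"
proof -
  have "- gx 1 + gx 0 + gx 1 = gx 0" using x_conj[of 0] by (simp add: One_nat_def)
  then have "gx 1 + (- gx 1 + gx 0 + gx 1) = gx 1 + gx 0" by (rule arg_cong)
  then show ?thesis by (simp only: group_norm)
qed

lemma bb_1: "bb 1 = - gx 1 + T 2"
proof -
  have "T 2 = gx 0 + gx 0" using zm_add[of 1 1 "gx 0"] by simp
  then show ?thesis
    unfolding bb_def using uminus_commute[OF x_0_1_commute[symmetric]]
    by (simp only: add.assoc[symmetric] diff_conv_add_uminus)
qed

lemma zm_bb_1: "zm j (bb 1) = - zm j (gx 1) + T (2 * j)"
proof -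
  have "- gx 1 + T 2 = T 2 + - gx 1"
    by (rule uminus_commute[OF zm_commute[OF x_0_1_commute[symmetric]]])
  then have "zm j (- gx 1 + T 2) = zm j (- gx 1) + zm j (T 2)" by (rule zm_add_commute)
  then show ?thesis unfolding bb_1 zm_uminus zm_zm by (simp only: mult.commute)
qed

section \<open>Positive powers of \<open>bb\<close> and membership in \<open>H k\<close>\<close>

fun bb_tail :: "nat \<Rightarrow> hyd \<Rightarrow> (bool \<times> hyd) list" where
  "bb_tail 0 u = [(False, gx 0 + u)]"
| "bb_tail (Suc n) u = (False, gx 0 + gx 0) # bb_tail n u"

text \<open>Every factor t x_(m+1)^-1 t contributes one negative stable letter, and adjacent t merge
  into one syllable. All signs being equal, the form is pinch-free at once.\<close>

lemma bb_power_syllables: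
  "g + zm (int (Suc n)) (bb (Suc m)) + u = val m (g + gx 0) (bb_tail n u)"
proof (induction n arbitrary: g)
  case 0
  show ?case by (simp only: bb_tail.simps val.simps of_nat_Suc of_nat_0 add_0_left zm_1 bb_def if_False group_norm)
next
  case (Suc n)
  have "int (Suc (Suc n)) = int (Suc n) + 1" by simp
  then have "g + zm (int (Suc (Suc n))) (bb (Suc m)) + u = g + (bb (Suc m) + zm (int (Suc n)) (bb (Suc m))) + u"
    by (simp only: zm_Suc)
  also have "\<dots> = (g + bb (Suc m)) + zm (int (Suc n)) (bb (Suc m)) + u" by (simp only: add.assoc)
  also have "\<dots> = val m (g + bb (Suc m) + gx 0) (bb_tail n u)" by (rule Suc)
  also have "g + bb (Suc m) + gx 0 = (g + gx 0) + - gx (Suc m) + (gx 0 + gx 0)"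
    unfolding bb_def by (simp only: group_norm)
  finally show ?case by (simp only: val_add_left bb_tail.simps val.simps if_False)
qed

lemma no_pinch_bb_tail: "no_pinch P (bb_tail n u)"
proof (induction n)
  case (Suc n)
  then show ?case by (cases n) simp_all
qed simp

lemma bb_tail_G: "u \<in> G m \<Longrightarrow> snd ` set (bb_tail n u) \<subseteq> G m"
  by (induction n) (simp_all add: G_add x_G)

lemma bb_tail_Cons: "\<exists>v l. bb_tail n u = (False, v) # l"
  by (cases n) auto

text \<open>Strengthening that makes the induction for \<open>trivial_assoc\<close> go through. The
  exception at \<open>k = 1\<close> is genuine, since b_1 = x_1^-1 t^2 and t commutes with
  x_1.\<close>

definition T_bb_separated :: "nat \<Rightarrow> bool" where
  "T_bb_separated k \<longleftrightarrow> (\<forall>p i. 0 < p \<longrightarrow> T p - zm i (bb k) \<in> H k \<longrightarrow> k = 1 \<and> p = 2 * i)"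

text \<open>Match the first stable letter with that of a syllable form inside
  \<open>H (Suc m)\<close>. What stands before it lies in \<open>H m\<close> up to a power of
  \<open>bb m\<close>; that power is carried into the rest, which has one factor
  \<open>bb (Suc m)\<close> less.\<close>

lemma bb_power_compare:
  assumes m: "trivial_assoc m" and g: "g \<in> G m" "u \<in> G m"
    and h: "g + zm (int (Suc n)) (bb (Suc m)) + u \<in> H (Suc m)"
  obtains j where "g + gx 0 - zm j (bb m) \<in> H m"
    "zm j (bb m) - gx (Suc m) + gx 0 + zm (int n) (bb (Suc m)) + u \<in> H (Suc m)"
proof -
  obtain h0 l where l: "h0 \<in> H m" "snd ` set l \<subseteq> H m" "no_pinch (assoc m) l"
    "val m h0 l = g + zm (int (Suc n)) (bb (Suc m)) + u" "h0 \<in> G m" "snd ` set l \<subseteq> G m"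
    by (rule H_syllables_G[OF m h])
  have eq: "val m (g + gx 0) (bb_tail n u) = val m h0 l" using l(4) bb_power_syllables by simp
  have gx: "g + gx 0 \<in> G m" using g x_G by (intro G_add) simp_all
  obtain v t where t: "bb_tail n u = (False, v) # t" using bb_tail_Cons by blast
  from gx bb_tail_G[OF g(2)] no_pinch_bb_tail l(5,6,3) eq
  obtain h1 l' where l': "l = (False, h1) # l'" and a: "assoc m True (- h0 + (g + gx 0))"
    by (rule hnn_compare) (auto simp: t)
  obtain j where j: "- h0 + (g + gx 0) = zm j (bb m)" using a by (auto simp: assoc_def)
  have "g + gx 0 - zm j (bb m) = h0" unfolding j[symmetric] by (simp only: group_norm)
  moreover have "zm j (bb m) - gx (Suc m) + gx 0 + zm (int n) (bb (Suc m)) + u = - h0 + val m h0 l"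
  proof -
    have "zm (int (Suc n)) (bb (Suc m)) = bb (Suc m) + zm (int n) (bb (Suc m))"
      using zm_Suc[of "int n"] by (simp add: add.commute)
    then show ?thesis unfolding l(4) j[symmetric] by (simp only: bb_def group_norm)
  qed
  moreover have "- h0 + val m h0 l \<in> H (Suc m)"
    using val_H[OF l(1,2)] l(1) H_mono[of m "Suc m"] by (intro H_add H_uminus) auto
  ultimately show thesis using l(1) that by metis
qed

lemma trivial_assoc_0: "trivial_assoc 0"
proof -
  have "j = 0" if "zm j g = 0" "ex g = 1" for j g
    using arg_cong[OF that(1), of ex] that(2) by simp
  then show ?thesis unfolding trivial_assoc_def H_zero_iff using ex_bb ex_simps(4) by blast
qed

lemma trivial_assoc_1: "trivial_assoc 1"
proof -
  have T: "j = 0" if "T j \<in> H 1" for j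
    using T_H_Suc[OF trivial_assoc_0] that by (simp add: One_nat_def)
  have "j = 0" if j: "zm j (bb 1) \<in> H 1" for j
  proof -
    have "zm j (gx 1) + zm j (bb 1) \<in> H 1" by (intro H_add zm_H x_H j) simp_all
    then have "T (2 * j) \<in> H 1" unfolding zm_bb_1 by (simp only: group_norm)
    then show ?thesis using T by fastforce
  qed
  with T show ?thesis unfolding trivial_assoc_def by blast
qed

lemma T_bb_separated_1: "T_bb_separated 1"
proof -
  have "p = 2 * i" if "T p - zm i (bb 1) \<in> H 1" for p i
  proof -
    have "T p - zm i (bb 1) - zm i (gx 1) \<in> H 1" by (intro H_diff zm_H x_H that) simp_all
    then have "T (p - 2 * i) \<in> H 1" unfolding zm_bb_1 zm_diff by (simp only: group_norm)
    then show ?thesis using trivial_assoc_1 unfolding trivial_assoc_def by fastforce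
  qed
  then show ?thesis unfolding T_bb_separated_def by blast
qed

text \<open>A parity argument: 1 is not of the form \<open>2 * j\<close>.\<close>

lemma x_0_notin_H_bb:
  assumes "T_bb_separated m" "gx 0 - zm j (bb m) \<in> H m" shows False
proof -
  have "T 1 - zm j (bb m) \<in> H m" using assms(2) by simp
  then have "1 = 2 * j" using assms(1) unfolding T_bb_separated_def by (metis zero_less_one)
  then show False by presburger
qed

text \<open>For positive exponents the first syllable would put t into \<open>H m\<close> up to a
  power of \<open>bb m\<close>, against \<open>x_0_notin_H_bb\<close>. Negative exponents are
  excluded by the hydra identity.\<close>

lemma trivial_assoc_Suc:
  assumes m: "trivial_assoc m" and s: "T_bb_separated m"
  shows "trivial_assoc (Suc m)"
proof -
  have T: "j = 0" if "T j \<in> H (Suc m)" for j using T_H_Suc[OF m that] .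
  have "j = 0" if j: "zm j (bb (Suc m)) \<in> H (Suc m)" for j
  proof (cases "j > 0")
    case True
    then obtain n where n: "j = int (Suc n)" by (metis gr0_implies_Suc nat_0_le of_nat_0_less_iff order_less_imp_le zero_less_imp_eq_int)
    have "0 + zm (int (Suc n)) (bb (Suc m)) + 0 \<in> H (Suc m)" using j n by simp
    from bb_power_compare[OF m G_zero G_zero this] obtain i where "0 + gx 0 - zm i (bb m) \<in> H m"
      by metis
    then show ?thesis using x_0_notin_H_bb[OF s] unfolding add_0_left by blast
  next
    case False
    then obtain n where n: "j = - int n" by (metis minus_minus neg_0_le_iff_le nonneg_int_cases not_le)
    then show ?thesis using bb_neg_power_H[OF T] j by simp
  qed
  with T show ?thesis unfolding trivial_assoc_def by blast
qed

text \<open>For negative \<open>i\<close>, peel off the factors \<open>bb (Suc m)\<close> one by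
  one. Each step replaces \<open>p\<close> by \<open>j + 1\<close> with
  \<open>p + 1 = 2 * j\<close>, so the exponent of t stays positive, and finally a positive power of
  t would lie in \<open>H (Suc m)\<close>.\<close>

lemma T_bb_separated_Suc:
  assumes m: "trivial_assoc m" and s: "T_bb_separated m"
  shows "T_bb_separated (Suc m)"
proof -
  note T = T_H_Suc[OF m]
  have neg: False if "T p + zm (int n) (bb (Suc m)) \<in> H (Suc m)" "p > 0" for p n
    using that
  proof (induction n arbitrary: p)
    case 0
    then have "T p \<in> H (Suc m)" by simp
    then show ?case using T 0(2) by fastforce
  next
    case (Suc n)
    have "T p + zm (int (Suc n)) (bb (Suc m)) + 0 \<in> H (Suc m)" using Suc.prems by simp
    from bb_power_compare[OF m T_G G_zero this] obtain j where j: "T p + gx 0 - zm j (bb m) \<in> H m"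
      and r: "zm j (bb m) - gx (Suc m) + gx 0 + zm (int n) (bb (Suc m)) + 0 \<in> H (Suc m)"
      by metis
    have "T (p + 1) - zm j (bb m) \<in> H m" using j unfolding T_Suc .
    then have "p + 1 = 2 * j" using s Suc.prems(2) unfolding T_bb_separated_def
      by (metis add_pos_pos zero_less_one)
    then have "0 < j + 1" using Suc.prems(2) by simp
    moreover have "T (j + 1) + zm (int n) (bb (Suc m)) \<in> H (Suc m)"
    proof -
      have "gx (Suc m) + (zm j (bb m) - gx (Suc m) + gx 0 + zm (int n) (bb (Suc m)) + 0) \<in> H (Suc m)"
        by (intro H_add r x_H) simp_all
      moreover have "gx (Suc m) + (zm j (bb m) - gx (Suc m) + gx 0 + zm (int n) (bb (Suc m)) + 0) =
        (gx (Suc m) + zm j (bb m) - gx (Suc m)) + gx 0 + zm (int n) (bb (Suc m))"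
        by (simp only: group_norm)
      ultimately show ?thesis unfolding bb_conj' T_Suc by simp
    qed
    ultimately show ?case using Suc.IH by blast
  qed
  have False if h: "T p - zm i (bb (Suc m)) \<in> H (Suc m)" and p: "p > 0" for p i
  proof (cases "i > 0")
    case True
    then obtain n where n: "i = int (Suc n)" by (metis gr0_implies_Suc nat_0_le of_nat_0_less_iff order_less_imp_le zero_less_imp_eq_int)
    have "- (T p - zm i (bb (Suc m))) \<in> H (Suc m)" by (rule H_uminus[OF h])
    then have "0 + zm (int (Suc n)) (bb (Suc m)) + - T p \<in> H (Suc m)"
      unfolding n by (simp only: group_norm)
    from bb_power_compare[OF m G_zero G_uminus[OF T_G] this] obtain j where "0 + gx 0 - zm j (bb m) \<in> H m"
      by metis
    then show ?thesis using x_0_notin_H_bb[OF s] unfolding add_0_left by blast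
  next
    case False
    then obtain n where n: "i = - int n" by (metis minus_minus neg_0_le_iff_le nonneg_int_cases not_le)
    then show ?thesis using neg[of p n] h p by simp
  qed
  then show ?thesis unfolding T_bb_separated_def by blast
qed

theorem trivial_assoc_separated: "trivial_assoc m \<and> (m \<ge> 1 \<longrightarrow> T_bb_separated m)"
proof (induction m)
  case (Suc m)
  then show ?case
    using trivial_assoc_Suc T_bb_separated_Suc trivial_assoc_1 T_bb_separated_1
    by (cases "m = 0") (auto simp: One_nat_def)
qed (simp add: trivial_assoc_0)

lemmas trivial_assoc = trivial_assoc_separated[THEN conjunct1]
lemmas T_bb_separated = trivial_assoc_separated[THEN conjunct2, rule_format]

section \<open>Distortion\<close>

text \<open>Counting each \<open>bb i\<close> as one letter keeps lengths from growing when a pinch replaces a power of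
  \<open>t\<close> by the same power of \<open>bb m\<close>.\<close>

definition letters :: "nat \<Rightarrow> hyd set" where
  "letters k = (\<Union>i\<le>k. {gx i, - gx i, bb i, - bb i})"

definition nrm :: "nat \<Rightarrow> nat \<Rightarrow> hyd \<Rightarrow> bool" where
  "nrm k n g \<longleftrightarrow> (\<exists>l. set l \<subseteq> letters k \<and> length l \<le> n \<and> sum_list l = g)"

lemma nrm_0 [simp]: "nrm k n 0"
  unfolding nrm_def by (rule exI[of _ "[]"]) simp

lemma nrm_add: "nrm k a g \<Longrightarrow> nrm k b h \<Longrightarrow> nrm k (a + b) (g + h)"
  unfolding nrm_def
proof (elim exE conjE)
  fix l l' assume "set l \<subseteq> letters k" "length l \<le> a" "sum_list l = g" "set l' \<subseteq> letters k" "length l' \<le> b" "sum_list l' = h"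
  then show "\<exists>l. set l \<subseteq> letters k \<and> length l \<le> a + b \<and> sum_list l = g + h"
    by (intro exI[of _ "l @ l'"]) simp
qed

lemma nrm_mono: "nrm k a g \<Longrightarrow> a \<le> b \<Longrightarrow> nrm k b g"
  unfolding nrm_def using order_trans[of _ a b] by blast

lemma nrm_S: "y \<in> letters k \<Longrightarrow> nrm k 1 y"
  unfolding nrm_def by (rule exI[of _ "[y]"]) simp

lemma S_x: "i \<le> k \<Longrightarrow> gx i \<in> letters k" "i \<le> k \<Longrightarrow> - gx i \<in> letters k"
  "i \<le> k \<Longrightarrow> bb i \<in> letters k" "i \<le> k \<Longrightarrow> - bb i \<in> letters k"
  by (auto simp: letters_def)

lemma nrm_zm: "y \<in> letters k \<Longrightarrow> - y \<in> letters k \<Longrightarrow> nrm k (nat \<bar>j\<bar>) (zm j y)"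
proof (induction j rule: int_induct[where k = 0])
  case (step1 i)
  then have "nrm k (1 + nat \<bar>i\<bar>) (y + zm i y)" by (intro nrm_add nrm_S) auto
  moreover have "1 + nat \<bar>i\<bar> = nat \<bar>i + 1\<bar>" using step1 by simp
  ultimately show ?case by (simp only: zm_Suc)
next
  case (step2 i)
  then have "nrm k (1 + nat \<bar>i\<bar>) (- y + zm i y)" by (intro nrm_add nrm_S) auto
  moreover have "1 + nat \<bar>i\<bar> = nat \<bar>i - 1\<bar>" using step2 by simp
  ultimately show ?case by (simp only: zm_diff1)
qed simp

lemma nrm_T: "nrm k (nat \<bar>j\<bar>) (T j)"
  by (rule nrm_zm) (simp_all add: S_x)

lemma nrm_bb: "nrm k (nat \<bar>j\<bar>) (zm j (bb k))"
  by (rule nrm_zm) (simp_all add: S_x)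

lemma S_ex: "y \<in> letters k \<Longrightarrow> \<bar>ex y\<bar> = 1"
  by (auto simp: letters_def)

lemma S_G: "y \<in> letters k \<Longrightarrow> y \<in> G k"
proof -
  assume "y \<in> letters k"
  then obtain i where i: "i \<le> k" "y \<in> {gx i, - gx i, bb i, - bb i}" by (auto simp: letters_def)
  have "bb i \<in> G k" using bb_G[of i] G_mono[OF i(1)] by blast
  then show ?thesis using i x_G G_uminus by blast
qed

lemma nrm_ex: "nrm k n g \<Longrightarrow> nat \<bar>ex g\<bar> \<le> n"
proof -
  have "\<bar>ex (sum_list l)\<bar> \<le> int (length l)" if "set l \<subseteq> letters k" for l
    using that
  proof (induction l)
    case (Cons y l)
    then show ?case using S_ex[of y k] by auto
  qed simp
  then show "nrm k n g \<Longrightarrow> ?thesis" unfolding nrm_def by force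
qed

lemma nrm_G: "nrm k n g \<Longrightarrow> g \<in> G k"
proof -
  have "sum_list l \<in> G k" if "set l \<subseteq> letters k" for l
    using that by (induction l) (simp_all add: G_add S_G)
  then show "nrm k n g \<Longrightarrow> ?thesis" unfolding nrm_def by blast
qed

section \<open>Lengths in \<open>H k\<close> and lengths of pinch-free forms\<close>

definition H_norm :: "nat \<Rightarrow> nat \<Rightarrow> hyd \<Rightarrow> bool" where
  "H_norm k n h \<longleftrightarrow> (\<exists>w \<in> words {1..k}. length w \<le> n \<and> eval gx w = h)"

lemma H_norm_0 [simp]: "H_norm k n 0"
  unfolding H_norm_def by (rule bexI[of _ "[]"]) simp_all

lemma H_norm_add: "H_norm k a g \<Longrightarrow> H_norm k b h \<Longrightarrow> H_norm k (a + b) (g + h)"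
  unfolding H_norm_def
proof (elim bexE conjE)
  fix u v assume "u \<in> words {1..k}" "length u \<le> a" "eval gx u = g" "v \<in> words {1..k}" "length v \<le> b" "eval gx v = h"
  then show "\<exists>w \<in> words {1..k}. length w \<le> a + b \<and> eval gx w = g + h"
    by (intro bexI[of _ "u @ v"]) simp_all
qed

lemma length_inv_word [simp]: "length (inv_word w) = length w"
  by (simp add: inv_word_def)

lemma H_norm_uminus: "H_norm k a g \<Longrightarrow> H_norm k a (- g)"
  unfolding H_norm_def
proof (elim bexE conjE)
  fix u assume "u \<in> words {1..k}" "length u \<le> a" "eval gx u = g"
  then show "\<exists>w \<in> words {1..k}. length w \<le> a \<and> eval gx w = - g"
    by (intro bexI[of _ "inv_word u"]) simp_all
qed

lemma H_norm_mono: "H_norm k a g \<Longrightarrow> a \<le> b \<Longrightarrow> k \<le> k' \<Longrightarrow> H_norm k' b g"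
  unfolding H_norm_def by (meson words_mono atLeastatMost_subset_iff order_refl order_trans)

lemma H_norm_H: "H_norm k n h \<Longrightarrow> h \<in> H k"
  unfolding H_norm_def H_def by blast

lemma H_H_norm: "h \<in> H k \<Longrightarrow> \<exists>n. H_norm k n h"
  unfolding H_norm_def H_def by blast

lemma H_norm_x: "1 \<le> i \<Longrightarrow> i \<le> k \<Longrightarrow> H_norm k 1 (gx i)"
  unfolding H_norm_def by (rule bexI[of _ "[(i, True)]"]) simp_all

fun sylnorm :: "nat \<Rightarrow> nat \<Rightarrow> (bool \<times> hyd) list \<Rightarrow> bool" where
  "sylnorm m N [] \<longleftrightarrow> True"
| "sylnorm m N ((b, g) # l) \<longleftrightarrow> (\<exists>n n'. n + n' \<le> N \<and> nrm m n g \<and> sylnorm m n' l)"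

lemma sylnorm_nrm: "sylnorm m N l \<Longrightarrow> (b, g) \<in> set l \<Longrightarrow> nrm m N g"
proof (induction m N l rule: sylnorm.induct)
  case (2 m N b' g' l)
  then obtain n n' where n: "n + n' \<le> N" "nrm m n g'" "sylnorm m n' l" by auto
  show ?case
  proof (cases "(b, g) \<in> set l")
    case True
    then have "nrm m n' g" using 2(1) n by blast
    then show ?thesis using n(1) nrm_mono by (metis add_leD2)
  next
    case False
    then have "g = g'" using 2 by auto
    then show ?thesis using n nrm_mono by (metis add_leD1)
  qed
qed simp

definition sylform :: "nat \<Rightarrow> nat \<Rightarrow> nat \<Rightarrow> hyd \<Rightarrow> bool" where
  "sylform m N L g \<longleftrightarrow> (\<exists>g0 l n n'. nrm m n g0 \<and> sylnorm m n' l \<and> n + n' \<le> N \<and> length l \<le> L \<and>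
     no_pinch (assoc m) l \<and> val m g0 l = g)"

lemma sylform_base:
  assumes "sylform m N L g" "nrm m a y"
  shows "sylform m (N + a) L (y + g)"
proof -
  obtain g0 l n n' where l: "nrm m n g0" "sylnorm m n' l" "n + n' \<le> N" "length l \<le> L"
     "no_pinch (assoc m) l" "val m g0 l = g"
    using assms(1) unfolding sylform_def by blast
  have "nrm m (a + n) (y + g0)" using assms(2) l(1) by (rule nrm_add)
  moreover have "val m (y + g0) l = y + g" using l(6) by (simp only: val_add_left)
  moreover have "a + n + n' \<le> N + a" using l(3) by simp
  ultimately show ?thesis unfolding sylform_def using l by blast
qed

text \<open>If the new letter closes a pinch, a power of \<open>bb m\<close> or of t is traded for
  the same power of the other. All letters have exponent sum 1 or -1, so the exponent is at most the
  length of the old syllable and nothing grows.\<close>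

lemma sylform_stable:
  assumes "sylform m N L g"
  shows "sylform m N (Suc L) ((if b then gx (Suc m) else - gx (Suc m)) + g)"
proof -
  define s where "s = (if b then gx (Suc m) else - gx (Suc m))"
  obtain g0 l n n' where l: "nrm m n g0" "sylnorm m n' l" "n + n' \<le> N" "length l \<le> L"
     "no_pinch (assoc m) l" "val m g0 l = g"
    using assms(1) unfolding sylform_def by blast
  have "sylform m N (Suc L) (s + g)"
  proof (cases "\<exists>h1 l'. l = (\<not> b, h1) # l' \<and> assoc m b g0")
    case True
    then obtain h1 l' where l': "l = (\<not> b, h1) # l'" and a: "assoc m b g0" by blast
    obtain n1 n2 where n: "n1 + n2 \<le> n'" "nrm m n1 h1" "sylnorm m n2 l'" using l(2) l' by auto
    have c: "nrm m n (s + g0 + - s)"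
    proof (cases b)
      case True
      then obtain j where j: "g0 = zm j (bb m)" using a by (auto simp: assoc_def)
      then have "s + g0 + - s = T j" using True bb_conj'[of m j] by (simp add: s_def)
      moreover have "nat \<bar>j\<bar> \<le> n" using nrm_ex[OF l(1)] j by simp
      ultimately show ?thesis using nrm_mono[OF nrm_T] by simp
    next
      case False
      then obtain j where j: "g0 = T j" using a by (auto simp: assoc_def)
      then have "s + g0 + - s = zm j (bb m)" using False bb_conj[of m j] by (simp add: s_def)
      moreover have "nat \<bar>j\<bar> \<le> n" using nrm_ex[OF l(1)] j by simp
      ultimately show ?thesis using nrm_mono[OF nrm_bb] by simp
    qed
    have "nrm m (n + n1) (s + g0 + - s + h1)" by (rule nrm_add[OF c n(2)])
    moreover have "val m (s + g0 + - s + h1) l' = s + g"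
      unfolding l(6)[symmetric] l' val_add_left s_def
      by (cases b) (simp_all only: val.simps if_True if_False not_True_eq_False not_False_eq_True group_norm)
    moreover have "no_pinch (assoc m) l'" using l(5) unfolding l' by (rule no_pinch_tl)
    moreover have "length l' \<le> Suc L" using l(4) l' by simp
    moreover have "n + n1 + n2 \<le> N" using l(3) n(1) by simp
    ultimately show ?thesis unfolding sylform_def using n(3) by blast
  next
    case False
    then have "no_pinch (assoc m) ((b, g0) # l)" by (intro no_pinch_Cons[OF l(5)]) blast
    moreover have "val m 0 ((b, g0) # l) = s + g" unfolding s_def l(6)[symmetric] by simp
    moreover have "sylnorm m N ((b, g0) # l)" using l by auto
    moreover have "length ((b, g0) # l) \<le> Suc L" using l(4) by simp
    moreover have "nrm m 0 0" "0 + N \<le> N" by simp_all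
    ultimately show ?thesis unfolding sylform_def by blast
  qed
  then show ?thesis by (simp only: s_def)
qed

lemma sylform_mono: "sylform m N L g \<Longrightarrow> N \<le> N' \<Longrightarrow> L \<le> L' \<Longrightarrow> sylform m N' L' g"
  unfolding sylform_def using order_trans[of _ N N'] order_trans[of _ L L'] by blast

text \<open>The factor 2 pays for \<open>bb (Suc m)\<close>, which is one stable letter between two
  letters t.\<close>

lemma nrm_sylform: "nrm (Suc m) n g \<Longrightarrow> sylform m (2 * n) n g"
proof -
  have "sylform m (2 * length l) (length l) (sum_list l)" if "set l \<subseteq> letters (Suc m)" for l
    using that
  proof (induction l)
    case Nil
    have "nrm m 0 0" "sylnorm m 0 []" "no_pinch (assoc m) []" "val m 0 [] = 0" by simp_all
    then show ?case unfolding sylform_def by (metis add_0 le_refl list.size(3) mult_0_right sum_list.Nil)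
  next
    case (Cons y l)
    define g where "g = sum_list l"
    have IH: "sylform m (2 * length l) (length l) g" using Cons by (simp add: g_def)
    note stable = sylform_stable[of m _ _ _ True, unfolded if_True] sylform_stable[of m _ _ _ False, unfolded if_False]
    have "sylform m (2 * length l + 2) (Suc (length l)) (y + g)"
    proof (cases "y \<in> letters m")
      case True
      from sylform_base[OF IH nrm_S[OF this]] show ?thesis by (rule sylform_mono) simp_all
    next
      case False
      then have "y \<in> {gx (Suc m), - gx (Suc m), bb (Suc m), - bb (Suc m)}"
        using Cons.prems by (auto simp: letters_def le_Suc_eq)
      moreover have "sylform m (2 * length l + 2) (Suc (length l)) (gx (Suc m) + g)"
        "sylform m (2 * length l + 2) (Suc (length l)) (- gx (Suc m) + g)"
        using stable[OF IH] sylform_mono by (metis le_add1 le_refl)+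
      moreover have X: "nrm m 1 (gx 0)" "nrm m 1 (- gx 0)" by (intro nrm_S S_x le0)+
      have "sylform m (2 * length l + 1 + 1) (Suc (length l)) (gx 0 + (- gx (Suc m) + (gx 0 + g)))"
        by (intro sylform_base[OF _ X(1)] stable(2) IH)
      moreover have "sylform m (2 * length l + 1 + 1) (Suc (length l)) (- gx 0 + (gx (Suc m) + (- gx 0 + g)))"
        by (intro sylform_base[OF _ X(2)] stable(1) IH)
      moreover have "bb (Suc m) + g = gx 0 + (- gx (Suc m) + (gx 0 + g))"
        "- bb (Suc m) + g = - gx 0 + (gx (Suc m) + (- gx 0 + g))"
        unfolding bb_def by (simp_all only: group_norm)
      moreover have "2 * length l + 1 + 1 = 2 * length l + 2" by simp
      ultimately show ?thesis by (elim insertE emptyE) (simp_all only:)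
    qed
    then show ?case by (simp add: g_def)
  qed
  then show "nrm (Suc m) n g \<Longrightarrow> ?thesis" unfolding nrm_def
    using sylform_mono by (metis mult_le_mono2)
qed

text \<open>Right multiplication by \<open>u\<close> changes the last syllable only. If there is no
  stable letter, that is the leading syllable, which the users of \<open>addr\<close> adjust
  themselves.\<close>

fun addr :: "(bool \<times> hyd) list \<Rightarrow> hyd \<Rightarrow> (bool \<times> hyd) list" where
  "addr [] u = []"
| "addr ((b, g) # l) u = (b, if l = [] then g + u else g) # addr l u"

lemma val_addr: "val m (if l = [] then g + u else g) (addr l u) = val m g l + u"
proof (induction l arbitrary: g)
  case (Cons s l)
  obtain b h where s: "s = (b, h)" by force
  show ?case using Cons[of h] by (simp add: s add.assoc)
qed simp

lemma addr_G: "snd ` set l \<subseteq> G m \<Longrightarrow> u \<in> G m \<Longrightarrow> snd ` set (addr l u) \<subseteq> G m"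
  by (induction l u rule: addr.induct) (simp_all add: G_add)

lemma no_pinch_addr: "no_pinch P l \<Longrightarrow> no_pinch P (addr l u)"
proof (induction P l rule: no_pinch.induct)
  case (1 P b v b' v' l)
  then show ?case by (cases l) auto
next
  case ("2_2" P s)
  then show ?case by (cases s) simp
qed simp_all

lemma addr_Nil_iff [simp]: "addr l u = [] \<longleftrightarrow> l = []"
  by (cases l) auto

text \<open>Both kinds of tail are controlled together because passing a stable letter turns one
  into the other.\<close>

definition distorted_by :: "nat \<Rightarrow> (nat \<Rightarrow> nat) \<Rightarrow> bool" where
  "distorted_by k f \<longleftrightarrow> mono f \<and> (\<forall>n. n \<le> f n) \<and>
     (\<forall>n g h j. nrm k n g \<longrightarrow> h \<in> H k \<longrightarrow> h + T j = g \<or> h + zm j (bb k) = g \<longrightarrow>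
        nat \<bar>j\<bar> \<le> f n \<and> H_norm k (f n) h)"

lemma peel_eq:
  fixes h0 :: "'g::group_add"
  assumes "h0 + s + u = g0 + s + v" "- h0 + g0 = c"
  shows "u = - s + c + s + v"
proof -
  have "u = - (h0 + s) + (h0 + s + u)" by (simp only: group_norm)
  then show ?thesis unfolding assms(1) assms(2)[symmetric] by (simp only: group_norm)
qed

lemma le_funpow: "(\<And>r. r \<le> F r) \<Longrightarrow> r \<le> (F ^^ p) (r :: nat)"
  by (induction p) (auto intro: order_trans)

text \<open>Peel off the common first stable letter. The discrepancy \<open>c\<close> of the leading
  syllables lies in an associated subgroup, and \<open>f\<close> bounds its exponent and the length
  of \<open>h0\<close>. Carried past the letter, \<open>c\<close> joins the next syllable, so the
  length \<open>r\<close> becomes at most \<open>f r + N\<close>. Each round adds at most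
  \<open>X\<close> plus one stable letter to the length in \<open>H (Suc m)\<close>.\<close>

lemma distortion_run:
  assumes f: "distorted_by m f"
    and h: "h0 \<in> H m" "snd ` set lh \<subseteq> H m" "no_pinch (assoc m) lh"
    and g: "nrm m r g0" "\<And>b g. (b, g) \<in> set lg \<Longrightarrow> nrm m N g" "no_pinch (assoc m) lg"
    and eq: "val m h0 lh + T j = val m g0 lg"
  defines "X \<equiv> f (((\<lambda>r. f r + N) ^^ length lg) r)"
  shows "nat \<bar>j\<bar> \<le> X \<and> H_norm (Suc m) (Suc (length lg) * (X + 1)) (val m h0 lh)"
  using h g eq unfolding X_def
proof (induction lg arbitrary: h0 lh g0 r)
  case Nil
  note h = Nil(1-3)
  have H: "h0 \<in> G m" "snd ` set lh \<subseteq> G m" using h H_sub_G[of m] by auto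
  have v: "val m (if lh = [] then h0 + T j else h0) (addr lh (T j)) = val m g0 []"
    using Nil(7) by (simp only: val_addr)
  have "(if lh = [] then h0 + T j else h0) \<in> G m" using H(1) T_G by (simp add: G_add)
  from this addr_G[OF H(2) T_G] no_pinch_addr[OF h(3)] nrm_G[OF Nil(4)] _ _ v
  have "lh = []" by (rule hnn_compare) simp_all
  then have e: "h0 + T j = g0" using Nil(7) by simp
  with f Nil(4) h(1) have "nat \<bar>j\<bar> \<le> f r \<and> H_norm m (f r) h0" unfolding distorted_by_def by blast
  moreover from this have "H_norm (Suc m) (f r + 1) h0" by (auto elim: H_norm_mono)
  ultimately show ?case using \<open>lh = []\<close> by simp
next
  case (Cons s lg)
  note h = Cons.prems(1-3)
  obtain b g1 where s: "s = (b, g1)" by force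
  have H: "h0 \<in> G m" "snd ` set lh \<subseteq> G m" using h H_sub_G[of m] by auto
  have v: "val m (if lh = [] then h0 + T j else h0) (addr lh (T j)) = val m g0 (s # lg)"
    using Cons.prems(7) by (simp only: val_addr)
  have G0: "(if lh = [] then h0 + T j else h0) \<in> G m" using H(1) T_G by (simp add: G_add)
  have lgG: "snd ` set (s # lg) \<subseteq> G m" using Cons.prems(5) nrm_G by fastforce
  obtain h1 l' where l': "addr lh (T j) = (b, h1) # l'"
    and a: "assoc m (\<not> b) (- g0 + (if lh = [] then h0 + T j else h0))"
    using G0 addr_G[OF H(2) T_G] no_pinch_addr[OF h(3)] nrm_G[OF Cons.prems(4)] lgG Cons.prems(6) v
    by (rule hnn_compare) (auto simp: s)
  obtain h1 lh' where lh: "lh = (b, h1) # lh'" using l' by (cases lh) auto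
  define y where "y = (if b then gx (Suc m) else - gx (Suc m))"
  define c where "c = - h0 + g0"
  have c0: "h0 + c = g0" by (simp add: c_def)
  have ac: "assoc m (\<not> b) (- g0 + h0)" using a lh by simp
  have c': "nat \<bar>ex c\<bar> \<le> f r \<and> H_norm m (f r) h0 \<and> nrm m (f r) (- y + c + y)"
  proof (cases b)
    case True
    then obtain i where "- g0 + h0 = T i" using ac by (auto simp: assoc_def)
    moreover have "c = - (- g0 + h0)" unfolding c_def by (simp only: group_norm)
    ultimately have c: "c = T (- i)" by simp
    then have "h0 + T (- i) = g0" using c0 by simp
    with f Cons.prems(4) h(1) have *: "nat \<bar>- i\<bar> \<le> f r \<and> H_norm m (f r) h0" unfolding distorted_by_def by blast
    have "- y + c + y = zm (- i) (bb m)" using True c bb_conj[of m "- i"] by (simp only: y_def if_True)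
    then have "nrm m (f r) (- y + c + y)" using nrm_mono[OF nrm_bb[of m "- i"]] * by simp
    with * c show ?thesis by simp
  next
    case False
    then obtain i where "- g0 + h0 = zm i (bb m)" using ac by (auto simp: assoc_def)
    moreover have "c = - (- g0 + h0)" unfolding c_def by (simp only: group_norm)
    ultimately have c: "c = zm (- i) (bb m)" by simp
    then have "h0 + zm (- i) (bb m) = g0" using c0 by simp
    with f Cons.prems(4) h(1) have *: "nat \<bar>- i\<bar> \<le> f r \<and> H_norm m (f r) h0" unfolding distorted_by_def by blast
    have "- y + c + y = T (- i)" using False c bb_conj'[of m "- i"]
      by (simp only: y_def if_False group_norm)
    then have "nrm m (f r) (- y + c + y)" using nrm_mono[OF nrm_T[of m "- i"]] * by simp
    with * c show ?thesis by simp
  qed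
  define r' where "r' = f r + N"
  have "h0 + y + (val m h1 lh' + T j) = g0 + y + val m g1 lg"
    using Cons.prems(7) unfolding lh s y_def by (simp only: val.simps add.assoc)
  from peel_eq[OF this c_def[symmetric]]
  have "val m h1 lh' + T j = val m (- y + c + y + g1) lg" by (simp only: val_add_left)
  moreover have "nrm m r' (- y + c + y + g1)"
    unfolding r'_def using c' Cons.prems(5)[of b g1] s by (intro nrm_add) auto
  moreover have "h1 \<in> H m" "snd ` set lh' \<subseteq> H m" using h(2) lh by auto
  moreover have "no_pinch (assoc m) lh'" "no_pinch (assoc m) lg"
    using no_pinch_tl h(3) Cons.prems(6) unfolding lh by blast+
  moreover have "nrm m N g" if "(b, g) \<in> set lg" for b g using that Cons.prems(5)[of b g] by simp
  ultimately have IH: "nat \<bar>j\<bar> \<le> f (((\<lambda>r. f r + N) ^^ length lg) r')"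
    "H_norm (Suc m) (Suc (length lg) * (f (((\<lambda>r. f r + N) ^^ length lg) r') + 1)) (val m h1 lh')"
    using Cons.IH[of h1 lh' r' "- y + c + y + g1"] by blast+
  define Y where "Y = f (((\<lambda>r. f r + N) ^^ length (s # lg)) r)"
  have Y: "f (((\<lambda>r. f r + N) ^^ length lg) r') = Y"
    by (simp only: Y_def r'_def length_Cons funpow_Suc_right o_apply)
  have F: "r \<le> f r + N" for r using f unfolding distorted_by_def by (meson le_add1 order_trans)
  have "f r \<le> Y" unfolding Y_def using f le_funpow[OF F] unfolding distorted_by_def mono_def by blast
  have "H_norm (Suc m) (f r) h0" using c' by (auto elim: H_norm_mono)
  moreover have "H_norm (Suc m) 1 y" unfolding y_def by (cases b) (simp_all add: H_norm_x H_norm_uminus)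
  ultimately have "H_norm (Suc m) (f r + 1 + Suc (length lg) * (Y + 1)) (h0 + y + val m h1 lh')"
    using IH(2) unfolding Y by (intro H_norm_add)
  then have "H_norm (Suc m) (Suc (length (s # lg)) * (Y + 1)) (h0 + y + val m h1 lh')"
    by (rule H_norm_mono) (use \<open>f r \<le> Y\<close> in simp_all)
  moreover have "val m h0 lh = h0 + y + val m h1 lh'" unfolding lh y_def by (simp only: val.simps)
  ultimately show ?case using IH(1) unfolding Y Y_def[symmetric] by simp
qed

text \<open>The bound of \<open>distortion_run\<close> for at most \<open>n\<close> stable letters
  and base syllables of length at most \<open>2 * n\<close>, as supplied by
  \<open>nrm_sylform\<close>.\<close>

definition tau :: "(nat \<Rightarrow> nat) \<Rightarrow> nat \<Rightarrow> nat" where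
  "tau f n = Suc n * (f (((\<lambda>r. f r + 2 * n) ^^ n) (2 * n)) + 1)"

lemma funpow_mono_le:
  assumes "\<And>r. F r \<le> (F' r :: nat)" "mono F'" "r \<le> r'" "p \<le> q" "\<And>r. r \<le> F' r"
  shows "(F ^^ p) r \<le> (F' ^^ q) r'"
proof -
  have "(F ^^ p) r \<le> (F' ^^ p) r'"
    by (induction p) (use assms(1,2,3) in \<open>auto intro: order_trans monoD\<close>)
  also have "\<dots> \<le> (F' ^^ (q - p)) ((F' ^^ p) r')" by (rule le_funpow) (rule assms(5))
  also have "\<dots> = (F' ^^ q) r'" using assms(4) by (simp flip: funpow_add[THEN fun_cong, unfolded o_apply])
  finally show ?thesis .
qed

lemma tau_mono: "mono f \<Longrightarrow> (\<And>n. n \<le> f n) \<Longrightarrow> mono (tau f)"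
proof (rule monoI)
  fix n n' :: nat assume f: "mono f" "\<And>n. n \<le> f n" and n: "n \<le> n'"
  have "((\<lambda>r. f r + 2 * n) ^^ n) (2 * n) \<le> ((\<lambda>r. f r + 2 * n') ^^ n') (2 * n')"
    using f n by (intro funpow_mono_le) (auto simp: mono_def intro: trans_le_add1)
  then show "tau f n \<le> tau f n'"
    unfolding tau_def using f(1) n by (intro mult_le_mono add_le_mono) (auto dest: monoD)
qed

lemma tau_ge: "n \<le> tau f n"
proof -
  have "n * 1 \<le> Suc n * (f (((\<lambda>r. f r + 2 * n) ^^ n) (2 * n)) + 1)"
    by (intro mult_le_mono) simp_all
  then show ?thesis by (simp only: tau_def mult_1_right)
qed

lemma distortion_T:
  assumes f: "distorted_by m f" and g: "nrm (Suc m) n g" and h: "h \<in> H (Suc m)" and eq: "h + T j = g"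
  shows "nat \<bar>j\<bar> \<le> tau f n \<and> H_norm (Suc m) (tau f n) h"
proof -
  obtain h0 lh where lh: "h0 \<in> H m" "snd ` set lh \<subseteq> H m" "no_pinch (assoc m) lh" "val m h0 lh = h"
    by (rule H_syllables[OF trivial_assoc h])
  obtain g0 lg r N where lg: "nrm m r g0" "sylnorm m N lg" "r + N \<le> 2 * n" "length lg \<le> n"
    "no_pinch (assoc m) lg" "val m g0 lg = g"
    using nrm_sylform[OF g] unfolding sylform_def by blast
  have N: "nrm m N g" if "(b, g) \<in> set lg" for b g using sylnorm_nrm[OF lg(2) that] .
  define X where "X = f (((\<lambda>r. f r + N) ^^ length lg) r)"
  have X: "nat \<bar>j\<bar> \<le> X \<and> H_norm (Suc m) (Suc (length lg) * (X + 1)) h"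
    using distortion_run[OF f lh(1-3) lg(1) N lg(5)] eq lh(4) lg(6) unfolding X_def by simp
  have mf: "mono f" and ff: "\<And>n. n \<le> f n" using f unfolding distorted_by_def by auto
  define Z where "Z = f (((\<lambda>r. f r + 2 * n) ^^ n) (2 * n))"
  have "((\<lambda>r. f r + N) ^^ length lg) r \<le> ((\<lambda>r. f r + 2 * n) ^^ n) (2 * n)"
    using lg(3,4) mf ff by (intro funpow_mono_le) (auto simp: mono_def intro: trans_le_add1)
  then have "X \<le> Z" unfolding X_def Z_def using mf by (rule_tac monoD)
  then have le: "Suc (length lg) * (X + 1) \<le> tau f n"
    unfolding tau_def Z_def[symmetric] using lg(4) by (intro mult_le_mono) auto
  moreover have "X \<le> Suc (length lg) * (X + 1)" by simp
  ultimately show ?thesis using X by (auto elim: H_norm_mono)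
qed

text \<open>Peeling equal first letters with \<open>hnn_compare\<close> keeps both forms pinch-free,
  so the number of stable letters is an invariant of the element.\<close>

lemma length_unique:
  assumes "g \<in> G m" "snd ` set l \<subseteq> G m" "no_pinch (assoc m) l"
    and "h \<in> G m" "snd ` set l' \<subseteq> G m" "no_pinch (assoc m) l'"
    and "val m g l = val m h l'"
  shows "length l = length l'"
  using assms
proof (induction l arbitrary: g h l')
  case Nil
  then show ?case by (rule hnn_compare) simp_all
next
  case (Cons s l)
  from Cons.prems obtain b g1 h1 t where s: "s = (b, g1)" and l': "l' = (b, h1) # t"
    and a: "assoc m (\<not> b) (- h + g)"
    by (rule hnn_compare) auto
  define y where "y = (if b then gx (Suc m) else - gx (Suc m))"
  have c: "- y + (- h + g) + y \<in> G m"
  proof (cases b)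
    case True
    then obtain i where "- h + g = T i" using a by (auto simp: assoc_def)
    then have "- y + (- h + g) + y = zm i (bb m)" using True bb_conj[of m i] by (simp only: y_def if_True)
    then show ?thesis by (simp only: zm_G bb_G)
  next
    case False
    then obtain i where "- h + g = zm i (bb m)" using a by (auto simp: assoc_def)
    then have "- y + (- h + g) + y = T i" using False bb_conj'[of m i]
      by (simp only: y_def if_False group_norm)
    then show ?thesis by (simp only: T_G)
  qed
  have "h + y + val m h1 t = g + y + val m g1 l"
    using Cons.prems(7) unfolding s l' y_def by (simp only: val.simps add.assoc)
  from peel_eq[OF this HOL.refl] have "val m (- y + (- h + g) + y + g1) l = val m h1 t"
    by (simp only: val_add_left)
  moreover have "g1 \<in> G m" "snd ` set l \<subseteq> G m" "h1 \<in> G m" "snd ` set t \<subseteq> G m"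
    using Cons.prems(2,5) unfolding s l' by auto
  moreover have "no_pinch (assoc m) l" "no_pinch (assoc m) t"
    using no_pinch_tl Cons.prems(3,6) unfolding l' by blast+
  ultimately have "length l = length t" using c by (intro Cons.IH) (auto intro: G_add)
  then show ?case by (simp add: l')
qed

lemma no_pinch_append:
  assumes "no_pinch P l" "no_pinch P t"
    and "\<And>b g s t'. (b, g) \<in> set l \<Longrightarrow> t = s # t' \<Longrightarrow> fst s = (\<not> b) \<Longrightarrow> \<not> P b (g + u)"
  shows "no_pinch P (addr l u @ t)"
  using assms
proof (induction P l rule: no_pinch.induct)
  case (1 P b v b' v' l)
  have "no_pinch P (addr ((b', v') # l) u @ t)"
    using 1(2) by (intro 1(1)[OF _ 1(3) 1(4)]) simp_all
  then show ?case using 1(2) by simp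
next
  case ("2_2" P s)
  obtain b g where s: "s = (b, g)" by force
  show ?case
  proof (cases t)
    case (Cons s' t')
    obtain b' g' where s': "s' = (b', g')" by force
    show ?thesis using "2_2"(2) "2_2"(3)[of b g s' t'] by (auto simp: s s' Cons)
  qed (simp add: s)
qed simp_all

text \<open>Where the form of \<open>h\<close> meets a positive power of \<open>bb (Suc m)\<close>
  no pinch arises, by \<open>x_0_notin_H_bb\<close>. The \<open>j\<close> stable letters of the
  power thus survive in \<open>g\<close>, which has at most \<open>n\<close>.\<close>

lemma distortion_bb_pos:
  assumes m: "m \<ge> 1" and g: "nrm (Suc m) n g" and h: "h \<in> H (Suc m)" and eq: "h + zm (int j) (bb (Suc m)) = g"
  shows "j \<le> n"
proof (cases j)
  case (Suc i)
  obtain h0 lh where lh: "h0 \<in> H m" "snd ` set lh \<subseteq> H m" "no_pinch (assoc m) lh" "val m h0 lh = h"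
    "h0 \<in> G m" "snd ` set lh \<subseteq> G m"
    by (rule H_syllables_G[OF trivial_assoc h])
  obtain g0 lg r N where lg: "nrm m r g0" "sylnorm m N lg" "length lg \<le> n"
    "no_pinch (assoc m) lg" "val m g0 lg = g"
    using nrm_sylform[OF g] unfolding sylform_def by blast
  have lgG: "snd ` set lg \<subseteq> G m" using sylnorm_nrm[OF lg(2)] nrm_G by fastforce
  define t where "t = bb_tail i 0"
  have tG: "snd ` set t \<subseteq> G m" unfolding t_def by (intro bb_tail_G G_zero)
  have "no_pinch (assoc m) (addr lh (gx 0) @ t)"
  proof (rule no_pinch_append[OF lh(3)])
    show "no_pinch (assoc m) t" unfolding t_def by (rule no_pinch_bb_tail)
    fix b g0 s t' assume g0: "(b, g0) \<in> set lh" and s: "t = s # t'" "fst s = (\<not> b)"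
    then have b using bb_tail_Cons[of i 0] unfolding t_def by auto
    have g0H: "g0 \<in> H m" using g0 lh(2) by force
    show "\<not> assoc m b (g0 + gx 0)"
    proof
      assume "assoc m b (g0 + gx 0)"
      then obtain p where "g0 + gx 0 = zm p (bb m)" using \<open>b\<close> by (auto simp: assoc_def)
      then have "gx 0 - zm p (bb m) = - g0"
        by (simp only: group_norm flip: \<open>g0 + gx 0 = zm p (bb m)\<close>)
      then show False using x_0_notin_H_bb[OF T_bb_separated[OF m]] H_uminus[OF g0H] by metis
    qed
  qed
  moreover have "val m (if lh = [] then h0 + gx 0 else h0) (addr lh (gx 0) @ t) = val m g0 lg"
  proof -
    have v: "val m (if l = [] then c + gx 0 else c) (addr l (gx 0) @ t) = val m c l + zm (int (Suc i)) (bb (Suc m))" for c l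
    proof (induction l arbitrary: c)
      case Nil
      show ?case using bb_power_syllables[of c i m 0] unfolding t_def by simp
    next
      case (Cons s l)
      obtain b c1 where s: "s = (b, c1)" by force
      show ?case using Cons[of c1] by (simp add: s add.assoc)
    qed
    show ?thesis unfolding v lh(4) lg(5) using eq Suc by simp
  qed
  moreover have "(if lh = [] then h0 + gx 0 else h0) \<in> G m" using lh(5) by (simp add: G_add x_G)
  moreover have "snd ` set (addr lh (gx 0) @ t) \<subseteq> G m" using tG addr_G[OF lh(6) x_G[of 0 m]] by auto
  ultimately have "length (addr lh (gx 0) @ t) = length lg"
    using nrm_G[OF lg(1)] lgG lg(4) by (intro length_unique)
  moreover have "length t = Suc i" unfolding t_def by (induction i) simp_all
  ultimately show ?thesis using lg(3) Suc by simp
qed simp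

text \<open>A positive power of \<open>bb (Suc m)\<close> has exponent at most \<open>n\<close> and
  is moved over to \<open>g\<close>, doubling the length. A negative one is rewritten by the hydra
  identity as a positive word and a power of t; that power bounds both \<open>i\<close> and the
  length of the word.\<close>

lemma distorted_by_Suc:
  assumes m: "m \<ge> 1" and f: "distorted_by m f"
  shows "distorted_by (Suc m) (\<lambda>n. 2 * tau f (2 * n))"
proof -
  have mf: "mono f" and ff: "\<And>n. n \<le> f n" using f unfolding distorted_by_def by auto
  note mt = tau_mono[OF mf ff]
  have t2: "tau f n \<le> tau f (2 * n)" for n by (rule monoD[OF mt]) simp
  have "nat \<bar>j\<bar> \<le> 2 * tau f (2 * n) \<and> H_norm (Suc m) (2 * tau f (2 * n)) h"
    if g: "nrm (Suc m) n g" and h: "h \<in> H (Suc m)" and eq: "h + zm j (bb (Suc m)) = g" for n g h j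
  proof (cases "j \<ge> 0")
    case True
    then obtain i where j: "j = int i" using nonneg_int_cases by blast
    have i: "i \<le> n" by (rule distortion_bb_pos[OF m g h eq[unfolded j]])
    have "nrm (Suc m) (n + nat \<bar>- int i\<bar>) (g + zm (- int i) (bb (Suc m)))" by (rule nrm_add[OF g nrm_bb])
    then have "nrm (Suc m) (2 * n) (g + zm (- int i) (bb (Suc m)))" by (rule nrm_mono) (use i in simp)
    moreover have "h + T 0 = g + zm (- int i) (bb (Suc m))"
      unfolding eq[symmetric] j zm_minus zm_0 by (simp only: group_norm)
    ultimately have "H_norm (Suc m) (tau f (2 * n)) h" using distortion_T[OF f _ h] by blast
    then have "H_norm (Suc m) (2 * tau f (2 * n)) h" by (rule H_norm_mono) simp_all
    moreover have "i \<le> tau f (2 * n)" using i tau_ge[of "2 * n" f] by simp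
    ultimately show ?thesis by (simp add: j)
  next
    case False
    then obtain i where j: "j = - int i" by (metis minus_minus neg_0_le_iff_le nonneg_int_cases linear)
    obtain l where l: "set l \<subseteq> {1..Suc m}" "zm (- int i) (bb (Suc m)) = eval gx (pos l) + T (- int (hydra_steps (Suc m) i))"
      using bb_neg_power by blast
    define y where "y = hydra_steps (Suc m) i"
    have y: "y = length l + i" using bb_neg_power_length[OF l(2)] by (simp add: y_def)
    have lh: "H_norm (Suc m) (length l) (eval gx (pos l))" unfolding H_norm_def using l(1) by (intro bexI[of _ "pos l"]) simp_all
    have "h + eval gx (pos l) \<in> H (Suc m)" by (intro H_add h H_norm_H[OF lh])
    moreover have "h + eval gx (pos l) + T (- int y) = g" using eq unfolding j l(2) y_def by (simp only: add.assoc)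
    ultimately have *: "nat \<bar>- int y\<bar> \<le> tau f n" "H_norm (Suc m) (tau f n) (h + eval gx (pos l))"
      using distortion_T[OF f g] by blast+
    have "H_norm (Suc m) (tau f n + length l) (h + eval gx (pos l) + - eval gx (pos l))"
      by (intro H_norm_add * H_norm_uminus lh)
    then have "H_norm (Suc m) (tau f n + length l) h" by (simp only: group_norm)
    then have "H_norm (Suc m) (2 * tau f (2 * n)) h" by (rule H_norm_mono) (use * y t2[of n] in simp_all)
    then show ?thesis using * y t2[of n] by (simp add: j)
  qed
  moreover have "nat \<bar>j\<bar> \<le> 2 * tau f (2 * n) \<and> H_norm (Suc m) (2 * tau f (2 * n)) h"
    if "nrm (Suc m) n g" "h \<in> H (Suc m)" "h + T j = g" for n g h j
  proof -
    have "nat \<bar>j\<bar> \<le> tau f n" "H_norm (Suc m) (tau f n) h" using distortion_T[OF f that] by blast+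
    then show ?thesis using t2[of n] by (auto elim: H_norm_mono)
  qed
  moreover have "mono (\<lambda>n. 2 * tau f (2 * n))" using mt by (auto simp: mono_def)
  moreover have "n \<le> 2 * tau f (2 * n)" for n using tau_ge[of "2 * n" f] by simp
  ultimately show ?thesis unfolding distorted_by_def by blast
qed

section \<open>The base case, where t and x_1 commute\<close>

lemma zm_x_1_T: "zm i (gx 1) + T p = T p + zm i (gx 1)"
  by (rule zm_commute[OF zm_commute[OF x_0_1_commute, symmetric]])

text \<open>The factor 2 for t comes from the letter \<open>bb 1\<close>, which is x_1^-1
  t^2.\<close>

lemma nrm_1: "nrm 1 n g \<Longrightarrow> \<exists>p q. g = T p + zm q (gx 1) \<and> nat \<bar>p\<bar> \<le> 2 * n \<and> nat \<bar>q\<bar> \<le> n"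
proof -
  note xT = zm_x_1_T
  have "\<exists>p q. sum_list l = T p + zm q (gx 1) \<and> nat \<bar>p\<bar> \<le> 2 * length l \<and> nat \<bar>q\<bar> \<le> length l" if "set l \<subseteq> letters 1" for l
    using that
  proof (induction l)
    case Nil
    show ?case by (intro exI[of _ 0]) simp
  next
    case (Cons y l)
    then obtain p q where pq: "sum_list l = T p + zm q (gx 1)" "nat \<bar>p\<bar> \<le> 2 * length l" "nat \<bar>q\<bar> \<le> length l"
      by auto
    have "\<exists>c d. y = zm d (gx 1) + T c \<and> \<bar>c\<bar> \<le> 2 \<and> \<bar>d\<bar> \<le> 1"
    proof -
      have "y \<in> {T 1, T (- 1), zm 1 (gx 1), zm (- 1) (gx 1), zm (- 1) (gx 1) + T 2, zm 1 (gx 1) + T (- 2)}"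
      proof -
        have "- bb 1 = T (- 2) + zm 1 (gx 1)" unfolding bb_1 by (simp only: zm_minus zm_1 group_norm)
        moreover have "bb 0 = T 1" by (simp add: bb_def)
        moreover have "y \<in> {gx 0, - gx 0, bb 0, - bb 0, gx 1, - gx 1, bb 1, - bb 1}"
        proof -
          have "{..1::nat} = {0, 1}" by auto
          then show ?thesis using Cons.prems by (auto simp: letters_def)
        qed
        ultimately show ?thesis unfolding xT[symmetric] by (auto simp: bb_1)
      qed
      then consider "y = zm 0 (gx 1) + T 1" | "y = zm 0 (gx 1) + T (- 1)" | "y = zm 1 (gx 1) + T 0"
        | "y = zm (- 1) (gx 1) + T 0" | "y = zm (- 1) (gx 1) + T 2" | "y = zm 1 (gx 1) + T (- 2)"
        unfolding zm_0 add_0_left add_0_right by blast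
      then show ?thesis by cases (rule exI, rule exI, rule conjI, assumption, simp)+
    qed
    then obtain c d where cd: "y = zm d (gx 1) + T c" "\<bar>c\<bar> \<le> 2" "\<bar>d\<bar> \<le> 1" by blast
    have "y + sum_list l = T (c + p) + zm (d + q) (gx 1)"
    proof -
      have "y + sum_list l = (zm d (gx 1) + T (c + p)) + zm q (gx 1)"
        unfolding cd(1) pq(1) by (simp only: zm_add add.assoc)
      then show ?thesis unfolding xT by (simp only: zm_add add.assoc)
    qed
    then show ?case using cd pq by (intro exI[of _ "c + p"] exI[of _ "d + q"]) auto
  qed
  then show "nrm 1 n g \<Longrightarrow> ?thesis" unfolding nrm_def by (metis (no_types, lifting) le_trans mult_le_mono2)
qed

lemma H_1: "h \<in> H 1 \<Longrightarrow> h = zm (ex h) (gx 1)"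
proof -
  have "eval gx w = zm (expo w) (gx 1)" if "w \<in> words {1..1::nat}" for w
    using that
  proof (induction w)
    case (Cons s w)
    then obtain b where s: "s = (1, b)" by (cases s) auto
    have "eval gx (s # w) = (if b then gx 1 else - gx 1) + zm (expo w) (gx 1)" using Cons s by simp
    also have "\<dots> = zm (expo (s # w)) (gx 1)"
      using zm_Suc[of "expo w" "gx 1"] zm_diff1[of "expo w" "gx 1"] by (simp add: s algebra_simps)
    finally show ?case .
  qed simp
  then show "h \<in> H 1 \<Longrightarrow> ?thesis" unfolding H_def using ex_eval by auto
qed

lemma H_norm_1: "H_norm 1 (nat \<bar>r\<bar>) (zm r (gx 1))"
proof (induction r rule: int_induct[where k = 0])
  case (step1 i)
  have "H_norm 1 (1 + nat \<bar>i\<bar>) (gx 1 + zm i (gx 1))" by (intro H_norm_add H_norm_x step1) simp_all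
  moreover have "1 + nat \<bar>i\<bar> = nat \<bar>i + 1\<bar>" using step1 by simp
  ultimately show ?case by (simp only: zm_Suc)
next
  case (step2 i)
  have "H_norm 1 (1 + nat \<bar>i\<bar>) (- gx 1 + zm i (gx 1))" by (intro H_norm_add H_norm_uminus H_norm_x step2) simp_all
  moreover have "1 + nat \<bar>i\<bar> = nat \<bar>i - 1\<bar>" using step2 by simp
  ultimately show ?case by (simp only: zm_diff1)
qed simp

text \<open>Exponents of t and x_1 are unique, so both equations can be solved for \<open>j\<close>
  and for the exponent of \<open>h\<close>.\<close>

lemma distorted_by_1: "distorted_by 1 (\<lambda>n. 2 * n)"
proof -
  note xT = zm_x_1_T
  have key: "j = p \<and> r = q" if "zm r (gx 1) + T j = T p + zm q (gx 1)" for r j p q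
  proof -
    have "T p + zm q (gx 1) = zm q (gx 1) + T p" by (rule xT[symmetric])
    then have "zm r (gx 1) + T j = zm q (gx 1) + T p" using that by simp
    then have "- zm q (gx 1) + (zm r (gx 1) + T j) - T j = - zm q (gx 1) + (zm q (gx 1) + T p) - T j" by simp
    then have "zm (- q) (gx 1) + zm r (gx 1) = T p + T (- j)" by (simp only: zm_minus group_norm)
    then have "T (p + - j) = zm (- q + r) (gx 1)" by (simp only: zm_add)
    then have "T (p - j) \<in> H 1" using zm_H[OF x_H[of 1 1]] by simp
    then have "p = j" using trivial_assoc[of 1] unfolding trivial_assoc_def by fastforce
    moreover have "r + j = p + q" using arg_cong[OF that, of ex] by simp
    ultimately show ?thesis by simp
  qed
  have "nat \<bar>j\<bar> \<le> 2 * n \<and> H_norm 1 (2 * n) h"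
    if g: "nrm 1 n g" and h: "h \<in> H 1" and eq: "h + T j = g \<or> h + zm j (bb 1) = g" for n g h j
  proof -
    obtain p q where pq: "g = T p + zm q (gx 1)" "nat \<bar>p\<bar> \<le> 2 * n" "nat \<bar>q\<bar> \<le> n" using nrm_1[OF g] by blast
    define r where "r = ex h"
    have h': "h = zm r (gx 1)" unfolding r_def by (rule H_1[OF h])
    from eq have "nat \<bar>j\<bar> \<le> 2 * n \<and> nat \<bar>r\<bar> \<le> 2 * n"
    proof
      assume "h + T j = g"
      then show ?thesis using key[of r j p q] pq h' by simp
    next
      assume "h + zm j (bb 1) = g"
      then have "zm (r + - j) (gx 1) + T (2 * j) = T p + zm q (gx 1)"
        unfolding h' zm_bb_1 pq(1) by (simp only: zm_add zm_minus add.assoc)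
      then have "2 * j = p \<and> r + - j = q" by (rule key)
      then show ?thesis using pq by auto
    qed
    then show ?thesis using H_norm_1[of r] H_norm_mono h' by blast
  qed
  then show ?thesis unfolding distorted_by_def by (auto simp: mono_def)
qed

fun distortion :: "nat \<Rightarrow> nat \<Rightarrow> nat" where
  "distortion 0 n = 2 * n"
| "distortion (Suc k) n = 2 * tau (distortion k) (2 * n)"

theorem distorted_by_distortion: "distorted_by (Suc k) (distortion k)"
proof (induction k)
  case 0
  have "distortion 0 = (\<lambda>n. 2 * n)" by (rule ext) simp
  then show ?case using distorted_by_1 by (simp add: One_nat_def)
next
  case (Suc k)
  have "distortion (Suc k) = (\<lambda>n. 2 * tau (distortion k) (2 * n))" by (rule ext) simp
  then show ?case using distorted_by_Suc[OF _ Suc] by simp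
qed

corollary H_distortion: "nrm (Suc k) n h \<Longrightarrow> h \<in> H (Suc k) \<Longrightarrow> H_norm (Suc k) (distortion k n) h"
  using distorted_by_distortion[of k] unfolding distorted_by_def by (metis add_0_right zm_0)

section \<open>Ackermann functions\<close>

lemma ackermann_1: "ackermann 1 n = 2 * n"
  by (induction n) (simp_all add: One_nat_def)

lemma ackermann_Suc: "1 \<le> k \<Longrightarrow> ackermann (Suc k) (Suc n) = ackermann k (ackermann (Suc k) n)"
  by (cases k) auto

lemma ackermann_double: "1 \<le> k \<Longrightarrow> 2 * n \<le> ackermann k n \<and> strict_mono (ackermann k) \<and> (2 \<le> k \<longrightarrow> 1 \<le> ackermann k n)"
proof (induction k arbitrary: n)
  case (Suc k)
  show ?case
  proof (cases "k = 0")
    case True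
    then show ?thesis using ackermann_1 by (auto simp: strict_mono_def One_nat_def)
  next
    case False
    then have k: "1 \<le> k" by simp
    then obtain i where i: "k = Suc i" by (cases k) auto
    have A0: "ackermann (Suc k) 0 = 1" by (simp add: i)
    have step: "2 * ackermann (Suc k) n \<le> ackermann (Suc k) (Suc n)" for n
      using Suc.IH[OF k] unfolding ackermann_Suc[OF k] by blast
    have pos: "1 \<le> ackermann (Suc k) n" for n
    proof (induction n)
      case (Suc n) then show ?case using step[of n] by simp
    qed (simp add: A0)
    have "2 * n \<le> ackermann (Suc k) n"
    proof (induction n)
      case (Suc n)
      show ?case
      proof (cases n)
        case 0 then show ?thesis using step[of 0] A0 by simp
      next
        case (Suc j) then show ?thesis using step[of n] \<open>2 * n \<le> _\<close> by simp
      qed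
    qed simp
    moreover have "strict_mono (ackermann (Suc k))"
      unfolding strict_mono_Suc_iff
    proof
      fix n show "ackermann (Suc k) n < ackermann (Suc k) (Suc n)" using step[of n] pos[of n] by linarith
    qed
    ultimately show ?thesis using pos by blast
  qed
qed simp

lemma ackermann_mono: "1 \<le> k \<Longrightarrow> m \<le> n \<Longrightarrow> ackermann k m \<le> ackermann k n"
  using ackermann_double[of k] by (simp add: strict_mono_less_eq)

lemma ackermann_pos: "2 \<le> k \<Longrightarrow> 1 \<le> ackermann k n"
  using ackermann_double[of k n] by simp

lemma ackermann_ge: "1 \<le> k \<Longrightarrow> n \<le> ackermann k n"
  using ackermann_double[of k n] by simp

lemma ackermann_Suc': "2 \<le> k \<Longrightarrow> ackermann k (Suc n) = ackermann (k - 1) (ackermann k n)"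
  using ackermann_Suc[of "k - 1" n] by (cases k) simp_all

lemma ackermann_double_Suc: "2 \<le> k \<Longrightarrow> 2 * ackermann k n \<le> ackermann k (Suc n)"
  unfolding ackermann_Suc' using ackermann_double[of "k - 1" "ackermann k n"] by simp

lemma ackermann_power: "2 \<le> k \<Longrightarrow> 2 ^ m * ackermann k n \<le> ackermann k (n + m)"
proof (induction m)
  case (Suc m)
  have "2 ^ Suc m * ackermann k n \<le> 2 * ackermann k (n + m)" using Suc by simp
  also have "\<dots> \<le> ackermann k (n + Suc m)" using ackermann_double_Suc[OF Suc.prems, of "n + m"] by simp
  finally show ?case .
qed simp

lemma ackermann_scale: "2 \<le> k \<Longrightarrow> c * ackermann k n \<le> ackermann k (n + c)"
proof -
  assume k: "2 \<le> k"
  have "c * ackermann k n \<le> 2 ^ c * ackermann k n" by (intro mult_right_mono) (simp_all add: less_imp_le)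
  also have "\<dots> \<le> ackermann k (n + c)" by (rule ackermann_power[OF k])
  finally show ?thesis .
qed

text \<open>For \<open>k\<close> at least 2, raising the argument by \<open>c - 1\<close> multiplies
  the value by at least 2^(c-1), and \<open>u + (c - 1)\<close> is at most \<open>c * u\<close>
  because \<open>u\<close> is positive.\<close>

lemma ackermann_mult_arg:
  assumes "1 \<le> k" "1 \<le> c" "1 \<le> u"
  shows "c * ackermann k u \<le> ackermann k (c * u)"
proof (cases "k = 1")
  case True then show ?thesis by (simp add: ackermann_1)
next
  case False
  then have k: "2 \<le> k" using assms(1) by simp
  obtain d where d: "c = Suc d" using assms(2) by (cases c) auto
  have "Suc d * ackermann k u \<le> 2 ^ d * ackermann k u"
    by (intro mult_right_mono) (simp_all add: Suc_leI less_exp)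
  also have "\<dots> \<le> ackermann k (u + d)" by (rule ackermann_power[OF k])
  also have "\<dots> \<le> ackermann k (c * u)"
  proof (rule ackermann_mono[OF assms(1)])
    have "d * 1 \<le> d * u" using assms(3) by (intro mult_left_mono) simp_all
    then show "u + d \<le> c * u" by (simp add: d)
  qed
  finally show ?thesis by (simp add: d)
qed

text \<open>In the induction on \<open>n\<close>, the factor \<open>ackermann k m\<close> is moved
  inside \<open>ackermann (k - 1)\<close>. This is what absorbs polynomial factors into a linear
  change of argument.\<close>

lemma ackermann_mult: "2 \<le> k \<Longrightarrow> ackermann k m * ackermann k n \<le> ackermann k (m + n)"
proof (induction n)
  case 0
  then obtain i where "k = Suc (Suc i)" by (metis Suc_1 Suc_le_D add_2_eq_Suc le_Suc_ex)
  then show ?case by simp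
next
  case (Suc n)
  have "ackermann k m * ackermann k (Suc n) = ackermann k m * ackermann (k - 1) (ackermann k n)"
    by (simp only: ackermann_Suc'[OF Suc.prems])
  also have "\<dots> \<le> ackermann (k - 1) (ackermann k m * ackermann k n)"
    using Suc.prems ackermann_pos[OF Suc.prems] by (intro ackermann_mult_arg) auto
  also have "\<dots> \<le> ackermann (k - 1) (ackermann k (m + n))"
    using Suc by (intro ackermann_mono) auto
  also have "\<dots> = ackermann k (m + Suc n)" using ackermann_Suc'[OF Suc.prems, of "m + n"] by simp
  finally show ?case .
qed

lemma ackermann_pow: "2 \<le> k \<Longrightarrow> ackermann k n ^ d \<le> ackermann k (d * n)"
proof (induction d)
  case 0 then show ?case using ackermann_pos[of k 0] by simp
next
  case (Suc d)
  have "ackermann k n ^ Suc d \<le> ackermann k n * ackermann k (d * n)" using Suc by simp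
  also have "\<dots> \<le> ackermann k (Suc d * n)" using ackermann_mult[OF Suc.prems, of n "d * n"] by simp
  finally show ?case .
qed

text \<open>The successor of \<open>hydra_steps\<close> obeys Ackermann's recursion with an
  additional 1 at each step.\<close>

lemma hydra_steps_ge_ackermann: "1 \<le> k \<Longrightarrow> ackermann k n \<le> Suc (hydra_steps k n)"
proof (induction k arbitrary: n)
  case (Suc k)
  show ?case
  proof (cases "k = 0")
    case True
    have "hydra_steps 1 n = 2 * n" by (induction n) (simp_all add: One_nat_def)
    then show ?thesis using True ackermann_1[of n] by (simp add: One_nat_def)
  next
    case False
    then have k: "1 \<le> k" by simp
    show ?thesis
    proof (induction n)
      case 0
      then show ?case using k by (cases k) simp_all
    next
      case IH: (Suc n)
      have "ackermann (Suc k) (Suc n) = ackermann k (ackermann (Suc k) n)" by (rule ackermann_Suc[OF k])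
      also have "\<dots> \<le> ackermann k (Suc (hydra_steps (Suc k) n))" by (rule ackermann_mono[OF k IH])
      also have "\<dots> \<le> Suc (hydra_steps k (Suc (hydra_steps (Suc k) n)))" by (rule Suc.IH[OF k])
      finally show ?case by simp
    qed
  qed
qed simp

text \<open>By the recursion of Ackermann's functions, applying \<open>distortion k\<close> to a
  value of \<open>?A\<close> shifts the argument of \<open>?A\<close> by a constant. The iteration
  in \<open>tau\<close> therefore shifts it by an amount linear in \<open>n\<close>.\<close>

lemma distortion_ackermann: "\<exists>c. \<forall>n. distortion k n \<le> ackermann (Suc k) (c * n + c)"
proof (induction k)
  case 0
  show ?case by (rule exI[of _ 1]) (simp add: ackermann_1 flip: One_nat_def)
next
  case (Suc k)
  then obtain c where c: "\<And>n. distortion k n \<le> ackermann (Suc k) (c * n + c)" by blast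
  let ?A = "ackermann (Suc (Suc k))"
  have K: "2 \<le> Suc (Suc k)" "1 \<le> Suc (Suc k)" "1 \<le> Suc k" by simp_all
  have f: "distortion k r \<le> ?A (z + Suc (2 * c))" if "r \<le> ?A z" for r z
  proof -
    have "c * r + c \<le> c * ?A z + c * ?A z"
      using that ackermann_pos[OF K(1), of z] by (intro add_mono mult_le_mono) (auto simp: Suc_leI)
    also have "\<dots> \<le> ?A (z + 2 * c)" using ackermann_scale[OF K(1), of "2 * c" z] by simp
    finally have "ackermann (Suc k) (c * r + c) \<le> ?A (Suc (z + 2 * c))"
      unfolding ackermann_Suc[OF K(3)] by (rule ackermann_mono[OF K(3)])
    then show ?thesis using c[of r] by simp
  qed
  have F: "((\<lambda>r. distortion k r + 2 * n) ^^ i) (2 * n) \<le> ?A (2 * n + i * (2 * c + 2))" for n i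
  proof (induction i)
    case 0
    then show ?case using ackermann_ge[OF K(2), of "2 * n"] by simp
  next
    case (Suc i)
    define z where "z = 2 * n + i * (2 * c + 2)"
    have "distortion k (((\<lambda>r. distortion k r + 2 * n) ^^ i) (2 * n)) \<le> ?A (z + Suc (2 * c))"
      using Suc unfolding z_def by (rule f)
    moreover have "2 * n \<le> ?A (z + Suc (2 * c))"
      using ackermann_ge[OF K(2), of "z + Suc (2 * c)"] by (simp add: z_def)
    ultimately have "((\<lambda>r. distortion k r + 2 * n) ^^ Suc i) (2 * n) \<le> 2 * ?A (z + Suc (2 * c))" by simp
    also have "\<dots> \<le> ?A (Suc (z + Suc (2 * c)))" by (rule ackermann_double_Suc[OF K(1)])
    also have "Suc (z + Suc (2 * c)) = 2 * n + Suc i * (2 * c + 2)" by (simp add: z_def)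
    finally show ?case .
  qed
  have tau: "tau (distortion k) n \<le> ?A ((2 * c + 7) * n + (2 * c + 7))" for n
  proof -
    define z where "z = 2 * n + n * (2 * c + 2) + Suc (2 * c)"
    have "distortion k (((\<lambda>r. distortion k r + 2 * n) ^^ n) (2 * n)) \<le> ?A z"
      unfolding z_def by (rule f[OF F])
    then have "tau (distortion k) n \<le> Suc n * (?A z + ?A z)"
      unfolding tau_def using ackermann_pos[OF K(1), of z] by (intro mult_le_mono add_mono) simp_all
    also have "\<dots> = (2 * n + 2) * ?A z" by (simp add: algebra_simps)
    also have "\<dots> \<le> ?A (z + (2 * n + 2))" by (rule ackermann_scale[OF K(1)])
    also have "\<dots> \<le> ?A ((2 * c + 7) * n + (2 * c + 7))"
      by (rule ackermann_mono[OF K(2)]) (simp add: z_def algebra_simps)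
    finally show ?thesis .
  qed
  have "distortion (Suc k) n \<le> ?A ((4 * c + 16) * n + (4 * c + 16))" for n
  proof -
    have "distortion (Suc k) n \<le> 2 * ?A ((2 * c + 7) * (2 * n) + (2 * c + 7))" using tau[of "2 * n"] by simp
    also have "\<dots> \<le> ?A (Suc ((2 * c + 7) * (2 * n) + (2 * c + 7)))" by (rule ackermann_double_Suc[OF K(1)])
    also have "\<dots> \<le> ?A ((4 * c + 16) * n + (4 * c + 16))"
      by (rule ackermann_mono[OF K(2)]) (simp add: algebra_simps)
    finally show ?thesis .
  qed
  then show ?case by blast
qed

section \<open>Area\<close>

text \<open>A relative form of \<open>fills\<close>: costs can be added along a chain of
  rewritings.\<close>

definition area_eq :: "'a set \<Rightarrow> 'a word set \<Rightarrow> nat \<Rightarrow> 'a word \<Rightarrow> 'a word \<Rightarrow> bool" where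
  "area_eq A R N u v \<longleftrightarrow> (\<exists>cs. length cs \<le> N \<and> set cs \<subseteq> words A \<times> (R \<union> inv_word ` R) \<and>
     freely_equal A u (conj_product cs @ v))"

lemma fills_iff_area_eq: "fills A R N w \<longleftrightarrow> area_eq A R N w []"
  by (simp add: fills_def area_eq_def)

lemma conj_product_simps [simp]:
  "conj_product [] = []" "conj_product ((u, r) # cs) = inv_word u @ r @ u @ conj_product cs"
  "conj_product (cs @ ds) = conj_product cs @ conj_product ds"
  by (simp_all add: conj_product_def)

lemma one_le_Suc [simp]: "1 \<le> Suc n"
  by (simp add: One_nat_def)

lemma foldr_push_inv_left: "reduced w \<Longrightarrow> foldr push (inv_word u) (foldr push u w) = w"
  using foldr_push_freely_equal[OF free_inv_left[OF words_UNIV], of w u] by simp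

lemma foldr_push_inv_right: "reduced w \<Longrightarrow> foldr push u (foldr push (inv_word u) w) = w"
  using foldr_push_inv_left[of w "inv_word u"] by simp

text \<open>Together with \<open>free_simps\<close> this proves identities in free groups by
  simplifying the action on reduced words.\<close>

lemma freely_equalI:
  "u \<in> words A \<Longrightarrow> v \<in> words A \<Longrightarrow> foldr push u [] = foldr push v [] \<Longrightarrow> freely_equal A u v"
  by (simp add: freely_equal_iff_reduce reduce_def)

lemma push_inverse:
  "reduced w \<Longrightarrow> push (y, True) (push (y, False) w) = w" "reduced w \<Longrightarrow> push (y, False) (push (y, True) w) = w"
  using push_push_inverse[of w y True] push_push_inverse[of w y False] by simp_all

lemmas free_simps = foldr_push_inv_left foldr_push_inv_right reduced_foldr_push push_inverse reduced_push

lemma area_eq_words: "area_eq A R N u v \<Longrightarrow> u \<in> words A \<and> v \<in> words A"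
  unfolding area_eq_def by (auto dest: free_word_eq_words)

lemma area_eq_free: "freely_equal A u v \<Longrightarrow> area_eq A R N u v"
  unfolding area_eq_def by (rule exI[of _ "[]"]) simp

lemma area_eq_mono: "area_eq A R N u v \<Longrightarrow> N \<le> M \<Longrightarrow> area_eq A R M u v"
  unfolding area_eq_def by (meson order_trans)

lemma area_eq_trans:
  assumes "area_eq A R M u v" "area_eq A R N v w"
  shows "area_eq A R (M + N) u w"
proof -
  obtain cs ds where cs: "length cs \<le> M" "set cs \<subseteq> words A \<times> (R \<union> inv_word ` R)" "freely_equal A u (conj_product cs @ v)"
    and ds: "length ds \<le> N" "set ds \<subseteq> words A \<times> (R \<union> inv_word ` R)" "freely_equal A v (conj_product ds @ w)"
    using assms unfolding area_eq_def by blast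
  have "conj_product cs \<in> words A" using free_word_eq_words[OF cs(3)] by simp
  then have "freely_equal A (conj_product cs @ v) (conj_product cs @ conj_product ds @ w)"
    by (intro word_eq.append ds word_eq.refl)
  with cs(3) have "freely_equal A u (conj_product (cs @ ds) @ w)" by (auto intro: word_eq.trans)
  with cs ds show ?thesis unfolding area_eq_def by (intro exI[of _ "cs @ ds"]) simp
qed

lemma area_eq_free_trans:
  "freely_equal A u u' \<Longrightarrow> area_eq A R N u' v' \<Longrightarrow> freely_equal A v' v \<Longrightarrow> area_eq A R N u v"
  using area_eq_trans[OF area_eq_free[of A u u' R 0] area_eq_trans[OF _ area_eq_free[of A v' v R 0]]] by simp

lemma area_eq_relator: "r \<in> R \<union> inv_word ` R \<Longrightarrow> r \<in> words A \<Longrightarrow> area_eq A R 1 r []"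
  unfolding area_eq_def by (rule exI[of _ "[([], r)]"]) (simp add: word_eq.refl)

lemma area_eq_sym:
  assumes "area_eq A R N u v"
  shows "area_eq A R N v u"
proof -
  obtain cs where cs: "length cs \<le> N" "set cs \<subseteq> words A \<times> (R \<union> inv_word ` R)" "freely_equal A u (conj_product cs @ v)"
    using assms unfolding area_eq_def by blast
  define ds where "ds = rev (map (\<lambda>(u, r). (u, inv_word r)) cs)"
  have ds: "conj_product ds = inv_word (conj_product cs)"
    unfolding ds_def by (induction cs) auto
  have "set ds \<subseteq> words A \<times> (R \<union> inv_word ` R)" "length ds \<le> N"
    using cs(1,2) by (force simp: ds_def)+
  moreover have "freely_equal A v (conj_product ds @ u)"
  proof -
    have w: "conj_product cs \<in> words A" "v \<in> words A" "u \<in> words A"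
      using free_word_eq_words[OF cs(3)] by simp_all
    have "freely_equal A v (conj_product ds @ (conj_product cs @ v))"
      using w by (intro freely_equalI) (simp_all add: ds free_simps)
    moreover have "freely_equal A (conj_product ds @ (conj_product cs @ v)) (conj_product ds @ u)"
      using w by (intro word_eq.append word_eq.refl word_eq.sym[OF cs(3)]) (simp add: ds)
    ultimately show ?thesis by (rule word_eq.trans)
  qed
  ultimately show ?thesis unfolding area_eq_def by blast
qed

text \<open>Moving \<open>u'\<close> past the conjugates used for \<open>v\<close> changes only the
  conjugating words, so their number is preserved.\<close>

lemma area_eq_append:
  assumes "area_eq A R M u u'" "area_eq A R N v v'"
  shows "area_eq A R (M + N) (u @ v) (u' @ v')"
proof -
  obtain cs where cs: "length cs \<le> M" "set cs \<subseteq> words A \<times> (R \<union> inv_word ` R)" "freely_equal A u (conj_product cs @ u')"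
    using assms(1) unfolding area_eq_def by blast
  obtain ds where ds: "length ds \<le> N" "set ds \<subseteq> words A \<times> (R \<union> inv_word ` R)" "freely_equal A v (conj_product ds @ v')"
    using assms(2) unfolding area_eq_def by blast
  have w: "conj_product cs \<in> words A" "u' \<in> words A" "conj_product ds \<in> words A" "v' \<in> words A"
    using free_word_eq_words[OF cs(3)] free_word_eq_words[OF ds(3)] by simp_all
  define es where "es = map (\<lambda>(x, r). (x @ inv_word u', r)) ds"
  have es: "set es \<subseteq> words A \<times> (R \<union> inv_word ` R)" "length es \<le> N"
    using ds(1,2) w by (auto simp: es_def)
  have push: "foldr push (conj_product es) z = foldr push (u' @ conj_product ds @ inv_word u') z" if "reduced z" for z
    unfolding es_def using that by (induction ds) (auto simp: free_simps)
  have es_words: "conj_product es \<in> words A"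
    using w(2,3) unfolding es_def by (induction ds) auto
  have "freely_equal A (u @ v) ((conj_product cs @ u') @ (conj_product ds @ v'))"
    by (rule word_eq.append[OF cs(3) ds(3)])
  moreover have "freely_equal A ((conj_product cs @ u') @ (conj_product ds @ v')) (conj_product (cs @ es) @ u' @ v')"
    using w es_words by (intro freely_equalI) (simp_all add: push free_simps)
  ultimately have "freely_equal A (u @ v) (conj_product (cs @ es) @ u' @ v')" by (rule word_eq.trans)
  with cs es show ?thesis unfolding area_eq_def by (intro exI[of _ "cs @ es"]) simp
qed

lemma area_eq_context:
  assumes "area_eq A R N u v" "p \<in> words A" "s \<in> words A"
  shows "area_eq A R N (p @ u @ s) (p @ v @ s)"
proof -
  have "area_eq A R (0 + (N + 0)) (p @ u @ s) (p @ v @ s)"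
    by (intro area_eq_append assms(1) area_eq_free word_eq.refl assms(2,3))
  then show ?thesis by simp
qed

lemma area_eq_inv:
  assumes "area_eq A R N u v"
  shows "area_eq A R N (inv_word u) (inv_word v)"
proof -
  have w: "u \<in> words A" "v \<in> words A" using area_eq_words[OF assms] by auto
  have "area_eq A R N (inv_word u @ v @ inv_word v) (inv_word u @ u @ inv_word v)"
    using w by (intro area_eq_context area_eq_sym[OF assms]) simp_all
  then show ?thesis
    by (rule area_eq_free_trans[rotated]) (use w in \<open>auto intro!: freely_equalI simp: free_simps\<close>)
qed

lemma area_eq_word_eq: "area_eq A R N u v \<Longrightarrow> R \<subseteq> words A \<Longrightarrow> word_eq A R u v"
proof -
  assume R: "R \<subseteq> words A" and "area_eq A R N u v"
  then obtain cs where cs: "set cs \<subseteq> words A \<times> (R \<union> inv_word ` R)" "freely_equal A u (conj_product cs @ v)"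
    unfolding area_eq_def by blast
  have free: "word_eq A R u v" if "freely_equal A u v" for u v
    using that by (induction rule: word_eq.induct) (auto intro: word_eq.intros)
  have inv: "word_eq A R (inv_word r) []" if "r \<in> R" for r
  proof -
    have r: "r \<in> words A" using that R by blast
    have "word_eq A R (inv_word r @ r) (inv_word r @ [])"
      by (intro word_eq.append word_eq.refl word_eq.relator that) (simp add: r)
    then show ?thesis using word_eq_inv_left[OF R r] by (auto intro: word_eq.sym word_eq.trans)
  qed
  have "word_eq A R (conj_product cs) []"
    using cs(1)
  proof (induction cs)
    case (Cons c cs)
    obtain x r where c: "c = (x, r)" by force
    have x: "x \<in> words A" and r: "word_eq A R r []" using Cons.prems c inv by (auto intro: word_eq.relator)
    have "word_eq A R (inv_word x @ r @ x) (inv_word x @ [] @ x)"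
      by (intro word_eq.append word_eq.refl r) (simp_all add: x)
    then have "word_eq A R (inv_word x @ r @ x) []"
      using word_eq_inv_left[OF R x] by (auto intro: word_eq.trans)
    then have "word_eq A R ((inv_word x @ r @ x) @ conj_product cs) ([] @ [])"
      using Cons by (intro word_eq.append) auto
    then show ?case by (simp add: c)
  qed (simp add: word_eq.refl)
  then have "word_eq A R (conj_product cs @ v) ([] @ v)"
    using free_word_eq_words[OF cs(2)] by (intro word_eq.append word_eq.refl) simp_all
  then show ?thesis using free[OF cs(2)] by (auto intro: word_eq.trans)
qed

section \<open>Polynomial area for words without \<open>Gen_p\<close>\<close>

abbreviation h_area :: "nat \<Rightarrow> nat \<Rightarrow> hydra_gen word \<Rightarrow> hydra_gen word \<Rightarrow> bool" where
  "h_area k \<equiv> area_eq (hydra_gens k) (hydra_relators k)"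

definition of_ga :: "nat word \<Rightarrow> hydra_gen word" where
  "of_ga w = map (\<lambda>(i, b). (Gen_a i, b)) w"

lemma of_ga_simps [simp]: "of_ga [] = []" "of_ga ((i, b) # w) = (Gen_a i, b) # of_ga w" "of_ga (u @ v) = of_ga u @ of_ga v"
  "of_ga (inv_word w) = inv_word (of_ga w)"
  by (simp_all add: of_ga_def inv_word_def rev_map case_prod_unfold)

lemma of_ga_words: "w \<in> words {1..k} \<Longrightarrow> of_ga w \<in> words (hydra_gens k)"
  by (induction w) (auto simp: hydra_gens_def)

lemma of_ga_freely_equal:
  "freely_equal {1..k} u v \<Longrightarrow> freely_equal (hydra_gens k) (of_ga u) (of_ga v)"
proof (induction rule: word_eq.induct)
  case (cancel i b)
  then show ?case by (auto simp: hydra_gens_def intro!: word_eq.cancel)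
next
  case (refl w) then show ?case by (auto intro: word_eq.refl of_ga_words)
next
  case (append u u' v v') then show ?case by (auto intro: word_eq.append)
qed (auto intro: word_eq.sym word_eq.trans)

text \<open>The letter a_i, or the empty word for \<open>i = 0\<close>, so that the relation for a_1
  has the shape of the others.\<close>

definition aw :: "nat \<Rightarrow> hydra_gen word" where
  "aw i = of_ga (theta_pos 0 i)"

lemma aw_words: "i \<le> k \<Longrightarrow> aw i \<in> words (hydra_gens k)"
  unfolding aw_def using theta_pos_words[of 0 i] by (intro of_ga_words) (auto elim: words_mono)

lemma Gen_t_in [simp]: "Gen_t \<in> hydra_gens k" and Gen_p_in [simp]: "Gen_p \<in> hydra_gens k"
  and Gen_a_in [simp]: "Gen_a i \<in> hydra_gens k \<longleftrightarrow> 1 \<le> i \<and> i \<le> k"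
  by (auto simp: hydra_gens_def)

lemma h_area_t_a:
  assumes "1 \<le> i" "i \<le> k"
  shows "h_area k 1 ([(Gen_t, False), (Gen_a i, True), (Gen_t, True)]) (aw i @ aw (i - 1))"
proof -
  let ?A = "hydra_gens k" and ?l = "[(Gen_t, False), (Gen_a i, True), (Gen_t, True)]"
  have "?l @ inv_word (aw i @ aw (i - 1)) \<in> hydra_relators k"
  proof (cases "i = 1")
    case True
    then show ?thesis by (simp add: hydra_relators_def aw_def One_nat_def)
  next
    case False
    then obtain j where "i = Suc (Suc j)" using assms(1) by (cases i; cases "i - 1") (auto simp: One_nat_def)
    then show ?thesis using assms by (auto simp: hydra_relators_def aw_def)
  qed
  then have "h_area k 1 (?l @ inv_word (aw i @ aw (i - 1))) []"
    using hydra_relators_words[of k] assms by (intro area_eq_relator) auto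
  from area_eq_append[OF this area_eq_free[OF word_eq.refl[of "aw i @ aw (i - 1)" ?A], of _ 0]]
  have "h_area k 1 ((?l @ inv_word (aw i @ aw (i - 1))) @ (aw i @ aw (i - 1))) (aw i @ aw (i - 1))"
    using assms by (simp add: aw_words)
  then show ?thesis
    by (rule area_eq_free_trans[rotated])
      (use assms in \<open>auto intro!: freely_equalI simp: free_simps aw_words\<close>)
qed

definition tpow :: "nat \<Rightarrow> hydra_gen word" where
  "tpow m = replicate m (Gen_t, True)"

lemma tpow_Suc: "tpow (Suc m) = (Gen_t, True) # tpow m" "tpow (Suc m) = tpow m @ [(Gen_t, True)]"
  by (simp_all add: tpow_def replicate_append_same)

lemma tpow_words [simp]: "tpow m \<in> words (hydra_gens k)"
  by (induction m) (simp_all add: tpow_def)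

lemma tpow_0 [simp]: "tpow 0 = []"
  by (simp add: tpow_def)

text \<open>One relator splits the conjugate of a_(i+1) into two that are conjugated one time less.
  The bound is preserved since (m+1)^(i+1) + (m+1)^i is at most (m+2)^(i+1).\<close>

lemma h_area_theta_pos:
  "i \<le> k \<Longrightarrow> h_area k (Suc m ^ i - 1) (inv_word (tpow m) @ aw i @ tpow m) (of_ga (theta_pos m i))"
proof (induction m i rule: theta_pos.induct)
  case (1 m)
  have "freely_equal (hydra_gens k) (inv_word (tpow m) @ [] @ tpow m) []"
    by (intro freely_equalI) (simp_all add: free_simps)
  then show ?case by (simp add: aw_def area_eq_free)
next
  case (2 i)
  then have "aw (Suc i) \<in> words (hydra_gens k)" by (rule aw_words)
  from area_eq_free[OF word_eq.refl[OF this]] show ?case by (simp add: aw_def)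
next
  case (3 m i)
  let ?t = "tpow m" and ?A = "hydra_gens k"
  have w: "aw (Suc i) \<in> words ?A" "aw i \<in> words ?A" using 3(3) by (auto intro: aw_words)
  have "h_area k 1 (inv_word ?t @ [(Gen_t, False), (Gen_a (Suc i), True), (Gen_t, True)] @ ?t)
      (inv_word ?t @ (aw (Suc i) @ aw i) @ ?t)"
    using h_area_t_a[of "Suc i" k] 3(3) by (intro area_eq_context) simp_all
  moreover have "inv_word ?t @ [(Gen_t, False), (Gen_a (Suc i), True), (Gen_t, True)] @ ?t =
      inv_word (tpow (Suc m)) @ aw (Suc i) @ tpow (Suc m)"
    by (simp add: tpow_Suc(1) aw_def)
  moreover have "freely_equal ?A (inv_word ?t @ (aw (Suc i) @ aw i) @ ?t)
      ((inv_word ?t @ aw (Suc i) @ ?t) @ (inv_word ?t @ aw i @ ?t))"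
    using w by (intro freely_equalI) (simp_all add: free_simps)
  ultimately have "h_area k 1 (inv_word (tpow (Suc m)) @ aw (Suc i) @ tpow (Suc m))
      ((inv_word ?t @ aw (Suc i) @ ?t) @ (inv_word ?t @ aw i @ ?t))"
    using area_eq_trans[OF _ area_eq_free[of _ _ _ _ 0]] by fastforce
  moreover have "h_area k ((Suc m ^ Suc i - 1) + (Suc m ^ i - 1))
      ((inv_word ?t @ aw (Suc i) @ ?t) @ (inv_word ?t @ aw i @ ?t)) (of_ga (theta_pos m (Suc i)) @ of_ga (theta_pos m i))"
    using 3 by (intro area_eq_append) simp_all
  ultimately have "h_area k (1 + ((Suc m ^ Suc i - 1) + (Suc m ^ i - 1)))
      (inv_word (tpow (Suc m)) @ aw (Suc i) @ tpow (Suc m)) (of_ga (theta_pos m (Suc i)) @ of_ga (theta_pos m i))"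
    by (rule area_eq_trans)
  moreover have "1 + ((Suc m ^ Suc i - 1) + (Suc m ^ i - 1)) \<le> Suc (Suc m) ^ Suc i - 1"
  proof -
    have "Suc m ^ Suc i + Suc m ^ i = Suc (Suc m) * Suc m ^ i" by simp
    also have "\<dots> \<le> Suc (Suc m) * Suc (Suc m) ^ i" by (intro mult_le_mono power_mono) simp_all
    finally have "Suc m ^ Suc i + Suc m ^ i \<le> Suc (Suc m) ^ Suc i" by simp
    moreover have "1 \<le> Suc m ^ i" "1 \<le> Suc m ^ Suc i" by (rule one_le_power, simp)+
    ultimately show ?thesis by linarith
  qed
  ultimately show ?case by (auto elim: area_eq_mono)
qed

text \<open>The relation is solved for t a_(i+1) t^-1: inserting \<open>c\<close> and its inverse
  makes the relator applicable in reverse and leaves an inverse conjugate of lower index.\<close>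

lemma h_area_theta_neg:
  "i \<le> k \<Longrightarrow> h_area k (Suc m ^ i - 1) (tpow m @ aw i @ inv_word (tpow m)) (of_ga (theta_neg m i))"
proof (induction m i rule: theta_neg.induct)
  case (1 m)
  have "freely_equal (hydra_gens k) (tpow m @ [] @ inv_word (tpow m)) []"
    by (intro freely_equalI) (simp_all add: free_simps)
  then show ?case by (simp add: aw_def area_eq_free)
next
  case (2 i)
  then have "aw (Suc i) \<in> words (hydra_gens k)" by (rule aw_words)
  from area_eq_free[OF word_eq.refl[OF this]] show ?case by (simp add: aw_def)
next
  case (3 m i)
  let ?t = "tpow (Suc m)" and ?A = "hydra_gens k"
  have w: "aw (Suc i) \<in> words ?A" "aw i \<in> words ?A" using 3(3) by (auto intro: aw_words)
  define c where "c = ?t @ aw i @ inv_word ?t"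
  have c: "c \<in> words ?A" using w by (simp add: c_def)
  have A: "h_area k 1 (?t @ (aw (Suc i) @ aw i) @ inv_word ?t @ inv_word c)
     (?t @ [(Gen_t, False), (Gen_a (Suc i), True), (Gen_t, True)] @ inv_word ?t @ inv_word c)"
    by (rule area_eq_context[OF area_eq_sym[OF h_area_t_a[of "Suc i" k, simplified]]]) (use 3(3) c in simp_all)
  have B: "freely_equal ?A (?t @ aw (Suc i) @ inv_word ?t) (?t @ (aw (Suc i) @ aw i) @ inv_word ?t @ inv_word c)"
    using w c by (intro freely_equalI) (simp_all add: free_simps c_def)
  have C: "freely_equal ?A (?t @ [(Gen_t, False), (Gen_a (Suc i), True), (Gen_t, True)] @ inv_word ?t @ inv_word c)
     ((tpow m @ aw (Suc i) @ inv_word (tpow m)) @ inv_word c)"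
    using w c unfolding tpow_Suc(2) by (intro freely_equalI) (simp_all add: free_simps aw_def)
  have "h_area k 1 (?t @ aw (Suc i) @ inv_word ?t) ((tpow m @ aw (Suc i) @ inv_word (tpow m)) @ inv_word c)"
    by (rule area_eq_free_trans[OF B A C])
  moreover have "h_area k ((Suc m ^ Suc i - 1) + (Suc (Suc m) ^ i - 1)) ((tpow m @ aw (Suc i) @ inv_word (tpow m)) @ inv_word c)
     (of_ga (theta_neg m (Suc i)) @ inv_word (of_ga (theta_neg (Suc m) i)))"
    unfolding c_def using 3 by (intro area_eq_append area_eq_inv) simp_all
  ultimately have "h_area k (1 + ((Suc m ^ Suc i - 1) + (Suc (Suc m) ^ i - 1))) (?t @ aw (Suc i) @ inv_word ?t)
     (of_ga (theta_neg m (Suc i)) @ inv_word (of_ga (theta_neg (Suc m) i)))"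
    by (rule area_eq_trans)
  moreover have "1 + ((Suc m ^ Suc i - 1) + (Suc (Suc m) ^ i - 1)) \<le> Suc (Suc m) ^ Suc i - 1"
  proof -
    have "Suc m ^ Suc i \<le> Suc m * Suc (Suc m) ^ i" unfolding power_Suc by (intro mult_le_mono power_mono) simp_all
    then have "Suc m ^ Suc i + Suc (Suc m) ^ i \<le> Suc (Suc m) ^ Suc i" by simp
    moreover have "1 \<le> Suc (Suc m) ^ i" "1 \<le> Suc m ^ Suc i" by (rule one_le_power, simp)+
    ultimately show ?thesis by linarith
  qed
  ultimately show ?case by (auto elim: area_eq_mono)
qed

definition t_pow :: "int \<Rightarrow> hydra_gen word" where
  "t_pow e = (if e \<le> 0 then inv_word (tpow (nat (- e))) else tpow (nat e))"

lemma t_pow_words [simp]: "t_pow e \<in> words (hydra_gens k)"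
  by (simp add: t_pow_def)

lemma t_pow_0 [simp]: "t_pow 0 = []"
  by (simp add: t_pow_def)

lemma h_area_Th:
  assumes "i \<le> k"
  shows "h_area k (Suc (nat \<bar>e\<bar>) ^ k) (t_pow e @ aw i @ inv_word (t_pow e)) (of_ga (Th e i))"
proof -
  have "h_area k (Suc (nat \<bar>e\<bar>) ^ i - 1) (t_pow e @ aw i @ inv_word (t_pow e)) (of_ga (Th e i))"
    using h_area_theta_pos[OF assms, of "nat (- e)"] h_area_theta_neg[OF assms, of "nat e"]
    by (simp add: t_pow_def Th_def)
  moreover have "Suc (nat \<bar>e\<bar>) ^ i \<le> Suc (nat \<bar>e\<bar>) ^ k" using assms by (intro power_increasing) simp_all
  ultimately show ?thesis by (auto elim: area_eq_mono)
qed

lemma t_pow_Suc: "freely_equal (hydra_gens k) (t_pow e @ [(Gen_t, True)]) (t_pow (e + 1))"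
proof (cases "e < 0")
  case True
  then obtain m where "nat (- e) = Suc m" "nat (- (e + 1)) = m" "e \<le> 0" "e + 1 \<le> 0"
    by (cases "nat (- e)") auto
  then show ?thesis unfolding t_pow_def by (intro freely_equalI) (simp_all add: tpow_Suc(1) free_simps )
next
  case False
  then have e: "nat (e + 1) = Suc (nat e)" by simp
  show ?thesis
  proof (cases "e = 0")
    case True then show ?thesis by (simp add: t_pow_def tpow_def word_eq.refl One_nat_def)
  next
    case False
    then show ?thesis using \<open>\<not> e < 0\<close> e by (simp add: t_pow_def tpow_Suc(2) word_eq.refl)
  qed
qed

lemma t_pow_diff1: "freely_equal (hydra_gens k) (t_pow e @ [(Gen_t, False)]) (t_pow (e - 1))"
proof -
  have "freely_equal (hydra_gens k) ((t_pow (e - 1) @ [(Gen_t, True)]) @ [(Gen_t, False)]) (t_pow (e - 1 + 1) @ [(Gen_t, False)])"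
    by (intro word_eq.append word_eq.refl t_pow_Suc) simp
  moreover have "freely_equal (hydra_gens k) (t_pow (e - 1) @ [(Gen_t, True)] @ [(Gen_t, False)]) (t_pow (e - 1) @ [])"
    using word_eq.cancel[of Gen_t "hydra_gens k" "{}" True] by (intro word_eq.append word_eq.refl) simp_all
  ultimately show ?thesis by (auto intro: word_eq.sym word_eq.trans)
qed

fun to_gx :: "hydra_gen word \<Rightarrow> nat word" where
  "to_gx [] = []"
| "to_gx ((Gen_a i, True) # w) = (i, True) # (0, False) # to_gx w"
| "to_gx ((Gen_a i, False) # w) = (0, True) # (i, False) # to_gx w"
| "to_gx ((Gen_t, b) # w) = (0, b) # to_gx w"
| "to_gx ((Gen_p, b) # w) = to_gx w"

text \<open>\<open>M\<close> bounds the exponent of t throughout, so each letter a_i passes it at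
  cost at most (M+1)^k.\<close>

lemma h_area_phi:
  assumes "w \<in> words (hydra_gens k - {Gen_p})" "nat \<bar>e\<bar> + length w \<le> M"
  shows "h_area k (length w * Suc M ^ k) (t_pow e @ w) (of_ga (phi e (to_gx w)) @ t_pow (e + expo (to_gx w)))"
  using assms
proof (induction w arbitrary: e rule: to_gx.induct)
  case 1
  then show ?case by (simp add: area_eq_free word_eq.refl)
next
  case (2 i w)
  let ?A = "hydra_gens k"
  have i: "1 \<le> i" "i \<le> k" and w: "w \<in> words ?A" using 2(2) by (auto elim: words_mono)
  have ai: "aw i = [(Gen_a i, True)]" using i by (cases i) (simp_all add: aw_def)
  have "Suc (nat \<bar>e\<bar>) ^ k \<le> Suc M ^ k" using 2(3) by (intro power_mono) simp_all
  then have "h_area k (Suc M ^ k) (t_pow e @ aw i @ inv_word (t_pow e)) (of_ga (Th e i))"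
    by (rule area_eq_mono[OF h_area_Th[OF i(2)]])
  moreover have "h_area k (length w * Suc M ^ k) (t_pow e @ w) (of_ga (phi e (to_gx w)) @ t_pow (e + expo (to_gx w)))"
    using 2 by (intro 2(1)) auto
  ultimately have "h_area k (Suc M ^ k + length w * Suc M ^ k) ((t_pow e @ aw i @ inv_word (t_pow e)) @ (t_pow e @ w))
      (of_ga (Th e i) @ of_ga (phi e (to_gx w)) @ t_pow (e + expo (to_gx w)))"
    by (rule area_eq_append)
  moreover have "freely_equal ?A (t_pow e @ aw i @ w) ((t_pow e @ aw i @ inv_word (t_pow e)) @ (t_pow e @ w))"
    using w aw_words[OF i(2)] by (intro freely_equalI) (simp_all add: free_simps)
  ultimately show ?case
    by (simp add: ai) (metis area_eq_free_trans area_eq_words word_eq.refl)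
next
  case (3 i w)
  let ?A = "hydra_gens k"
  have i: "1 \<le> i" "i \<le> k" and w: "w \<in> words ?A" using 3(2) by (auto elim: words_mono)
  have ai: "inv_word (aw i) = [(Gen_a i, False)]" using i by (cases i) (simp_all add: aw_def)
  have "Suc (nat \<bar>e\<bar>) ^ k \<le> Suc M ^ k" using 3(3) by (intro power_mono) simp_all
  then have "h_area k (Suc M ^ k) (inv_word (t_pow e @ aw i @ inv_word (t_pow e))) (inv_word (of_ga (Th e i)))"
    by (rule area_eq_inv[OF area_eq_mono[OF h_area_Th[OF i(2)]]])
  moreover have "h_area k (length w * Suc M ^ k) (t_pow e @ w) (of_ga (phi e (to_gx w)) @ t_pow (e + expo (to_gx w)))"
    using 3 by (intro 3(1)) auto
  ultimately have "h_area k (Suc M ^ k + length w * Suc M ^ k) (inv_word (t_pow e @ aw i @ inv_word (t_pow e)) @ (t_pow e @ w))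
      (inv_word (of_ga (Th e i)) @ of_ga (phi e (to_gx w)) @ t_pow (e + expo (to_gx w)))"
    by (rule area_eq_append)
  moreover have "freely_equal ?A (t_pow e @ inv_word (aw i) @ w) (inv_word (t_pow e @ aw i @ inv_word (t_pow e)) @ (t_pow e @ w))"
    using w aw_words[OF i(2)] by (intro freely_equalI) (simp_all add: free_simps)
  ultimately show ?case
    by (simp add: ai) (metis area_eq_free_trans area_eq_words word_eq.refl)
next
  case (4 b w)
  let ?A = "hydra_gens k"
  define e' where "e' = (if b then e + 1 else e - 1)"
  have w: "w \<in> words ?A" using 4(2) by (auto elim: words_mono)
  have "freely_equal ?A (t_pow e @ [(Gen_t, b)]) (t_pow e')"
    unfolding e'_def using t_pow_Suc t_pow_diff1 by (cases b) simp_all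
  then have "freely_equal ?A ((t_pow e @ [(Gen_t, b)]) @ w) (t_pow e' @ w)"
    by (intro word_eq.append word_eq.refl w)
  moreover have "h_area k (length w * Suc M ^ k) (t_pow e' @ w) (of_ga (phi e' (to_gx w)) @ t_pow (e' + expo (to_gx w)))"
    using 4 unfolding e'_def by (intro 4(1)) auto
  ultimately have "h_area k (length w * Suc M ^ k) (t_pow e @ (Gen_t, b) # w) (of_ga (phi e' (to_gx w)) @ t_pow (e' + expo (to_gx w)))"
    by simp (metis area_eq_free_trans area_eq_words word_eq.refl)
  then have "h_area k (length ((Gen_t, b) # w) * Suc M ^ k) (t_pow e @ (Gen_t, b) # w) (of_ga (phi e' (to_gx w)) @ t_pow (e' + expo (to_gx w)))"
    by (rule area_eq_mono) simp
  moreover have "phi e (to_gx ((Gen_t, b) # w)) = phi e' (to_gx w)" "e + expo (to_gx ((Gen_t, b) # w)) = e' + expo (to_gx w)"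
    by (cases b; simp add: e'_def)+
  ultimately show ?case by (simp only:)
next
  case (5 b w)
  then show ?case by simp
qed

definition hval :: "hydra_gen word \<Rightarrow> hyd" where
  "hval = eval (\<lambda>g. case g of Gen_a i \<Rightarrow> ga i | Gen_t \<Rightarrow> gx 0 | Gen_p \<Rightarrow> 0)"

lemma eval_to_gx: "eval gx (to_gx w) = hval w"
proof (induction w rule: to_gx.induct)
  case (2 i w) then show ?case by (simp add: hval_def add.assoc[symmetric])
next
  case (3 i w)
  have "eval gx (to_gx ((Gen_a i, False) # w)) = gx 0 + (- gx i + hval w)"
    by (simp only: to_gx.simps eval_simps if_True if_False 3)
  also have "\<dots> = - (gx i - gx 0) + hval w" by (simp only: group_norm)
  finally show ?case by (simp only: hval_def eval_simps if_False hydra_gen.case)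
qed (simp_all add: hval_def)

lemma to_gx_words: "w \<in> words (hydra_gens k) \<Longrightarrow> to_gx w \<in> words {..k}"
  by (induction w rule: to_gx.induct) auto

text \<open>Once the powers of t are on the right, the free part is freely trivial and the exponent
  is 0, so moving them is the only cost.\<close>

theorem h_area_trivial:
  assumes w: "w \<in> words (hydra_gens k - {Gen_p})" and "hval w = 0"
  shows "h_area k (length w * Suc (length w) ^ k) w []"
proof -
  have "eval gx (to_gx w) = eval gx []" using assms(2) by (simp add: eval_to_gx)
  then have eq: "word_eq UNIV hyd_rel (to_gx w) []" by (simp only: eval_x_eq_iff)
  have "w \<in> words (hydra_gens k)" using w by (rule words_mono) auto
  then have phi: "phi 0 (to_gx w) \<in> words {1..k}" by (intro phi_words to_gx_words)
  have "reduce (phi 0 (to_gx w)) = reduce []" using reduce_freely_equal[OF phi_word_eq[OF eq, of 0]] by simp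
  then have "freely_equal {1..k} (phi 0 (to_gx w)) []" using phi by (simp add: freely_equal_iff_reduce)
  from of_ga_freely_equal[OF this] have "freely_equal (hydra_gens k) (of_ga (phi 0 (to_gx w))) []" by simp
  moreover have "h_area k (length w * Suc (length w) ^ k) (t_pow 0 @ w) (of_ga (phi 0 (to_gx w)) @ t_pow (0 + expo (to_gx w)))"
    by (rule h_area_phi[OF w]) simp
  moreover have "expo (to_gx w) = 0" using expo_word_eq[OF eq] by simp
  ultimately show ?thesis
    using area_eq_free_trans[OF word_eq.refl[OF \<open>w \<in> words (hydra_gens k)\<close>]] by simp
qed

section \<open>The upper bound\<close>

definition coset :: "nat \<Rightarrow> hyd \<Rightarrow> hyd set" where
  "coset k g = (\<lambda>h. h + g) ` H k"

lemma coset_eq_iff: "coset k g = coset k g' \<longleftrightarrow> g - g' \<in> H k"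
proof
  assume "coset k g = coset k g'"
  moreover have "g \<in> coset k g" unfolding coset_def by (rule image_eqI[of _ _ 0]) simp_all
  ultimately obtain h where "h \<in> H k" "g = h + g'" by (auto simp: coset_def)
  then show "g - g' \<in> H k" by simp
next
  assume d: "g - g' \<in> H k"
  have "h + g \<in> coset k g'" if "h \<in> H k" for h
    unfolding coset_def by (rule image_eqI[of _ _ "h + (g - g')"]) (simp_all only: group_norm H_add[OF that d, simplified group_norm])
  moreover have "h + g' \<in> coset k g" if "h \<in> H k" for h
  proof -
    have "h + - (g - g') \<in> H k" by (intro H_add H_uminus that d)
    then show ?thesis unfolding coset_def by (rule rev_image_eqI) (simp only: group_norm)
  qed
  ultimately show "coset k g = coset k g'" unfolding coset_def by blast
qed

text \<open>A letter \<open>Gen_p\<close> stands for its conjugate by everything to its right, and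
  \<open>g\<close> is the value of what follows the word. As \<open>Gen_p\<close> commutes with
  \<open>H k\<close>, only the coset of that value matters.\<close>

fun coset_labels :: "nat \<Rightarrow> hyd \<Rightarrow> hydra_gen word \<Rightarrow> hyd set word" where
  "coset_labels k g [] = []"
| "coset_labels k g ((y, b) # w) = (if y = Gen_p then [(coset k (hval w + g), b)] else []) @ coset_labels k g w"

lemma hval_simps [simp]:
  "hval [] = 0" "hval (u @ v) = hval u + hval v" "hval (inv_word u) = - hval u"
  "hval ((Gen_a i, b) # w) = (if b then ga i else - ga i) + hval w"
  "hval ((Gen_t, b) # w) = (if b then gx 0 else - gx 0) + hval w"
  "hval ((Gen_p, b) # w) = hval w"
  by (simp_all add: hval_def)

lemma coset_labels_append: "coset_labels k g (u @ v) = coset_labels k (hval v + g) u @ coset_labels k g v"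
  by (induction u) (auto simp: add.assoc)

lemma hval_relator:
  assumes "r \<in> hydra_relators k" shows "hval r = 0"
proof -
  have c: "- gx 0 + ga i + gx 0 = ga i + ga (i - 1)" if "1 \<le> i" for i
    using a_conj[of "i - 1"] that by (cases i) simp_all
  consider "r = inv_word t_word @ a_word 1 @ t_word @ inv_word (a_word 1)"
    | i where "1 < i" "r = inv_word t_word @ a_word i @ t_word @ inv_word (a_word i @ a_word (i - 1))"
    | i where "r = comm_word p_word (a_word i @ t_word)"
    using assms unfolding hydra_relators_def by blast
  then show ?thesis
  proof cases
    case 1
    have "hval r = (- gx 0 + ga 1 + gx 0) - (ga 1 + ga 0)"
      unfolding 1 by (simp only: hval_simps inv_word_simps append_Cons append_Nil not_True_eq_False if_False if_True group_norm)
    then show ?thesis unfolding c[of 1, simplified] by simp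
  next
    case (2 i)
    have "hval r = (- gx 0 + ga i + gx 0) - (ga i + ga (i - 1))"
      unfolding 2(2) by (simp only: hval_simps inv_word_simps append_Cons append_Nil not_True_eq_False if_False if_True group_norm)
    also have "\<dots> = 0" using c[of i] 2(1) by simp
    finally show ?thesis .
  next
    case (3 i)
    show ?thesis
      unfolding 3 comm_word_def by (simp only: hval_simps inv_word_simps append_Cons append_Nil not_True_eq_False if_False if_True group_norm)
  qed
qed

lemma hval_word_eq: "word_eq (hydra_gens k) (hydra_relators k) u v \<Longrightarrow> hval u = hval v"
  using eval_word_eq[of _ _ u v] hval_relator unfolding hval_def by metis

lemma hval_comm_suffix: "hval (a_word i @ t_word) = gx i"
  by simp

text \<open>In a relator containing \<open>Gen_p\<close> the two labels are the cosets of
  \<open>g\<close> and of x_i times \<open>g\<close>, which coincide, and the signs are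
  opposite.\<close>

lemma coset_labels_word_eq:
  "word_eq (hydra_gens k) (hydra_relators k) u v \<Longrightarrow> freely_equal UNIV (coset_labels k g u) (coset_labels k g v)"
proof (induction arbitrary: g rule: word_eq.induct)
  case (cancel y b)
  have "freely_equal UNIV [(coset k g, b), (coset k g, \<not> b)] []" by (intro word_eq.cancel) simp
  then show ?case by (cases "y = Gen_p") (simp_all add: word_eq.refl)
next
  case (relator r)
  show ?case
  proof (cases "\<exists>i. 1 \<le> i \<and> i \<le> k \<and> r = comm_word p_word (a_word i @ t_word)")
    case True
    then obtain i where i: "1 \<le> i" "i \<le> k" and r: "r = comm_word p_word (a_word i @ t_word)" by blast
    have "coset_labels k g r = [(coset k (- hval (a_word i @ t_word) + hval (a_word i @ t_word) + g), False),
        (coset k (hval (a_word i @ t_word) + g), True)]"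
      unfolding r comm_word_def by (simp add: coset_labels_append)
    also have "\<dots> = [(coset k g, False), (coset k (gx i + g), True)]"
      unfolding hval_comm_suffix by simp
    also have "coset k (gx i + g) = coset k g"
      unfolding coset_eq_iff using x_H[OF i] by (simp only: group_norm)
    finally show ?thesis using word_eq.cancel[of "coset k g" UNIV "{}" False] by simp
  next
    case False
    then have "coset_labels k g r = []" using relator unfolding hydra_relators_def by auto
    then show ?thesis by (simp add: word_eq.refl)
  qed
next
  case (append u u' v v')
  then show ?case
    using hval_word_eq[OF append.hyps(2)] by (auto simp: coset_labels_append intro: word_eq.append)
qed (auto intro: word_eq.refl word_eq.sym word_eq.trans)

lemma not_reduced: "\<not> reduced w \<Longrightarrow> \<exists>u y b v. w = u @ (y, b) # (y, \<not> b) # v"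
proof (induction w rule: reduced.induct)
  case (1 l m w)
  show ?case
  proof (cases "m = (fst l, \<not> snd l)")
    case True
    then have "l # m # w = [] @ (fst l, snd l) # (fst l, \<not> snd l) # w" by simp
    then show ?thesis by blast
  next
    case False
    then obtain u y b v where "m # w = u @ (y, b) # (y, \<not> b) # v" using 1 by auto
    then have "l # m # w = (l # u) @ (y, b) # (y, \<not> b) # v" by simp
    then show ?thesis by blast
  qed
qed simp_all

lemma coset_labels_split: "coset_labels k g w = u @ v \<Longrightarrow> \<exists>w1 w2. w = w1 @ w2 \<and> coset_labels k g w2 = v"
proof (induction w arbitrary: u)
  case Nil
  then show ?case by (intro exI[of _ "[]"]) simp
next
  case (Cons s w)
  show ?case
  proof (cases u)
    case Nil
    then show ?thesis using Cons.prems by (intro exI[of _ "[]"] exI[of _ "s # w"]) simp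
  next
    case (Cons l u')
    obtain y b where s: "s = (y, b)" by force
    have "\<exists>u''. coset_labels k g w = u'' @ v" using Cons.prems Cons by (cases "y = Gen_p") (auto simp: s)
    then obtain w1 w2 where "w = w1 @ w2" "coset_labels k g w2 = v" using Cons.IH by blast
    then show ?thesis by (intro exI[of _ "s # w1"] exI[of _ w2]) simp
  qed
qed

lemma coset_labels_Cons: "coset_labels k g w = (c, b) # v \<Longrightarrow>
  \<exists>w1 w2. w = w1 @ (Gen_p, b) # w2 \<and> (\<forall>A. w \<in> words A \<longrightarrow> w1 \<in> words (A - {Gen_p})) \<and> c = coset k (hval w2 + g) \<and> coset_labels k g w2 = v"
proof (induction w)
  case (Cons s w)
  obtain y b' where s: "s = (y, b')" by force
  show ?case
  proof (cases "y = Gen_p")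
    case True
    then show ?thesis using Cons.prems s by (intro exI[of _ "[]"] exI[of _ w]) auto
  next
    case False
    then have "coset_labels k g w = (c, b) # v" using Cons.prems s by simp
    then obtain w1 w2 where "w = w1 @ (Gen_p, b) # w2" "\<forall>A. w \<in> words A \<longrightarrow> w1 \<in> words (A - {Gen_p})"
      "c = coset k (hval w2 + g)" "coset_labels k g w2 = v"
      using Cons.IH by blast
    then show ?thesis using False s by (intro exI[of _ "s # w1"] exI[of _ w2]) auto
  qed
qed simp

lemma coset_labels_Nil: "coset_labels k g w = [] \<Longrightarrow> w \<in> words A \<Longrightarrow> w \<in> words (A - {Gen_p})"
  by (induction w) (auto split: if_splits)

text \<open>Britton's lemma for the stable letter \<open>Gen_p\<close>: the kernel of killing \<open>Gen_p\<close> is free on the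
  cosets of \<open>H k\<close>, so in a trivial word two neighbouring occurrences have to cancel.\<close>

lemma p_pinch:
  assumes "word_eq (hydra_gens k) (hydra_relators k) w []" "w \<notin> words (hydra_gens k - {Gen_p})" "w \<in> words (hydra_gens k)"
  obtains u b m v where "w = u @ (Gen_p, b) # m @ (Gen_p, \<not> b) # v" "m \<in> words (hydra_gens k - {Gen_p})" "hval m \<in> H k"
proof -
  have "reduce (coset_labels k 0 w) = []" using reduce_freely_equal[OF coset_labels_word_eq[OF assms(1), of 0]] by simp
  moreover have "coset_labels k 0 w \<noteq> []" using coset_labels_Nil assms(2,3) by blast
  ultimately have "\<not> reduced (coset_labels k 0 w)" using reduce_reduced by metis
  then obtain u c b v where "coset_labels k 0 w = u @ (c, b) # (c, \<not> b) # v" using not_reduced by blast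
  then obtain w1 w2 where w: "w = w1 @ w2" "coset_labels k 0 w2 = (c, b) # (c, \<not> b) # v" using coset_labels_split by blast
  then obtain w3 w4 where w2: "w2 = w3 @ (Gen_p, b) # w4" "c = coset k (hval w4 + 0)" "coset_labels k 0 w4 = (c, \<not> b) # v"
    using coset_labels_Cons by blast
  have "w4 \<in> words (hydra_gens k)" using assms(3) w w2 by simp
  then obtain m w5 where w4: "w4 = m @ (Gen_p, \<not> b) # w5" "m \<in> words (hydra_gens k - {Gen_p})" "c = coset k (hval w5 + 0)"
    using coset_labels_Cons[OF w2(3)] by blast
  have "coset k (hval m + hval w5) = coset k (hval w5)"
    using w2(2) w4(3) unfolding w4(1) by simp
  then have "hval m \<in> H k" unfolding coset_eq_iff by simp
  then show thesis using that[of "w1 @ w3" b m w5] w w2 w4 by simp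
qed

section \<open>Removing a pair of letters \<open>Gen_p\<close>\<close>

fun of_gx :: "nat word \<Rightarrow> hydra_gen word" where
  "of_gx [] = []"
| "of_gx ((i, True) # w) = (Gen_a i, True) # (Gen_t, True) # of_gx w"
| "of_gx ((i, False) # w) = (Gen_t, False) # (Gen_a i, False) # of_gx w"

lemma length_of_gx: "length (of_gx w) = 2 * length w"
  by (induction w rule: of_gx.induct) simp_all

lemma of_gx_words: "w \<in> words {1..k} \<Longrightarrow> of_gx w \<in> words (hydra_gens k - {Gen_p})"
  by (induction w rule: of_gx.induct) auto

lemma hval_of_gx: "hval (of_gx w) = eval gx w"
proof (induction w rule: of_gx.induct)
  case (2 i w) then show ?case by (simp add: add.assoc[symmetric])
next
  case (3 i w)
  have "hval (of_gx ((i, False) # w)) = - gx 0 + (- (gx i - gx 0) + hval (of_gx w))"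
    by (simp only: of_gx.simps hval_simps if_False)
  also have "\<dots> = - gx i + hval (of_gx w)" by (simp only: group_norm)
  finally show ?case using 3 by simp
qed simp

text \<open>A letter a_i equals x_i t^-1 and so counts twice.\<close>

lemma nrm_hval:
  "w \<in> words (hydra_gens k - {Gen_p}) \<Longrightarrow> nrm k (2 * length w) (hval w)"
proof (induction w)
  case (Cons s w)
  obtain y b where s: "s = (y, b)" by force
  have w: "nrm k (2 * length w) (hval w)" using Cons by simp
  have "y \<in> hydra_gens k - {Gen_p}" using Cons.prems s by simp
  then consider i where "y = Gen_a i" "1 \<le> i" "i \<le> k" | "y = Gen_t" by (auto simp: hydra_gens_def)
  then have "nrm k 2 (hval [s])"
  proof cases
    case (1 i)
    then have "nrm k (1 + 1) (gx i + - gx 0)" "nrm k (1 + 1) (gx 0 + - gx i)"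
      by (intro nrm_add nrm_S S_x; simp)+
    moreover have "- (gx i - gx 0) = gx 0 + - gx i" by (simp only: group_norm)
    ultimately show ?thesis using 1 s by (cases b) simp_all
  next
    case 2
    then have "nrm k 1 (gx 0)" "nrm k 1 (- gx 0)" by (intro nrm_S S_x; simp)+
    then show ?thesis using 2 s nrm_mono[of k 1 _ 2] by (cases b) simp_all
  qed
  from nrm_add[OF this w] show ?case using hval_simps(2)[of "[s]" w] by simp
qed simp

lemma h_area_p_letter:
  assumes "1 \<le> i" "i \<le> k"
  shows "h_area k 1 ([(Gen_p, b)] @ of_gx [(i, c)] @ [(Gen_p, \<not> b)]) (of_gx [(i, c)])"
proof -
  let ?v = "a_word i @ t_word" and ?A = "hydra_gens k"
  have v: "?v \<in> words ?A" using assms by simp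
  have "comm_word p_word ?v \<in> hydra_relators k" using assms unfolding hydra_relators_def by blast
  then have "h_area k 1 (inv_word (comm_word p_word ?v)) []"
    using assms by (intro area_eq_relator UnI2 imageI) (simp_all add: comm_word_def)
  from area_eq_context[OF this v, of "[]"]
  have "h_area k 1 (?v @ inv_word (comm_word p_word ?v)) ?v" by simp
  moreover have "freely_equal ?A (inv_word p_word @ ?v @ p_word) (?v @ inv_word (comm_word p_word ?v))"
    using assms by (intro freely_equalI) (simp_all add: comm_word_def free_simps)
  ultimately have F: "h_area k 1 (inv_word p_word @ ?v @ p_word) ?v"
    using area_eq_free_trans[OF _ _ word_eq.refl[OF v]] by blast
  have "h_area k 1 (p_word @ (inv_word p_word @ ?v @ p_word) @ inv_word p_word) (p_word @ ?v @ inv_word p_word)"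
    by (rule area_eq_context[OF F]) simp_all
  then have "h_area k 1 (p_word @ ?v @ inv_word p_word) (p_word @ (inv_word p_word @ ?v @ p_word) @ inv_word p_word)"
    by (rule area_eq_sym)
  moreover have "freely_equal ?A (p_word @ (inv_word p_word @ ?v @ p_word) @ inv_word p_word) ?v"
    using assms by (intro freely_equalI) (simp_all add: free_simps)
  ultimately have P: "h_area k 1 (p_word @ ?v @ inv_word p_word) ?v"
    using area_eq_free_trans[OF word_eq.refl] area_eq_words by metis
  have "h_area k 1 ([(Gen_p, b)] @ ?v @ [(Gen_p, \<not> b)]) ?v"
    using F P by (cases b) simp_all
  moreover from area_eq_inv[OF this] have "h_area k 1 ([(Gen_p, b)] @ inv_word ?v @ [(Gen_p, \<not> b)]) (inv_word ?v)"
    by simp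
  ultimately show ?thesis by (cases c) simp_all
qed

lemma h_area_p_word:
  "w \<in> words {1..k} \<Longrightarrow> h_area k (length w) ([(Gen_p, b)] @ of_gx w @ [(Gen_p, \<not> b)]) (of_gx w)"
proof (induction w)
  case Nil
  then show ?case by (cases b) (auto intro!: area_eq_free freely_equalI simp: free_simps)
next
  case (Cons s w)
  obtain i c where s: "s = (i, c)" by force
  let ?A = "hydra_gens k"
  have zs: "of_gx (s # w) = of_gx [s] @ of_gx w" unfolding s by (cases c) simp_all
  have i: "1 \<le> i" "i \<le> k" using Cons.prems s by auto
  have w: "of_gx [s] \<in> words ?A" "of_gx w \<in> words ?A"
    using of_gx_words[of "[s]" k] of_gx_words[of w k] Cons.prems by (auto elim: words_mono)
  have "h_area k (1 + length w) (([(Gen_p, b)] @ of_gx [s] @ [(Gen_p, \<not> b)]) @ ([(Gen_p, b)] @ of_gx w @ [(Gen_p, \<not> b)])) (of_gx [s] @ of_gx w)"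
    using h_area_p_letter[OF i] Cons unfolding s by (intro area_eq_append) auto
  note A = this
  have B: "freely_equal ?A ([(Gen_p, b)] @ of_gx (s # w) @ [(Gen_p, \<not> b)])
     (([(Gen_p, b)] @ of_gx [s] @ [(Gen_p, \<not> b)]) @ ([(Gen_p, b)] @ of_gx w @ [(Gen_p, \<not> b)]))"
    unfolding zs using w by (intro freely_equalI; cases b) (simp_all add: free_simps)
  have C: "freely_equal ?A (of_gx [s] @ of_gx w) (of_gx (s # w))" unfolding zs using w by (intro word_eq.refl) simp
  have "h_area k (1 + length w) ([(Gen_p, b)] @ of_gx (s # w) @ [(Gen_p, \<not> b)]) (of_gx (s # w))"
    by (rule area_eq_free_trans[OF B A C])
  then show ?case by (simp only: length_Cons plus_1_eq_Suc)
qed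

text \<open>\<open>f\<close> bounds the length of the word in the x_i, the argument being doubled by
  \<open>nrm_hval\<close>. Rewriting into that word and back gives the two polynomial terms; the
  last \<open>f\<close> pays for commuting with \<open>Gen_p\<close>.\<close>

definition pinch_cost :: "nat \<Rightarrow> nat \<Rightarrow> nat" where
  "pinch_cost k n = (let f = distortion (k - 1) (2 * n) in 2 * ((n + 2 * f) * Suc (n + 2 * f) ^ k) + f)"

lemma h_area_p_H:
  assumes k: "1 \<le> k" and m: "m \<in> words (hydra_gens k - {Gen_p})" "length m \<le> n" "hval m \<in> H k"
  shows "h_area k (pinch_cost k n) ([(Gen_p, b)] @ m @ [(Gen_p, \<not> b)]) m"
proof -
  let ?A = "hydra_gens k"
  define f where "f = distortion (k - 1) (2 * n)"
  have "nrm k (2 * n) (hval m)" by (rule nrm_mono[OF nrm_hval[OF m(1)]]) (use m(2) in simp)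
  then have "H_norm k f (hval m)" using H_distortion[of "k - 1"] m(3) k unfolding f_def by simp
  then obtain z where z: "z \<in> words {1..k}" "length z \<le> f" "eval gx z = hval m" unfolding H_norm_def by blast
  have w: "of_gx z \<in> words ?A" "m \<in> words ?A"
    using of_gx_words[OF z(1)] m(1) by (auto elim: words_mono)
  define L where "L = n + 2 * f"
  have len: "length (m @ inv_word (of_gx z)) \<le> L" using m(2) z(2) by (simp add: L_def length_of_gx)
  have "h_area k (length (m @ inv_word (of_gx z)) * Suc (length (m @ inv_word (of_gx z))) ^ k) (m @ inv_word (of_gx z)) []"
    using m(1) of_gx_words[OF z(1)] z(3) by (intro h_area_trivial) (simp_all add: hval_of_gx)
  then have "h_area k (L * Suc L ^ k) (m @ inv_word (of_gx z)) []"
    by (rule area_eq_mono) (use len in \<open>intro mult_le_mono power_mono; simp\<close>)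
  from area_eq_context[OF this, of "[]" "of_gx z"] w
  have "h_area k (L * Suc L ^ k) ((m @ inv_word (of_gx z)) @ of_gx z) (of_gx z)" by simp
  moreover have "freely_equal ?A m ((m @ inv_word (of_gx z)) @ of_gx z)"
    using w by (intro freely_equalI) (simp_all add: free_simps)
  ultimately have c: "h_area k (L * Suc L ^ k) m (of_gx z)"
    using area_eq_free_trans[OF _ _ word_eq.refl[OF w(1)]] by blast
  have 1: "h_area k (L * Suc L ^ k) ([(Gen_p, b)] @ m @ [(Gen_p, \<not> b)]) ([(Gen_p, b)] @ of_gx z @ [(Gen_p, \<not> b)])"
    by (rule area_eq_context[OF c]) simp_all
  have "h_area k (L * Suc L ^ k + (length z + L * Suc L ^ k)) ([(Gen_p, b)] @ m @ [(Gen_p, \<not> b)]) m"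
    by (rule area_eq_trans[OF 1 area_eq_trans[OF h_area_p_word[OF z(1)] area_eq_sym[OF c]]])
  then show ?thesis
    by (rule area_eq_mono) (use z(2) in \<open>simp add: pinch_cost_def Let_def flip: f_def L_def\<close>)
qed

text \<open>Every removed pinch shortens the word by two letters, so pinches stay of length at most
  \<open>n\<close> and there are at most \<open>length w\<close> of them. The second summand fills
  the final word without \<open>Gen_p\<close>.\<close>

lemma hydra_area:
  assumes k: "1 \<le> k" and w: "w \<in> words (hydra_gens k)" "length w \<le> n" "word_eq (hydra_gens k) (hydra_relators k) w []"
  shows "h_area k (length w * pinch_cost k n + n * Suc n ^ k) w []"
  using w
proof (induction "length w" arbitrary: w rule: less_induct)
  case less
  show ?case
  proof (cases "w \<in> words (hydra_gens k - {Gen_p})")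
    case True
    have "hval w = 0" using hval_word_eq[OF less(4)] by simp
    then have "h_area k (length w * Suc (length w) ^ k) w []" by (rule h_area_trivial[OF True])
    moreover have "length w * Suc (length w) ^ k \<le> n * Suc n ^ k"
      using less(3) by (intro mult_le_mono power_mono) simp_all
    ultimately show ?thesis by (auto elim: area_eq_mono)
  next
    case False
    obtain u b m v where w': "w = u @ (Gen_p, b) # m @ (Gen_p, \<not> b) # v"
      and m: "m \<in> words (hydra_gens k - {Gen_p})" "hval m \<in> H k"
      by (rule p_pinch[OF less(4) False less(2)])
    have "h_area k (pinch_cost k n) ([(Gen_p, b)] @ m @ [(Gen_p, \<not> b)]) m"
      using less(3) by (intro h_area_p_H[OF k m(1) _ m(2)]) (simp add: w')
    from area_eq_context[OF this, of u v]
    have 1: "h_area k (pinch_cost k n) w (u @ m @ v)" using less(2) by (simp add: w')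
    then have "word_eq (hydra_gens k) (hydra_relators k) (u @ m @ v) []"
      using area_eq_word_eq[OF 1 hydra_relators_words[OF k]] less(4) by (metis word_eq.sym word_eq.trans)
    then have "h_area k (length (u @ m @ v) * pinch_cost k n + n * Suc n ^ k) (u @ m @ v) []"
      using less(2,3) area_eq_words[OF 1] by (intro less(1)) (simp_all add: w')
    from area_eq_trans[OF 1 this] show ?thesis
      by (rule area_eq_mono) (simp add: w')
  qed
qed

lemma dehn_hydra_le:
  assumes k: "1 \<le> k"
  shows "dehn_function (hydra_gens k) (hydra_relators k) n \<le> n * pinch_cost k n + n * Suc n ^ k"
  unfolding dehn_function_def
proof (rule Least_le, intro ballI impI, elim conjE)
  fix w assume w: "w \<in> words (hydra_gens k)" "length w \<le> n"
    "word_class (hydra_gens k) (hydra_relators k) w = \<one>\<^bsub>presented_group (hydra_gens k) (hydra_relators k)\<^esub>"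
  then have "word_eq (hydra_gens k) (hydra_relators k) w []"
    using word_class_eq_one_iff[OF hydra_relators_words[OF k] w(1)] by simp
  then have "h_area k (length w * pinch_cost k n + n * Suc n ^ k) w []" by (rule hydra_area[OF k w(1,2)])
  then show "fills (hydra_gens k) (hydra_relators k) (n * pinch_cost k n + n * Suc n ^ k) w"
    unfolding fills_iff_area_eq by (rule area_eq_mono) (use w(2) in simp)
qed

theorem dehn_hydra_upper:
  assumes k: "2 \<le> k"
  shows "dehn_function (hydra_gens k) (hydra_relators k) \<preceq> ackermann k"
proof -
  have k1: "1 \<le> k" using k by simp
  obtain c where c: "\<And>n. distortion (k - 1) n \<le> ackermann k (c * n + c)"
    using distortion_ackermann[of "k - 1"] k by auto
  \<comment> \<open>\<open>D\<close> is the sum of the three coefficients after all powers of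
    \<open>B\<close> are raised to exponent \<open>k + 2\<close>.\<close>
  define D :: nat where "D = 6 * 4 ^ k + 1 + 2 ^ k"
  define C where "C = D + (k + 2) * (2 * c + 1)"
  have "dehn_function (hydra_gens k) (hydra_relators k) n \<le> C * ackermann k (C * n + C) + C * n + C" for n
  proof -
    \<comment> \<open>\<open>z\<close> dominates both \<open>n\<close> and the argument
      \<open>c * (2 * n) + c\<close>.\<close>
    define z where "z = (2 * c + 1) * n + (2 * c + 1)"
    define B where "B = ackermann k z"
    define f where "f = distortion (k - 1) (2 * n)"
    have f: "f \<le> B" unfolding f_def B_def
      using c[of "2 * n"] ackermann_mono[OF k1, of "c * (2 * n) + c" z] by (simp add: z_def algebra_simps)
    have "n \<le> z" by (simp add: z_def distrib_right)
    then have n: "n \<le> B" unfolding B_def using ackermann_ge[OF k1, of z] by (rule order_trans)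
    have B: "1 \<le> B" unfolding B_def by (rule ackermann_pos[OF k])
    have "pinch_cost k n \<le> 2 * ((3 * B) * (4 * B) ^ k) + B"
      unfolding pinch_cost_def Let_def f_def[symmetric]
      using f n B by (intro add_mono mult_le_mono power_mono) simp_all
    moreover have "Suc n \<le> 2 * B" using n B by simp
    ultimately have "n * pinch_cost k n + n * Suc n ^ k \<le> B * (2 * ((3 * B) * (4 * B) ^ k) + B) + B * (2 * B) ^ k"
      using n by (intro add_mono mult_le_mono power_mono) simp_all
    also have "\<dots> = 6 * 4 ^ k * B ^ (k + 2) + B ^ 2 + 2 ^ k * B ^ (k + 1)"
      by (simp add: power_mult_distrib power_add algebra_simps power2_eq_square)
    also have "\<dots> \<le> 6 * 4 ^ k * B ^ (k + 2) + B ^ (k + 2) + 2 ^ k * B ^ (k + 2)"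
      using B by (intro add_mono mult_le_mono power_increasing) simp_all
    also have "\<dots> = D * B ^ (k + 2)" by (simp add: D_def algebra_simps)
    also have "\<dots> \<le> D * ackermann k ((k + 2) * z)"
      unfolding B_def by (intro mult_le_mono ackermann_pow[OF k]) simp
    also have "\<dots> \<le> C * ackermann k (C * n + C)"
    proof (intro mult_le_mono ackermann_mono[OF k1])
      have "(k + 2) * z = ((k + 2) * (2 * c + 1)) * n + (k + 2) * (2 * c + 1)"
        unfolding z_def by (simp only: algebra_simps)
      also have "\<dots> \<le> C * n + C" unfolding C_def by (intro add_mono mult_le_mono) simp_all
      finally show "(k + 2) * z \<le> C * n + C" .
    qed (simp add: C_def)
    finally show ?thesis using dehn_hydra_le[OF k1, of n] by simp
  qed
  moreover have "0 < C" by (simp add: C_def D_def)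
  ultimately show ?thesis unfolding growth_le_def by blast
qed

section \<open>The lower bound\<close>

lemma reduced_append: "reduced (u @ v) \<Longrightarrow> reduced u \<and> reduced v"
proof (induction u)
  case (Cons l u)
  then show ?case by (cases u) (auto dest: reduced_tl)
qed simp

lemma join_exists:
  assumes "w \<in> words {1..Suc m}"
  shows "\<exists>v l. w = join (Suc m) v l \<and> v \<in> words {1..m} \<and> (\<forall>(b, u) \<in> set l. u \<in> words {1..m})"
  using assms
proof (induction w)
  case Nil
  show ?case by (rule exI[of _ "[]"], rule exI[of _ "[]"]) simp
next
  case (Cons s w)
  then obtain v l where l: "w = join (Suc m) v l" "v \<in> words {1..m}" "\<forall>(b, u) \<in> set l. u \<in> words {1..m}" by auto
  obtain i b where s: "s = (i, b)" by force
  show ?case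
  proof (cases "i = Suc m")
    case True
    then have "s # w = join (Suc m) [] ((b, v) # l)" using l s by simp
    moreover have "\<forall>(b, u) \<in> set ((b, v) # l). u \<in> words {1..m}" using l by simp
    ultimately show ?thesis by (intro exI[of _ "[]"] exI[of _ "(b, v) # l"]) simp
  next
    case False
    then have "s # v \<in> words {1..m}" using Cons.prems s l by auto
    moreover have "s # w = join (Suc m) (s # v) l" unfolding l(1) by (cases l) auto
    ultimately show ?thesis using l by (intro exI[of _ "s # v"] exI[of _ l]) simp
  qed
qed

lemma eval_join: "eval gx (join (Suc m) v l) = val m (eval gx v) (map (apsnd (eval gx)) l)"
  by (induction l arbitrary: v) (auto simp: add.assoc)

lemma no_pinch_join:
  assumes "reduced (join k v l)" "\<And>b u. (b, u) \<in> set l \<Longrightarrow> P b u \<Longrightarrow> reduced u \<Longrightarrow> u = []"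
  shows "no_pinch P l"
  using assms
proof (induction P l arbitrary: v rule: no_pinch.induct)
  case (1 P b u b' u' l)
  have r: "reduced (v @ (k, b) # join k u ((b', u') # l))" using 1(2) by simp
  then have r': "reduced ((k, b) # join k u ((b', u') # l))" using reduced_append by blast
  have "reduced (join k u ((b', u') # l))" using reduced_tl[OF r'] .
  then have "no_pinch P ((b', u') # l)" using 1(3) by (intro 1(1)[of u]) auto
  moreover have "\<not> (b' = (\<not> b) \<and> P b u)"
  proof
    assume p: "b' = (\<not> b) \<and> P b u"
    have "reduced u" using \<open>reduced (join k u _)\<close> reduced_append by auto
    then have "u = []" using p 1(3)[of b u] by simp
    then show False using r' p by simp
  qed
  ultimately show ?case by simp
qed simp_all

lemma no_pinch_map: "no_pinch P (map (apsnd f) l) \<longleftrightarrow> no_pinch (\<lambda>b u. P b (f u)) l"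
proof (induction "\<lambda>b u. P b (f u)" l rule: no_pinch.induct)
  case (1 b v b' v' l)
  then show ?case by simp
next
  case ("2_2" v)
  then show ?case by (cases v) simp
qed simp

text \<open>Cut the word at its letters x_(m+1). The middle of a pinch would lie in
  \<open>H m\<close> and in an associated subgroup, hence be trivial and, by induction, empty,
  against reducedness. So there is no pinch, and \<open>hnn_compare\<close> with 0 leaves no stable
  letter.\<close>

theorem H_free: "w \<in> words {1..k} \<Longrightarrow> reduced w \<Longrightarrow> eval gx w = 0 \<Longrightarrow> w = []"
proof (induction k arbitrary: w)
  case 0
  then show ?case by (cases w) auto
next
  case (Suc m)
  obtain v l where l: "w = join (Suc m) v l" "v \<in> words {1..m}" "\<forall>(b, u) \<in> set l. u \<in> words {1..m}"
    using join_exists[OF Suc.prems(1)] by blast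
  have u: "u = []" if "(b, u) \<in> set l" "assoc m b (eval gx u)" "reduced u" for b u
  proof -
    have "u \<in> words {1..m}" using l(3) that(1) by blast
    moreover from this have "eval gx u = 0" using that(2) by (intro assoc_H[OF trivial_assoc]) (auto simp: H_def)
    ultimately show ?thesis using Suc.IH that(3) by blast
  qed
  have np: "no_pinch (assoc m) (map (apsnd (eval gx)) l)"
    unfolding no_pinch_map using Suc.prems(2) u unfolding l(1) by (rule no_pinch_join)
  have vH: "eval gx v \<in> G m" using l(2) H_sub_G[of m] by (auto simp: H_def)
  have lG: "snd ` set (map (apsnd (eval gx)) l) \<subseteq> G m"
  proof
    fix g assume "g \<in> snd ` set (map (apsnd (eval gx)) l)"
    then obtain b u where "(b, u) \<in> set l" "g = eval gx u" by auto
    then show "g \<in> G m" using l(3) H_sub_G[of m] unfolding H_def by blast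
  qed
  have "val m (eval gx v) (map (apsnd (eval gx)) l) = val m 0 []"
    using Suc.prems(3) unfolding l(1) eval_join by simp
  from vH lG np G_zero _ _ this have "map (apsnd (eval gx)) l = []"
    by (rule hnn_compare) simp_all
  then show ?case using Suc.IH[OF l(2)] Suc.prems l(1) by simp
qed

text \<open>In a free group a reduced word is the shortest one for its element.\<close>

corollary H_length_ge:
  assumes "u \<in> words {1..k}" "reduced u" "H_norm k n (eval gx u)"
  shows "length u \<le> n"
proof -
  obtain z where z: "z \<in> words {1..k}" "length z \<le> n" "eval gx z = eval gx u" using assms(3) unfolding H_norm_def by blast
  have "reduce (inv_word u @ z) = []"
  proof (rule H_free)
    show "reduce (inv_word u @ z) \<in> words {1..k}"
      using free_word_eq_words[OF freely_equal_reduce[of "inv_word u @ z" "{1..k}"]] assms(1) z(1) by simp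
  qed (simp_all add: z)
  then have "foldr push (inv_word u) (reduce z) = []" by (simp add: reduce_def)
  then have "foldr push u [] = reduce z" using foldr_push_inv_right[OF reduced_reduce] by metis
  then have "u = reduce z" using reduce_reduced[OF assms(2)] by (simp add: reduce_def)
  then show ?thesis using length_reduce[of z] z(2) by simp
qed

text \<open>Word length, extended by 0 outside \<open>H k\<close>. It stays 1-Lipschitz for left
  multiplication by x_i, which preserves \<open>H k\<close> and its complement.\<close>

definition H_len :: "nat \<Rightarrow> hyd \<Rightarrow> int" where
  "H_len k g = (if g \<in> H k then int (LEAST n. H_norm k n g) else 0)"

lemma H_len_Least: "g \<in> H k \<Longrightarrow> H_norm k (LEAST n. H_norm k n g) g"
  using H_H_norm by (metis LeastI)

lemma H_len_x:
  assumes i: "1 \<le> i" "i \<le> k"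
  shows "\<bar>H_len k (gx i + g) - H_len k g\<bar> \<le> 1"
proof (cases "g \<in> H k")
  case True
  have x: "H_norm k 1 (gx i)" by (rule H_norm_x[OF i])
  have xg: "gx i + g \<in> H k" by (intro H_add x_H i True)
  have "H_norm k (1 + (LEAST n. H_norm k n g)) (gx i + g)" by (intro H_norm_add x H_len_Least True)
  then have "(LEAST n. H_norm k n (gx i + g)) \<le> 1 + (LEAST n. H_norm k n g)" by (rule Least_le)
  moreover have "H_norm k (1 + (LEAST n. H_norm k n (gx i + g))) (- gx i + (gx i + g))" by (intro H_norm_add H_norm_uminus x H_len_Least xg)
  then have "H_norm k (1 + (LEAST n. H_norm k n (gx i + g))) g" by (simp only: group_norm)
  then have "(LEAST n. H_norm k n g) \<le> 1 + (LEAST n. H_norm k n (gx i + g))" by (rule Least_le)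
  ultimately show ?thesis using True xg by (simp add: H_len_def)
next
  case False
  have "gx i + g \<notin> H k"
  proof
    assume "gx i + g \<in> H k"
    with H_uminus[OF x_H[OF i]] have "- gx i + (gx i + g) \<in> H k" by (rule H_add)
    then show False using False unfolding minus_add_cancel by blast
  qed
  then show ?thesis using False by (simp add: H_len_def)
qed

text \<open>In \<open>\<int>[G]\<close> a relator \<open>[Gen_p, a\<^sub>i t]\<close> contributes the boundary of one edge of the Cayley graph of
  \<open>H k\<close>; pairing with the 1-Lipschitz function \<open>H_len\<close> bounds the number of relators from below.\<close>

fun crossed :: "nat \<Rightarrow> hyd \<Rightarrow> hydra_gen word \<Rightarrow> int" where
  "crossed k g [] = 0"
| "crossed k g ((y, b) # w) =
    (if y = Gen_p then (if b then 1 else - 1) * H_len k (hval w + g) else 0) + crossed k g w"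

lemma crossed_append: "crossed k g (u @ v) = crossed k (hval v + g) u + crossed k g v"
  by (induction u) (auto simp: add.assoc)

lemma hval_freely_equal: "freely_equal A u v \<Longrightarrow> hval u = hval v"
  unfolding hval_def by (rule eval_freely_equal)

lemma crossed_freely_equal: "freely_equal A u v \<Longrightarrow> crossed k g u = crossed k g v"
proof (induction arbitrary: g rule: word_eq.induct)
  case (append u u' v v')
  then show ?case using hval_freely_equal[OF append.hyps(2)] by (simp add: crossed_append)
qed auto

lemma crossed_inv: "crossed k (hval u + g) (inv_word u) = - crossed k g u"
  using crossed_freely_equal[OF free_inv_left[OF words_UNIV], of k g u] by (simp add: crossed_append)

lemma crossed_relator:
  assumes "r \<in> hydra_relators k"
  shows "\<bar>crossed k g r\<bar> \<le> 1"
proof (cases "\<exists>i. 1 \<le> i \<and> i \<le> k \<and> r = comm_word p_word (a_word i @ t_word)")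
  case True
  then obtain i where i: "1 \<le> i" "i \<le> k" and r: "r = comm_word p_word (a_word i @ t_word)" by blast
  have "crossed k g r = - H_len k (- hval (a_word i @ t_word) + hval (a_word i @ t_word) + g)
      + H_len k (hval (a_word i @ t_word) + g)"
    unfolding r comm_word_def by (simp add: crossed_append)
  then show ?thesis using H_len_x[OF i, of g] unfolding hval_comm_suffix by simp
next
  case False
  then have "crossed k g r = 0" using assms unfolding hydra_relators_def by auto
  then show ?thesis by simp
qed

text \<open>A relator has value 0, so the contributions of a conjugating word and of its inverse
  cancel.\<close>

lemma crossed_conj_product:
  assumes "set cs \<subseteq> words (hydra_gens k) \<times> (hydra_relators k \<union> inv_word ` hydra_relators k)"
  shows "\<bar>crossed k g (conj_product cs)\<bar> \<le> int (length cs)"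
  using assms
proof (induction cs)
  case (Cons c cs)
  obtain u r where c: "c = (u, r)" by force
  define h where "h = hval (conj_product cs) + g"
  have r: "hval r = 0 \<and> \<bar>crossed k g' r\<bar> \<le> 1" for g'
  proof -
    have "r \<in> hydra_relators k \<union> inv_word ` hydra_relators k" using Cons.prems c by simp
    then show ?thesis
    proof
      assume "r \<in> hydra_relators k" then show ?thesis using hval_relator crossed_relator by blast
    next
      assume "r \<in> inv_word ` hydra_relators k"
      then obtain s where s: "s \<in> hydra_relators k" "r = inv_word s" by blast
      have "crossed k g' r = - crossed k g' s" using crossed_inv[of k s g'] hval_relator[OF s(1)] s(2) by simp
      then show ?thesis using hval_relator[OF s(1)] crossed_relator[OF s(1), of g'] s(2) by simp
    qed
  qed
  have "crossed k g (conj_product (c # cs)) =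
     crossed k (hval r + (hval u + h)) (inv_word u) + crossed k (hval u + h) r + crossed k h u + crossed k g (conj_product cs)"
    by (simp add: c crossed_append h_def add.assoc)
  also have "\<dots> = crossed k (hval u + h) r + crossed k g (conj_product cs)"
    using r crossed_inv[of k u h] by simp
  finally show ?case using r[of "hval u + h"] Cons by auto
qed simp

lemma crossed_fills:
  assumes "fills (hydra_gens k) (hydra_relators k) N (comm_word p_word w)" "w \<in> words (hydra_gens k - {Gen_p})"
  shows "H_len k (hval w) \<le> int N"
proof -
  obtain cs where cs: "length cs \<le> N" "set cs \<subseteq> words (hydra_gens k) \<times> (hydra_relators k \<union> inv_word ` hydra_relators k)"
    "freely_equal (hydra_gens k) (comm_word p_word w) (conj_product cs)"
    using assms(1) unfolding fills_def by blast
  have p_free: "crossed k g w = 0" "crossed k g (inv_word w) = 0" for g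
  proof -
    have "crossed k g u = 0" if "u \<in> words (hydra_gens k - {Gen_p})" for u
      using that by (induction u) auto
    then show "crossed k g w = 0" "crossed k g (inv_word w) = 0" using assms(2) by simp_all
  qed
  have "H_len k 0 = 0"
  proof -
    have "(LEAST n. H_norm k n 0) = 0" by (rule Least_eq_0) simp
    then show ?thesis by (simp add: H_len_def)
  qed
  \<comment> \<open>Only the two letters \<open>Gen_p\<close> count; the suffixes after them have
    values 0 and \<open>hval w\<close>.\<close>
  then have "crossed k 0 (comm_word p_word w) = H_len k (hval w)"
    using p_free by (simp add: comm_word_def crossed_append)
  then show ?thesis
    using crossed_conj_product[OF cs(2), of 0] crossed_freely_equal[OF cs(3), of k 0] cs(1) by simp
qed

lemma comm_word_trivial:
  assumes k: "1 \<le> k" and w: "w \<in> words (hydra_gens k - {Gen_p})" "hval w \<in> H k"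
  shows "word_eq (hydra_gens k) (hydra_relators k) (comm_word p_word w) []"
proof -
  let ?A = "hydra_gens k" and ?R = "hydra_relators k"
  have wA: "w \<in> words ?A" using w(1) by (auto elim: words_mono)
  have "h_area k (pinch_cost k (length w)) ([(Gen_p, False)] @ inv_word w @ [(Gen_p, \<not> False)]) (inv_word w)"
    using w by (intro h_area_p_H[OF k]) (simp_all add: H_uminus)
  then have "word_eq ?A ?R ([(Gen_p, False)] @ inv_word w @ [(Gen_p, True)]) (inv_word w)"
    using area_eq_word_eq hydra_relators_words[OF k] by fastforce
  then have "word_eq ?A ?R (([(Gen_p, False)] @ inv_word w @ [(Gen_p, True)]) @ w) (inv_word w @ w)"
    by (intro word_eq.append word_eq.refl wA)
  moreover have "word_eq ?A ?R (inv_word w @ w) []" by (rule word_eq_inv_left[OF hydra_relators_words[OF k] wA])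
  ultimately show ?thesis unfolding comm_word_def by (auto intro: word_eq.trans)
qed

section \<open>Test words for the lower bound\<close>

lemma reduced_pos_append: "reduced ((i, True) # v) \<Longrightarrow> reduced (pos l @ (i, True) # v)"
proof (induction l)
  case (Cons j l)
  then show ?case by (cases l) auto
qed simp

lemma reduced_inv_pos: "reduced (inv_word (pos l))" "reduced ((i, False) # inv_word (pos l))"
proof -
  have *: "reduced ((i, False) # map (\<lambda>i. (i, False)) l)" for i and l :: "nat list"
    by (induction l arbitrary: i) auto
  have "inv_word (pos l) = map (\<lambda>i. (i, False)) (rev l)" by (simp add: inv_word_def pos_def rev_map)
  then show "reduced ((i, False) # inv_word (pos l))" using *[of i "rev l"] by simp
  then show "reduced (inv_word (pos l))" by (rule reduced_tl)
qed

definition qword :: "nat word" where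
  "qword = [(2, True), (1, True), (2, False)]"

text \<open>\<open>qword\<close> begins with a positive and ends with a negative letter, so nothing
  cancels against the positive word before it or the negative one after it.\<close>

lemma reduced_conj: "reduced (pos l @ qword @ inv_word (pos l))"
proof -
  have "reduced ((2, True) # (1, True) # (2, False) # inv_word (pos l))"
    using reduced_inv_pos(2)[of 2 l] by simp
  then have "reduced (pos l @ (2, True) # (1, True) # (2, False) # inv_word (pos l))" by (rule reduced_pos_append)
  then show ?thesis by (simp add: qword_def)
qed

text \<open>Conjugation by x_2 carries t to b_1 = x_1^-1 t^2, which commutes with x_1.\<close>

lemma qword_commute: "T j + eval gx qword = eval gx qword + T j"
proof -
  have x2: "T j + gx 2 = gx 2 + zm j (bb 1)"
    using bb_conj[of 1 j] by (simp only: Suc_1 numeral_2_eq_2 One_nat_def group_norm flip: bb_conj)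
  have x2': "zm j (bb 1) - gx 2 = - gx 2 + T j"
    using bb_conj[of 1 j] by (simp only: Suc_1 numeral_2_eq_2 One_nat_def group_norm flip: bb_conj)
  have b1: "zm j (bb 1) + gx 1 = gx 1 + zm j (bb 1)"
  proof (rule zm_commute[symmetric])
    show "gx 1 + bb 1 = bb 1 + gx 1"
      unfolding bb_1 add.assoc zm_x_1_T[of 1 2, unfolded zm_1, symmetric] by (simp only: group_norm)
  qed
  have q: "eval gx qword = gx 2 + gx 1 - gx 2"
    by (simp only: qword_def eval_simps if_True if_False group_norm)
  have "T j + eval gx qword = (T j + gx 2) + gx 1 - gx 2" unfolding q by (simp only: group_norm)
  also have "\<dots> = gx 2 + (zm j (bb 1) + gx 1) - gx 2" unfolding x2 by (simp only: group_norm)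
  also have "\<dots> = gx 2 + gx 1 + (zm j (bb 1) - gx 2)" unfolding b1 by (simp only: group_norm)
  also have "\<dots> = eval gx qword + T j" unfolding x2' q by (simp only: group_norm)
  finally show ?thesis .
qed

theorem dehn_hydra_lower:
  assumes k: "2 \<le> k"
  shows "ackermann k \<preceq> dehn_function (hydra_gens k) (hydra_relators k)"
proof -
  let ?A = "hydra_gens k" and ?R = "hydra_relators k"
  have k1: "1 \<le> k" using k by simp
  \<comment> \<open>The commutator below has length \<open>8 * n + 14\<close>; rounding up to
    \<open>14 * n + 14\<close> lets 14 be the constant \<open>C\<close> of the growth
    relation.\<close>
  have "ackermann k n \<le> dehn_function ?A ?R (14 * n + 14) + n + 1" for n
  proof -
    obtain l where l: "set l \<subseteq> {1..k}" "zm (- int n) (bb k) = eval gx (pos l) + T (- int (hydra_steps k n))"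
      using bb_neg_power by blast
    \<comment> \<open>\<open>B\<close> spells the power \<open>- int n\<close> of
      \<open>bb k\<close> with only \<open>2 * n\<close> letters. Conjugation by it agrees on
      \<open>qword\<close> with conjugation by the long word \<open>pos l\<close>, since the power
      of t drops out.\<close>
    define B where "B = concat (replicate n [(Gen_t, False), (Gen_a k, True)])"
    define w where "w = B @ of_gx qword @ inv_word B"
    have B: "B \<in> words (?A - {Gen_p})" unfolding B_def using k1 by (induction n) simp_all
    have lenB: "length B = 2 * n" unfolding B_def by (induction n) simp_all
    have hB: "hval B = zm (- int n) (bb k)"
    proof -
      have "hval (concat (replicate n [(Gen_t, False), (Gen_a k, True)])) = zm (int n) (- bb k)"
      proof (induction n)
        case (Suc n)
        have "hval (concat (replicate (Suc n) [(Gen_t, False), (Gen_a k, True)])) = - bb k + zm (int n) (- bb k)"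
          unfolding replicate_Suc concat.simps hval_simps(2) Suc
          by (simp only: hval_simps if_True if_False bb_def group_norm)
        also have "\<dots> = zm (int n + 1) (- bb k)" by (simp only: zm_Suc)
        finally show ?case by (simp add: add.commute)
      qed simp
      then show ?thesis unfolding B_def by (simp add: zm_uminus)
    qed
    have q: "qword \<in> words {1..k}" using k by (simp add: qword_def)
    have w: "w \<in> words (?A - {Gen_p})" unfolding w_def using B of_gx_words[OF q] by simp
    define u where "u = pos l @ qword @ inv_word (pos l)"
    have u: "u \<in> words {1..k}" "reduced u" using l(1) q reduced_conj by (simp_all add: u_def)
    have hval_w: "hval w = eval gx u"
    proof -
      define y where "y = - int (hydra_steps k n)"
      have "hval w = eval gx (pos l) + (T y + eval gx qword) - T y - eval gx (pos l)"
        unfolding w_def hval_simps hval_of_gx hB l(2) y_def by (simp only: group_norm)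
      also have "\<dots> = eval gx u" unfolding qword_commute u_def eval_simps eval_inv_word by (simp only: group_norm)
      finally show ?thesis .
    qed
    have uH: "eval gx u \<in> H k" unfolding H_def using u(1) by blast
    let ?c = "comm_word p_word w"
    have c: "?c \<in> words ?A" using w by (auto simp: comm_word_def elim: words_mono)
    have "length ?c \<le> 14 * n + 14"
      by (simp add: comm_word_def w_def lenB length_of_gx qword_def)
    moreover have "word_class ?A ?R ?c = \<one>\<^bsub>presented_group ?A ?R\<^esub>"
      unfolding word_class_eq_one_iff[OF hydra_relators_words[OF k1] c]
      by (rule comm_word_trivial[OF k1 w]) (simp add: hval_w uH)
    ultimately have "fills ?A ?R (dehn_function ?A ?R (14 * n + 14)) ?c"
      using dehn_function_fills[OF hydra_relators_words[OF k1] finite_hydra_gens c] by blast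
    from crossed_fills[OF this w] have "H_len k (eval gx u) \<le> int (dehn_function ?A ?R (14 * n + 14))"
      by (simp only: hval_w)
    then have "(LEAST N. H_norm k N (eval gx u)) \<le> dehn_function ?A ?R (14 * n + 14)"
      using uH by (simp add: H_len_def)
    moreover have "length u \<le> (LEAST N. H_norm k N (eval gx u))"
      by (rule H_length_ge[OF u H_len_Least[OF uH]])
    moreover have "length l \<le> length u" by (simp add: u_def)
    \<comment> \<open>The hydra exponent equals \<open>length l + n\<close>, so
      \<open>length l\<close> falls short of the Ackermann value by at most
      \<open>n + 1\<close>.\<close>
    moreover have "ackermann k n \<le> Suc (length l + n)"
      using hydra_steps_ge_ackermann[OF k1, of n] bb_neg_power_length[OF l(2)] by simp
    ultimately show ?thesis by simp
  qed
  then have "ackermann k n \<le> 14 * dehn_function ?A ?R (14 * n + 14) + 14 * n + 14" for n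
    by (rule order_trans) simp
  then show ?thesis unfolding growth_le_def by (intro exI[of _ 14]) simp
qed

theorem theorem1p4:
  fixes k :: nat
  assumes "k \<ge> 2"
  shows "dehn_function (hydra_gens k) (hydra_relators k) \<simeq> ackermann k"
  unfolding growth_equiv_def using dehn_hydra_upper[OF assms] dehn_hydra_lower[OF assms] by blast

end
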